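(* Let $f$ be a quasi-majority function and consider the functional voting with respect to $f$ on an $n$-vertex connected $\lambda$-expander graph $G=(V,E)$ with degree distribution $\pi$. Suppose that $d_{\max}\le C_1d_{\mathrm{ave}}$ for an arbitrary constant $C_1>0$, where $d_{\max}$ and $d_{\mathrm{ave}}$ denote the maximum and average degree of $G$. Then the following hold. (i) Suppose that $\lambda\le C_1n^{-1/4}$. Then (a) for every $A\subseteq V$, $T_{\mathrm{cons}}(A)=O(\log n)$ w.h.p.; (b) for some $A\subseteq V$, $T_{\mathrm{cons}}(A)=\Omega(\log n)$ w.h.p. (ii) Suppose that $\lambda\le C_2$ for some constant $C_2>0$ depending only on $f$. Then for every $A\subseteq V$ satisfying $|\delta(A)|\ge C_2\max\left\{\lambda^2,\sqrt{\frac{\log n}{n}}\right\}$, $T_{\mathrm{cons}}(A)=O(\log n)$ w.h.p. (iii) Suppose that $\lambda\le C_2$ for some constant $C_2>0$ depending only on $f$, and that $H_f'(0)=0$. Then for every $A\subseteq V$ satisfying $|\delta(A)|\ge C_2\max\left\{\lambda^2,\sqrt{\frac{\log n}{n}}\right\}$, it holds w.h.p. that $$T_{\mathrm{cons}}(A)=O\left(\log\log n+\log|\delta(A)|^{-1}+\frac{\log n}{\log\lambda^{-1}}\right).$$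
   Context: Graphs are finite, undirected and connected; $n=|V|$. For $v\in V$, $S\subseteq V$, $\deg_S(v)$ is the number of neighbours of $v$ in $S$. Degree distribution: $\pi(v)=\deg(v)/(2|E|)$; $\pi(A)=\sum_{v\in A}\pi(v)$; $\delta(A)=\pi(A)-\pi(V\setminus A)=2\pi(A)-1$. $G$ is a $\lambda$-expander if $\max\{|\lambda_2|,|\lambda_n|\}\le\lambda$, where $1=\lambda_1\ge\lambda_2\ge\dots\ge\lambda_n\ge-1$ are the eigenvalues of the simple random walk transition matrix $P(u,v)=\mathbf 1_{\{u,v\}\in E}/\deg(u)$. Functional voting: let $f:\mathbb R\to\mathbb R$ satisfy $f([0,1])=[0,1]$ and $f(0)=0$. Functional voting with respect to $f$ is the Markov chain $A_0,A_1,\dots$ on subsets of $V$ ($A_t$ is the set of vertices holding opinion $0$, the others hold opinion $1$) in which, given $A_t=A$ and $B=V\setminus A$, all vertices update simultaneously and independently: $v\in B$ belongs to $A_{t+1}$ with probability $f(\deg_A(v)/\deg(v))$, and $v\in A$ belongs to $V\setminus A_{t+1}$ with probability $f(\deg_B(v)/\deg(v))$. The consensus time is $T_{\mathrm{cons}}(A)=\min\{t\ge0: A_t\in\{\emptyset,V\}\}$ for the chain started at $A_0=A$. The updating function is $H_f(x)=x(1-f(1-x))+(1-x)f(x)$. Such an $f$ is quasi-majority if: (1) $f$ is $C^2$; (2) $0<f(1/2)<1$; (3) $H_f(x)<x$ for all $x\in(0,1/2)$; (4) $H_f'(1/2)>1$; (5) $H_f'(0)<1$. Conventions: "w.h.p."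 means with probability at least $1-n^{-c}$ for a constant $c>0$, and $n$ is sufficiently large. The constants hidden in $O,\Omega$, in w.h.p. and in "sufficiently large" may depend on $f$ and $C_1$ but not on $n$, $G$ or $A$. *)

theory Defs
  imports "HOL-Probability.Probability" "Jordan_Normal_Form.Char_Poly"
begin

section \<open>Graphs\<close>

text \<open>The vertex set of an \<open>n\<close>-vertex graph is \<open>{..<n}\<close>; an edge is a set of two distinct vertices.
  Fixing the labels keeps \<open>n\<close> a term, so that constants can be quantified uniformly
  over all \<open>n\<close> and all graphs.\<close>

definition connected_graph :: "nat \<Rightarrow> nat set set \<Rightarrow> bool" where
  "connected_graph n E \<longleftrightarrow>
     E \<subseteq> {{u, v} | u v. u < n \<and> v < n \<and> u \<noteq> v} \<and>
     (\<forall>u<n. \<forall>v<n. (u, v) \<in> {(x, y). {x, y} \<in> E}\<^sup>*)"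

definition deg_in :: "nat set set \<Rightarrow> nat set \<Rightarrow> nat \<Rightarrow> nat" where
  "deg_in E S v = card {u \<in> S. {u, v} \<in> E}"

definition deg :: "nat \<Rightarrow> nat set set \<Rightarrow> nat \<Rightarrow> nat" where
  "deg n E v = deg_in E {..<n} v"

definition max_deg :: "nat \<Rightarrow> nat set set \<Rightarrow> nat" where
  "max_deg n E = Max (deg n E ` {..<n})"

definition avg_deg :: "nat \<Rightarrow> nat set set \<Rightarrow> real" where
  "avg_deg n E = (\<Sum>v<n. real (deg n E v)) / real n"

definition degree_dist :: "nat \<Rightarrow> nat set set \<Rightarrow> nat \<Rightarrow> real" where
  "degree_dist n E v = real (deg n E v) / (2 * real (card E))"

definition bias :: "nat \<Rightarrow> nat set set \<Rightarrow> nat set \<Rightarrow> real" where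
  "bias n E A = (\<Sum>v\<in>A. degree_dist n E v) - (\<Sum>v\<in>{..<n} - A. degree_dist n E v)"

definition walk_matrix :: "nat \<Rightarrow> nat set set \<Rightarrow> real mat" where
  "walk_matrix n E =
     Matrix.mat n n (\<lambda>(u, v). if {u, v} \<in> E then 1 / real (deg n E u) else 0)"

text \<open>The real eigenvalues with algebraic multiplicity, in descending order. All eigenvalues of
  a walk matrix are real, so the list then has length \<open>n\<close>. Lists are indexed from 0:
  the second largest eigenvalue is at index 1 and the smallest at index \<open>n - 1\<close>, for \<open>n \<ge> 2\<close>.\<close>

definition eigenvalues_desc :: "real mat \<Rightarrow> real list" where
  "eigenvalues_desc P = rev (sorted_list_of_multiset (proots (char_poly P)))"

definition expander :: "real \<Rightarrow> nat \<Rightarrow> nat set set \<Rightarrow> bool" where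
  "expander lam n E \<longleftrightarrow>
     (let es = eigenvalues_desc (walk_matrix n E)
      in max \<bar>es ! 1\<bar> \<bar>es ! (n - 1)\<bar> \<le> lam)"


section \<open>Functional voting\<close>

definition voting_function :: "(real \<Rightarrow> real) \<Rightarrow> bool" where
  "voting_function f \<longleftrightarrow> f ` {0..1} = {0..1} \<and> f 0 = 0"

definition updating_function :: "(real \<Rightarrow> real) \<Rightarrow> real \<Rightarrow> real" where
  "updating_function f x = x * (1 - f (1 - x)) + (1 - x) * f x"

definition C2_function :: "(real \<Rightarrow> real) \<Rightarrow> bool" where
  "C2_function f \<longleftrightarrow>
     (\<exists>f' f''. (\<forall>x. (f has_real_derivative f' x) (at x)) \<and>
               (\<forall>x. (f' has_real_derivative f'' x) (at x)) \<and>
               continuous_on UNIV f'')"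

definition quasi_majority :: "(real \<Rightarrow> real) \<Rightarrow> bool" where
  "quasi_majority f \<longleftrightarrow>
     voting_function f \<and>
     C2_function f \<and>
     0 < f (1/2) \<and> f (1/2) < 1 \<and>
     (\<forall>x\<in>{0<..<1/2}. updating_function f x < x) \<and>
     deriv (updating_function f) (1/2) > 1 \<and>
     deriv (updating_function f) 0 < 1"

text \<open>The probability that \<open>v\<close> holds opinion 0 after one round, if \<open>A\<close> is the set of vertices
  that hold opinion 0 before it.\<close>

definition next_zero_prob ::
    "(real \<Rightarrow> real) \<Rightarrow> nat \<Rightarrow> nat set set \<Rightarrow> nat set \<Rightarrow> nat \<Rightarrow> real" where
  "next_zero_prob f n E A v =
     (if v \<in> A then 1 - f (real (deg_in E ({..<n} - A) v) / real (deg n E v))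
      else f (real (deg_in E A v) / real (deg n E v)))"

definition voting_step ::
    "(real \<Rightarrow> real) \<Rightarrow> nat \<Rightarrow> nat set set \<Rightarrow> nat set \<Rightarrow> nat set pmf" where
  "voting_step f n E A =
     map_pmf (\<lambda>b. {v \<in> {..<n}. b v})
       (Pi_pmf {..<n} False (\<lambda>v. bernoulli_pmf (next_zero_prob f n E A v)))"

text \<open>Trajectories are functions \<open>\<omega>\<close> with \<open>\<omega> t = A\<^sub>t\<close>. The conditional law of \<open>A\<^sub>t\<close> given
  \<open>A\<^sub>0, \<dots>, A\<^bsub>t-1\<^esub>\<close>, and the law of the whole chain that the Ionescu-Tulcea theorem builds from it.\<close>

definition voting_kernel ::
    "(real \<Rightarrow> real) \<Rightarrow> nat \<Rightarrow> nat set set \<Rightarrow> nat set \<Rightarrow> nat \<Rightarrow> (nat \<Rightarrow> nat set) \<Rightarrow> nat set measure"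
  where
  "voting_kernel f n E A t \<omega> =
     measure_pmf (case t of 0 \<Rightarrow> return_pmf A | Suc s \<Rightarrow> voting_step f n E (\<omega> s))"

definition voting_chain ::
    "(real \<Rightarrow> real) \<Rightarrow> nat \<Rightarrow> nat set set \<Rightarrow> nat set \<Rightarrow> (nat \<Rightarrow> nat set) measure" where
  "voting_chain f n E A =
     projective_family.lim UNIV
       (Ionescu_Tulcea.CI (voting_kernel f n E A) (\<lambda>_. count_space UNIV))
       (\<lambda>_. count_space UNIV)"

lemma Ionescu_Tulcea_voting_kernel:
  "Ionescu_Tulcea (voting_kernel f n E A) (\<lambda>_. count_space UNIV)"
proof (rule Ionescu_Tulcea.intro)
  fix t :: nat
  show "voting_kernel f n E A t \<in>
      Pi\<^sub>M {0..<t} (\<lambda>_. count_space UNIV) \<rightarrow>\<^sub>M subprob_algebra (count_space UNIV)"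
  proof (cases t)
    case 0
    then show ?thesis
      by (simp add: voting_kernel_def[abs_def] measure_pmf_in_subprob_algebra)
  next
    case (Suc s)
    have "(\<lambda>\<omega>. \<omega> s) \<in> Pi\<^sub>M {0..<t} (\<lambda>_. count_space UNIV) \<rightarrow>\<^sub>M count_space UNIV"
      using Suc by (intro measurable_component_singleton) auto
    moreover have "(\<lambda>S. measure_pmf (voting_step f n E S)) \<in>
        count_space UNIV \<rightarrow>\<^sub>M subprob_algebra (count_space UNIV)"
      by (simp add: measure_pmf_in_subprob_algebra)
    ultimately show ?thesis
      unfolding Suc voting_kernel_def[abs_def] nat.case by (rule measurable_compose)
  qed
qed (simp add: voting_kernel_def measure_pmf.prob_space_axioms)

lemma emeasure_voting_chain_cylinder:
  "emeasure (voting_chain f n E A) {\<omega> \<in> space (voting_chain f n E A). \<forall>i\<le>t. \<omega> i = s i} =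
     (if s 0 = A then \<Prod>i<t. ennreal (pmf (voting_step f n E (s i)) (s (Suc i))) else 0)"
proof -
  let ?K = "voting_kernel f n E A" and ?M = "\<lambda>_::nat. count_space (UNIV :: nat set set)"
  interpret IT: Ionescu_Tulcea ?K ?M
    by (rule Ionescu_Tulcea_voting_kernel)
  let ?X = "\<lambda>m. PiE {0..<m} (\<lambda>i. {s i})"
  have X: "?X m \<in> sets (PiM {0..<m} ?M)" for m
    by (intro sets_PiM_I_finite) auto
  have sp: "space (voting_chain f n E A) = UNIV"
    unfolding voting_chain_def IT.PF.space_lim by (simp add: space_PiM)
  have "{\<omega> \<in> space (voting_chain f n E A). \<forall>i\<le>t. \<omega> i = s i}
      = prod_emb UNIV ?M {0..<Suc t} (?X (Suc t))"
    unfolding sp by (auto simp: prod_emb_def restrict_PiE_iff less_Suc_eq_le PiE_iff)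
  then have "emeasure (voting_chain f n E A) {\<omega> \<in> space (voting_chain f n E A). \<forall>i\<le>t. \<omega> i = s i}
      = emeasure (IT.CI {0..<Suc t}) (?X (Suc t))"
    unfolding voting_chain_def by (simp only: IT.lim[OF _ X] finite_atLeastLessThan)
  also have "\<dots> = emeasure (IT.C 0 (Suc t) (\<lambda>_. undefined)) (?X (Suc t))"
    by (subst IT.emeasure_CI[OF subset_refl X]) (simp add: prod_emb_id[OF] PiE_mono prod_emb_id)
  also have "\<dots> = (if s 0 = A then \<Prod>i<t. ennreal (pmf (voting_step f n E (s i)) (s (Suc i))) else 0)"
  proof -
    have "emeasure (IT.C 0 m (\<lambda>_. undefined)) (?X m)
        = (\<Prod>i<m. emeasure (?K i (restrict s {0..<i})) {s i})" for m
    proof (induction m)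
      case 0
      then show ?case by (simp add: PiM_empty)
    next
      case (Suc m)
      let ?u = "\<lambda>_::nat. undefined :: nat set"
      have u: "?u \<in> space (PiM {0..<0} ?M)" by (simp add: space_PiM)
      have "emeasure (IT.C 0 (Suc m) ?u) (?X (Suc m)) =
          (\<integral>\<^sup>+x. emeasure (IT.eP m x) (?X (Suc m)) \<partial>IT.C 0 m ?u)"
        using X[of "Suc m"] IT.space_C[OF u, of m] u
        by (simp, subst emeasure_bind[where N="PiM {0..<Suc m} ?M"])
           (auto simp: measurable_cong_sets[OF IT.sets_C[OF u]] space_PiM)
      also have "\<dots> = (\<integral>\<^sup>+x. emeasure (?K m (restrict s {0..<m})) {s m} * indicator (?X m) x \<partial>IT.C 0 m ?u)"
      proof (rule nn_integral_cong)
        fix x assume "x \<in> space (IT.C 0 m ?u)"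
        then have x: "x \<in> space (PiM {0..<m} ?M)" using IT.space_C[OF u, of m] by simp
        then have xe: "x \<in> extensional {0..<m}" by (simp add: space_PiM PiE_iff)
        have vim: "(\<lambda>y. x(m := y)) -` ?X (Suc m) \<inter> space (?M m) = (if x \<in> ?X m then {s m} else {})"
          using xe by (auto simp: PiE_iff extensional_def less_Suc_eq atLeastLessThanSuc split: if_splits)
        have "x = restrict s {0..<m}" if "x \<in> ?X m"
          using that by (intro ext) (auto simp: PiE_iff extensional_def restrict_def)
        then show "emeasure (IT.eP m x) (?X (Suc m)) =
            emeasure (?K m (restrict s {0..<m})) {s m} * indicator (?X m) x"
          unfolding IT.emeasure_eP[OF x X] vim by (auto split: split_indicator)
      qed
      also have "\<dots> = emeasure (?K m (restrict s {0..<m})) {s m} * emeasure (IT.C 0 m ?u) (?X m)"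
        using X[of m] IT.sets_C[OF u, of m] by (intro nn_integral_cmult_indicator) simp
      finally show ?case by (simp only: Suc.IH prod.lessThan_Suc mult.commute)
    qed
    from this[of "Suc t"] show ?thesis
      by (simp add: prod.lessThan_Suc_shift voting_kernel_def emeasure_pmf_single pmf_return del: prod.lessThan_Suc IT.C.simps)
  qed
  finally show ?thesis .
qed

definition T_cons :: "nat \<Rightarrow> (nat \<Rightarrow> nat set) \<Rightarrow> enat" where
  "T_cons n \<omega> = Inf {enat t | t. \<omega> t = {} \<or> \<omega> t = {..<n}}"

end

theory Submission
  imports Defs "HOL-Real_Asymp.Real_Asymp"
begin

text \<open>Write \<open>\<delta>\<close> for the bias and \<open>a = (1 - \<bar>\<delta>\<bar>) / 2\<close> for the mass of the minority. Expanding \<open>f\<close> to second order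
  at the mass of \<open>A\<close> and using that the walk contracts mean-zero functions by \<open>\<lambda>\<close> shows that one round
  moves the expected minority mass to \<open>H\<^sub>f a\<close> up to an error \<open>O (\<lambda> (\<bar>\<delta>\<bar> + \<lambda>) a)\<close>, and the conditions on \<open>H\<^sub>f\<close> amount
  to \<open>H\<^sub>f a \<le> a - \<epsilon> a (1 - 2 a)\<close>. With Hoeffding's inequality, the potential \<open>(1 - \<bar>\<delta>\<bar>) / max \<bar>\<delta>\<bar> L\<close> therefore
  decreases by a constant factor in expectation, both when \<open>\<bar>\<delta>\<bar>\<close> is small (where \<open>\<bar>\<delta>\<bar>\<close> grows geometrically) and
  near consensus (where \<open>1 - \<bar>\<delta>\<bar>\<close> decays geometrically). It ranges between powers of \<open>n\<close>, so
  consensus takes \<open>O (log n)\<close> rounds. For a balanced start take \<open>L\<close> of order \<open>1 / \<surd>n\<close>; below \<open>L\<close> the potential still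
  contracts, because the fluctuations exceed any fixed multiple of \<open>1 / \<surd>n\<close> with constant probability,
  which follows by comparing the product measure of a round with a slightly tilted one.
  When \<open>H\<^sub>f' 0 = 0\<close> the minority mass is squared in each round until it reaches \<open>\<lambda>\<close> and then shrinks by a
  factor \<open>O (\<lambda>)\<close> per round. The lower bound starts from a nearly balanced set, since \<open>\<bar>\<delta>\<bar>\<close> grows by at
  most a constant factor per round.\<close>

section \<open>Quasi-majority functions\<close>

text \<open>Two error terms per round dictate the hypotheses. The drift error is proportional to
  \<open>lam * (|\<delta>| + lam)\<close> times the minority mass: its first part is absorbed by the
  gap of \<open>H\<close> once \<open>lam\<close> is small, its second only where |\<delta>|
  dominates \<open>lam^2\<close>. The fluctuations have size 1 / sqrt n. Under
  \<open>lam <= C1 * n powr (-1/4)\<close> both floors are of order 1 / sqrt n, so chance alone can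
  lift the bias above them. At that scale a round fails with constant probability, which rules out a
  union bound over rounds; a potential averages over such failures, since a failure leaves it at
  most 1 / L. For a biased start the region |\<delta>| >= L is left with only polynomially small
  probability per round, which is what the threshold sqrt (log n / n) provides, and these exits are
  summed over the rounds. The numerator lets one potential serve until consensus: a dissenting set
  has 1 - |\<delta>| >= 2 / n^2, so consensus is forced once the potential, scaled by n^2, drops
  below 1. The estimates concern \<open>surv\<close>, a recursion of one-step expectations;
  \<open>measure_voting_chain_surv\<close> links it to the path measure.\<close>

lemma deriv_quotient_less:
  fixes f :: "real \<Rightarrow> real"
  assumes "(f has_real_derivative D) (at x)" "D < c"
  shows "\<exists>d>0. \<forall>h. h \<noteq> 0 \<and> \<bar>h\<bar> < d \<longrightarrow> (f (x + h) - f x) / h < c"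
proof -
  have "((\<lambda>h. (f (x + h) - f x) / h) \<longlongrightarrow> D) (at 0)"
    using assms(1) by (simp add: DERIV_def)
  then have "\<forall>\<^sub>F h in at 0. (f (x + h) - f x) / h < c"
    using assms(2) by (rule order_tendstoD)
  then show ?thesis
    by (auto simp: eventually_at dist_real_def)
qed

text \<open>Compactness of [0,1] turns continuity of \<open>f''\<close> into bounds. A single
  \<open>K\<close> serves all of them, and \<open>K >= 1\<close> lets it dominate plain constants as
  well. The Taylor bound is the mean value inequality for \<open>z -> f z - f' y * z\<close> on the
  segment from \<open>x\<close> to \<open>y\<close>, where the derivative is at most
  \<open>K * |x - y|\<close>.\<close>

lemma C2_function_bounds:
  assumes "C2_function f"
  obtains f' K where
    "\<And>x. (f has_real_derivative f' x) (at x)"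
    "K \<ge> 1"
    "\<And>x y. \<lbrakk>x \<in> {0..1}; y \<in> {0..1}\<rbrakk> \<Longrightarrow> \<bar>f' x - f' y\<bar> \<le> K * \<bar>x - y\<bar>"
    "\<And>x y. \<lbrakk>x \<in> {0..1}; y \<in> {0..1}\<rbrakk> \<Longrightarrow> \<bar>f x - f y - f' y * (x - y)\<bar> \<le> K * (x - y)\<^sup>2"
    "\<And>x. x \<in> {0..1} \<Longrightarrow> \<bar>f' x\<bar> \<le> K"
proof -
  obtain f' f'' where f': "\<And>x. (f has_real_derivative f' x) (at x)"
    and f'': "\<And>x. (f' has_real_derivative f'' x) (at x)" and cont: "continuous_on UNIV f''"
    using assms unfolding C2_function_def by blast
  have bdd: "\<exists>B. \<forall>x\<in>{0..1::real}. \<bar>g x\<bar> \<le> B" if "continuous_on UNIV g" for g :: "real \<Rightarrow> real"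
  proof -
    have "compact (g ` {0..1})"
      by (intro compact_continuous_image continuous_on_subset[OF that]) auto
    then have "bounded (g ` {0..1})" by (rule compact_imp_bounded)
    then show ?thesis by (auto simp: bounded_iff)
  qed
  have "continuous_on UNIV f'"
    using f'' by (meson DERIV_isCont continuous_at_imp_continuous_on)
  then obtain B1 where B1: "\<And>x. x \<in> {0..1} \<Longrightarrow> \<bar>f' x\<bar> \<le> B1" using bdd by blast
  obtain B2 where B2: "\<And>x. x \<in> {0..1} \<Longrightarrow> \<bar>f'' x\<bar> \<le> B2" using bdd[OF cont] by blast
  define K where "K = max 1 (max B1 B2)"
  have lip: "\<bar>f' x - f' y\<bar> \<le> K * \<bar>x - y\<bar>" if "x \<in> {0..1}" "y \<in> {0..1}" for x y
  proof -
    have "norm (f' x - f' y) \<le> K * norm (x - y)"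
    proof (rule field_differentiable_bound[of "{0..1}" f' f''])
      show "(f' has_field_derivative f'' z) (at z within {0..1})" for z
        using f'' has_field_derivative_at_within by blast
      show "norm (f'' z) \<le> K" if "z \<in> {0..1}" for z
        using B2[OF that] by (simp add: K_def)
    qed (use that in auto)
    then show ?thesis by simp
  qed
  have taylor: "\<bar>f x - f y - f' y * (x - y)\<bar> \<le> K * (x - y)\<^sup>2" if xy: "x \<in> {0..1}" "y \<in> {0..1}" for x y
  proof -
    let ?S = "{min x y..max x y}"
    have "norm ((f x - f' y * x) - (f y - f' y * y)) \<le> K * \<bar>x - y\<bar> * norm (x - y)"
    proof (rule field_differentiable_bound[of ?S "\<lambda>z. f z - f' y * z" "\<lambda>z. f' z - f' y"])
      show "((\<lambda>z. f z - f' y * z) has_field_derivative f' z - f' y) (at z within ?S)" for z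
        by (rule has_field_derivative_at_within) (use f'[of z] in \<open>auto intro!: derivative_eq_intros\<close>)
      show "norm (f' z - f' y) \<le> K * \<bar>x - y\<bar>" if "z \<in> ?S" for z
      proof -
        have "\<bar>f' z - f' y\<bar> \<le> K * \<bar>z - y\<bar>"
          using that xy by (intro lip) auto
        also have "\<dots> \<le> K * \<bar>x - y\<bar>"
          using that by (intro mult_left_mono) (auto simp: K_def)
        finally show ?thesis by simp
      qed
    qed auto
    moreover have "(f x - f' y * x) - (f y - f' y * y) = f x - f y - f' y * (x - y)"
      by (simp add: algebra_simps)
    moreover have "K * \<bar>x - y\<bar> * norm (x - y) = K * (x - y)\<^sup>2"
      by (simp add: power2_eq_square mult.assoc)
    ultimately show ?thesis by (metis real_norm_def)
  qed
  have "K \<ge> 1" by (simp add: K_def)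
  moreover have "\<bar>f' x\<bar> \<le> K" if "x \<in> {0..1}" for x
    using B1[OF that] by (simp add: K_def)
  ultimately show ?thesis using that f' lip taylor by blast
qed

locale quasi_majority_voting =
  fixes f f' :: "real \<Rightarrow> real" and K :: real
  assumes qm: "quasi_majority f"
    and f_deriv: "\<And>x. (f has_real_derivative f' x) (at x)"
    and K_ge: "K \<ge> 1"
    and f'_lipschitz: "\<And>x y. \<lbrakk>x \<in> {0..1}; y \<in> {0..1}\<rbrakk> \<Longrightarrow> \<bar>f' x - f' y\<bar> \<le> K * \<bar>x - y\<bar>"
    and f_taylor: "\<And>x y. \<lbrakk>x \<in> {0..1}; y \<in> {0..1}\<rbrakk> \<Longrightarrow> \<bar>f x - f y - f' y * (x - y)\<bar> \<le> K * (x - y)\<^sup>2"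
    and f'_bound: "\<And>x. x \<in> {0..1} \<Longrightarrow> \<bar>f' x\<bar> \<le> K"
begin

abbreviation "H \<equiv> updating_function f"

definition H' where "H' x = 1 - f (1 - x) + x * f' (1 - x) - f x + (1 - x) * f' x"

lemma f_range: "x \<in> {0..1} \<Longrightarrow> 0 \<le> f x \<and> f x \<le> 1"
  using qm unfolding quasi_majority_def voting_function_def by fastforce

lemma f_0: "f 0 = 0"
  using qm unfolding quasi_majority_def voting_function_def by auto

lemma H_deriv: "(H has_real_derivative H' x) (at x)"
proof -
  have "((\<lambda>x. f (1 - x)) has_real_derivative - f' (1 - x)) (at x)"
    by (rule DERIV_cong[OF DERIV_chain2[OF f_deriv]]) (auto intro!: derivative_eq_intros)
  then have "((\<lambda>x. x * (1 - f (1 - x)) + (1 - x) * f x) has_real_derivative H' x) (at x)"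
    using f_deriv[of x] unfolding H'_def
    by (auto intro!: derivative_eq_intros simp: algebra_simps)
  then show ?thesis by (simp add: updating_function_def[abs_def])
qed

lemma H_0: "H 0 = 0"
  by (simp add: updating_function_def f_0)

lemma H_half: "H (1/2) = 1/2"
  by (simp add: updating_function_def field_simps)

lemma H_flip: "H (1 - x) = 1 - H x"
  by (simp add: updating_function_def algebra_simps)

lemma f_lipschitz:
  assumes "x \<in> {0..1}" "y \<in> {0..1}"
  shows "\<bar>f x - f y\<bar> \<le> K * \<bar>x - y\<bar>"
proof -
  have "norm (f x - f y) \<le> K * norm (x - y)"
    by (rule field_differentiable_bound[of "{0..1}" f f'])
      (use assms f'_bound in \<open>auto intro: has_field_derivative_at_within f_deriv\<close>)
  then show ?thesis by simp
qed

lemma H'_lipschitz: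
  assumes "x \<in> {0..1}" "y \<in> {0..1}"
  shows "\<bar>H' x - H' y\<bar> \<le> 6 * K * \<bar>x - y\<bar>"
proof -
  have 1: "\<bar>f (1 - x) - f (1 - y)\<bar> \<le> K * \<bar>x - y\<bar>"
    using f_lipschitz[of "1 - x" "1 - y"] assms by (auto simp: abs_minus_commute)
  have 2: "\<bar>f x - f y\<bar> \<le> K * \<bar>x - y\<bar>" by (rule f_lipschitz[OF assms])
  have 3: "\<bar>f' (1 - x) - f' (1 - y)\<bar> \<le> K * \<bar>x - y\<bar>"
    using f'_lipschitz[of "1 - x" "1 - y"] assms by (auto simp: abs_minus_commute)
  have 4: "\<bar>f' x - f' y\<bar> \<le> K * \<bar>x - y\<bar>" by (rule f'_lipschitz[OF assms])
  have prod: "\<bar>a * b - c * d\<bar> \<le> \<bar>b - d\<bar> + \<bar>a - c\<bar> * K"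
    if "\<bar>a\<bar> \<le> 1" "\<bar>d\<bar> \<le> K" for a b c d :: real
  proof -
    have "a * b - c * d = a * (b - d) + (a - c) * d" by (simp add: algebra_simps)
    also have "\<bar>\<dots>\<bar> \<le> \<bar>a\<bar> * \<bar>b - d\<bar> + \<bar>a - c\<bar> * \<bar>d\<bar>"
      by (metis abs_mult abs_triangle_ineq)
    also have "\<dots> \<le> 1 * \<bar>b - d\<bar> + \<bar>a - c\<bar> * K"
      using that by (intro add_mono mult_mono) auto
    finally show ?thesis by simp
  qed
  have 5: "\<bar>x * f' (1 - x) - y * f' (1 - y)\<bar> \<le> K * \<bar>x - y\<bar> + \<bar>x - y\<bar> * K"
  proof -
    have "\<bar>x\<bar> \<le> 1" "\<bar>f' (1 - y)\<bar> \<le> K" using assms f'_bound[of "1 - y"] by auto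
    from prod[OF this, of "f' (1 - x)" y] show ?thesis using 3 by linarith
  qed
  have 6: "\<bar>(1 - x) * f' x - (1 - y) * f' y\<bar> \<le> K * \<bar>x - y\<bar> + \<bar>x - y\<bar> * K"
  proof -
    have "\<bar>1 - x\<bar> \<le> 1" "\<bar>f' y\<bar> \<le> K" "\<bar>1 - x - (1 - y)\<bar> = \<bar>x - y\<bar>"
      using assms f'_bound[of y] by auto
    with prod[OF this(1,2), of "f' x" "1 - y"] show ?thesis using 4 by (simp only:)
  qed
  have "H' x - H' y = - (f (1 - x) - f (1 - y)) + (x * f' (1 - x) - y * f' (1 - y)) - (f x - f y)
      + ((1 - x) * f' x - (1 - y) * f' y)"
    by (simp add: H'_def)
  then have "\<bar>H' x - H' y\<bar> \<le> \<bar>f (1 - x) - f (1 - y)\<bar> + \<bar>x * f' (1 - x) - y * f' (1 - y)\<bar>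
      + \<bar>f x - f y\<bar> + \<bar>(1 - x) * f' x - (1 - y) * f' y\<bar>"
    by linarith
  then show ?thesis using 1 2 5 6 by (simp add: algebra_simps)
qed

lemma H'_bound: "x \<in> {0..1} \<Longrightarrow> \<bar>H' x\<bar> \<le> 3 * K"
proof -
  assume x: "x \<in> {0..1}"
  have "\<bar>x * f' (1 - x) + (1 - x) * f' x\<bar> \<le> \<bar>x\<bar> * \<bar>f' (1 - x)\<bar> + \<bar>1 - x\<bar> * \<bar>f' x\<bar>"
    by (metis abs_mult abs_triangle_ineq)
  also have "\<dots> \<le> x * K + (1 - x) * K"
    using x f'_bound[of x] f'_bound[of "1 - x"] by (intro add_mono mult_mono) auto
  finally have "\<bar>x * f' (1 - x) + (1 - x) * f' x\<bar> \<le> K" by (simp add: algebra_simps)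
  then show ?thesis
    using f_range[of x] f_range[of "1 - x"] x K_ge by (auto simp: H'_def abs_le_iff)
qed

text \<open>Mean value inequality at the fixed point 1/2: \<open>H\<close> enlarges the bias at most
  \<open>3 * K\<close> times.\<close>

lemma H_expansion_bound:
  assumes "a \<in> {0..1}"
  shows "\<bar>2 * H a - 1\<bar> \<le> 3 * K * \<bar>2 * a - 1\<bar>"
proof -
  have "norm (H a - H (1/2)) \<le> 3 * K * norm (a - 1/2)"
    by (rule field_differentiable_bound[of "{0..1}" H H'])
      (use assms H'_bound in \<open>auto intro: has_field_derivative_at_within H_deriv\<close>)
  then have "2 * \<bar>H a - 1/2\<bar> \<le> 3 * K * (2 * \<bar>a - 1/2\<bar>)"
    unfolding H_half real_norm_def by simp
  moreover have "2 * \<bar>H a - 1/2\<bar> = \<bar>2 * H a - 1\<bar>" by (simp add: abs_if)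
  moreover have "2 * \<bar>a - 1/2\<bar> = \<bar>2 * a - 1\<bar>" by (simp add: abs_if)
  ultimately show ?thesis by simp
qed

lemma H_quadratic:
  assumes "deriv H 0 = 0" "a \<in> {0..1/2}"
  shows "H a \<le> 6 * K * a\<^sup>2"
proof -
  have H'0: "H' 0 = 0" using assms(1) DERIV_imp_deriv[OF H_deriv[of 0]] by simp
  have "norm (H a - H 0) \<le> (6 * K * a) * norm (a - 0)"
  proof (rule field_differentiable_bound[of "{0..a}" H H'])
    show "norm (H' z) \<le> 6 * K * a" if "z \<in> {0..a}" for z
    proof -
      have "\<bar>H' z\<bar> \<le> 6 * K * z"
        using H'_lipschitz[of z 0] that assms H'0 by auto
      also have "\<dots> \<le> 6 * K * a" using that K_ge by auto
      finally show ?thesis by simp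
    qed
  qed (use assms in \<open>auto intro: has_field_derivative_at_within H_deriv\<close>)
  then show ?thesis using assms H_0 by (simp add: power2_eq_square)
qed

text \<open>The term \<open>a * (1 - 2 * a)\<close> vanishes to first order at both ends, so a
  linear margin is needed at each: \<open>H' 0 < 1\<close> supplies it at 0 and
  \<open>H' (1/2) > 1\<close> at 1/2. Between them \<open>a - H a\<close> is continuous and positive
  on a compact interval, hence bounded below by some \<open>k > 0\<close>.\<close>

lemma H_contraction:
  obtains e where "0 < e" "e \<le> 1" "\<And>a. a \<in> {0..1/2} \<Longrightarrow> H a \<le> a - e * a * (1 - 2 * a)"
proof -
  have H'0: "H' 0 < 1" and H'half: "H' (1/2) > 1"
    using qm DERIV_imp_deriv[OF H_deriv] unfolding quasi_majority_def by metis+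
  have H_less: "H x < x" if "0 < x" "x < 1/2" for x
    using qm that unfolding quasi_majority_def by auto
  obtain d1 where d1: "d1 > 0" "\<And>h. h \<noteq> 0 \<and> \<bar>h\<bar> < d1 \<Longrightarrow> (H (0 + h) - H 0) / h < (1 + H' 0) / 2"
    using deriv_quotient_less[OF H_deriv[of 0], of "(1 + H' 0) / 2"] H'0 by auto
  \<comment> \<open>\<open>deriv_quotient_less\<close> bounds quotients from above; for a lower
    bound on the slope at 1/2 it is applied to \<open>- H\<close>.\<close>
  have "((\<lambda>x. - H x) has_real_derivative - H' (1/2)) (at (1/2))"
    by (intro derivative_intros H_deriv)
  from deriv_quotient_less[OF this, of "- (1 + H' (1/2)) / 2"] H'half
  obtain d2 where d2: "d2 > 0"
    "\<And>h. h \<noteq> 0 \<and> \<bar>h\<bar> < d2 \<Longrightarrow> (- H (1/2 + h) + H (1/2)) / h < - (1 + H' (1/2)) / 2"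
    by auto
  define e1 where "e1 = (1 - H' 0) / 2"
  define e2 where "e2 = (H' (1/2) - 1) / 2"
  have e12: "e1 > 0" "e2 > 0" using H'0 H'half by (auto simp: e1_def e2_def)
  have near0: "H a \<le> a - e1 * a" if "0 \<le> a" "a < d1" for a
  proof (cases "a = 0")
    case False
    then have "H a / a < (1 + H' 0) / 2" using d1(2)[of a] that H_0 by simp
    then have "H a < (1 + H' 0) / 2 * a" using False that by (simp add: divide_less_eq)
    then show ?thesis by (simp add: e1_def field_simps)
  qed (simp add: H_0)
  have near_half: "H a \<le> a - e2 * (1/2 - a)" if "a \<le> 1/2" "1/2 - a < d2" for a
  proof (cases "a = 1/2")
    case False
    then have neg: "a - 1/2 < 0" using that by simp
    have "(- H a + 1/2) / (a - 1/2) < - (1 + H' (1/2)) / 2"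
      using d2(2)[of "a - 1/2"] that False H_half by simp
    then have "- H a + 1/2 > - (1 + H' (1/2)) / 2 * (a - 1/2)"
      using neg by (simp add: neg_divide_less_eq)
    then show ?thesis by (simp add: e2_def field_simps)
  next
    case True
    show ?thesis unfolding True H_half by simp
  qed
  define I where "I = {d1..1/2 - d2}"
  have "\<exists>k>0. \<forall>a\<in>I. H a \<le> a - k"
  proof (cases "I = {}")
    case False
    have "continuous_on I (\<lambda>a. a - H a)"
      using H_deriv by (intro continuous_intros) (meson DERIV_isCont continuous_at_imp_continuous_on)
    then obtain x where x: "x \<in> I" "\<And>a. a \<in> I \<Longrightarrow> x - H x \<le> a - H a"
      using continuous_attains_inf[of I "\<lambda>a. a - H a"] False unfolding I_def by auto
    have "x - H x > 0" using H_less[of x] x(1) d1(1) d2(1) by (auto simp: I_def)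
    then show ?thesis using x(2) by (intro exI[of _ "x - H x"]) force
  qed (auto intro: exI[of _ 1])
  then obtain k where k: "k > 0" "\<And>a. a \<in> I \<Longrightarrow> H a \<le> a - k" by blast
  define e where "e = min 1 (min e1 (min e2 k))"
  show ?thesis
  proof (rule that[of e])
    fix a :: real assume a: "a \<in> {0..1/2}"
    have e: "0 < e" "e \<le> e1" "e \<le> e2" "e \<le> k" using e12 k(1) by (auto simp: e_def)
    have a2: "0 \<le> a * (1 - 2 * a)" using a by auto
    consider "a < d1" | "1/2 - a < d2" | "a \<in> I" by (force simp: I_def)
    then show "H a \<le> a - e * a * (1 - 2 * a)"
    proof cases
      case 1
      have "e * a * (1 - 2 * a) \<le> e1 * a * 1" using a e by (intro mult_mono) auto
      then show ?thesis using near0[of a] 1 a by auto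
    next
      case 2
      have "e * a * (1 - 2 * a) \<le> e2 * (1/2) * (1 - 2 * a)" using a e by (intro mult_mono) auto
      then show ?thesis using near_half[of a] 2 a by (auto simp: algebra_simps)
    next
      case 3
      have "e * a * (1 - 2 * a) \<le> k * 1 * 1" using a e by (intro mult_mono) auto
      then show ?thesis using k(2)[of a] 3 a by auto
    qed
  qed (use e12 k(1) in \<open>auto simp: e_def\<close>)
qed

end

lemma quasi_majority_voting_exists:
  assumes "quasi_majority f"
  obtains f' K where "quasi_majority_voting f f' K"
proof -
  have "C2_function f" using assms by (simp add: quasi_majority_def)
  from C2_function_bounds[OF this] obtain f' K where
    "\<And>x. (f has_real_derivative f' x) (at x)"
    "K \<ge> 1"
    "\<And>x y. \<lbrakk>x \<in> {0..1}; y \<in> {0..1}\<rbrakk> \<Longrightarrow> \<bar>f' x - f' y\<bar> \<le> K * \<bar>x - y\<bar>"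
    "\<And>x y. \<lbrakk>x \<in> {0..1}; y \<in> {0..1}\<rbrakk> \<Longrightarrow> \<bar>f x - f y - f' y * (x - y)\<bar> \<le> K * (x - y)\<^sup>2"
    "\<And>x. x \<in> {0..1} \<Longrightarrow> \<bar>f' x\<bar> \<le> K" by metis
  with assms show ?thesis
    by (intro that[of f' K] quasi_majority_voting.intro) auto
qed

section \<open>The random walk on an expander\<close>

lemma finite_argmax:
  fixes g :: "'a \<Rightarrow> real"
  assumes "finite A" "w \<in> A"
  obtains v where "v \<in> A" "\<And>u. u \<in> A \<Longrightarrow> g u \<le> g v"
proof -
  have "Max (g ` A) \<in> g ` A" using assms by (intro Max_in) auto
  then obtain v where "v \<in> A" "g v = Max (g ` A)" by auto
  then show ?thesis using assms that[of v] by auto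
qed

locale voting_graph =
  fixes n :: nat and E :: "nat set set"
  assumes conn: "connected_graph n E" and n_ge_2: "n \<ge> 2"
begin

definition adj :: "nat \<Rightarrow> nat \<Rightarrow> real" where
  "adj u v = (if {u, v} \<in> E then 1 else 0)"

abbreviation "d v \<equiv> real (deg n E v)"
abbreviation "\<pi> v \<equiv> degree_dist n E v"

text \<open>The transition operator of the walk on functions. It reads only values at vertices, and
  \<open>W (indicator A) v\<close> is the fraction of the neighbours of \<open>v\<close> that lie in
  \<open>A\<close>.\<close>

definition W :: "(nat \<Rightarrow> real) \<Rightarrow> nat \<Rightarrow> real" where
  "W g u = (\<Sum>v<n. adj u v * g v) / d u"

definition ip :: "(nat \<Rightarrow> real) \<Rightarrow> (nat \<Rightarrow> real) \<Rightarrow> real" where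
  "ip g h = (\<Sum>v<n. \<pi> v * g v * h v)"

lemma adj_commute: "adj u v = adj v u"
  by (simp add: adj_def insert_commute)

lemma adj_nonneg: "adj u v \<ge> 0"
  by (simp add: adj_def)

lemma edgeE:
  assumes "e \<in> E" obtains u v where "e = {u, v}" "u < n" "v < n" "u \<noteq> v"
  using conn assms unfolding connected_graph_def by blast

lemma edgeD:
  assumes "{u, v} \<in> E" shows "u < n" "v < n" "u \<noteq> v"
proof -
  obtain x y where "{u, v} = {x, y}" "x < n" "y < n" "x \<noteq> y" by (rule edgeE[OF assms])
  then show "u < n" "v < n" "u \<noteq> v" by (auto simp: doubleton_eq_iff)
qed

lemma finite_E: "finite E"
proof (rule finite_subset)
  show "E \<subseteq> Pow {..<n}" by (auto elim!: edgeE)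
qed simp

lemma deg_in_eq_sum:
  assumes "A \<subseteq> {..<n}"
  shows "real (deg_in E A v) = (\<Sum>u<n. adj v u * indicator A u)"
proof -
  have "(\<Sum>u<n. adj v u * indicator A u) = (\<Sum>u\<in>{u \<in> A. {u, v} \<in> E}. 1)"
    by (intro sum.mono_neutral_cong_right)
      (use assms in \<open>auto simp: adj_def insert_commute indicator_def\<close>)
  then show ?thesis by (simp add: deg_in_def)
qed

lemma deg_eq_sum: "d v = (\<Sum>u<n. adj v u)"
proof -
  have "d v = (\<Sum>u<n. adj v u * indicator {..<n} u)"
    unfolding deg_def by (rule deg_in_eq_sum) simp
  also have "\<dots> = (\<Sum>u<n. adj v u)"
    by (intro sum.cong) auto
  finally show ?thesis .
qed

lemma deg_pos:
  assumes "v < n" shows "d v > 0"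
proof -
  define w where "w = (if v = 0 then 1 else 0 :: nat)"
  have w: "w < n" "w \<noteq> v" using n_ge_2 by (auto simp: w_def)
  then have "(v, w) \<in> {(x, y). {x, y} \<in> E}\<^sup>*"
    using conn assms unfolding connected_graph_def by blast
  then obtain y where y: "{v, y} \<in> E"
    using w(2) by (auto elim: converse_rtranclE)
  have "adj v y \<le> (\<Sum>u<n. adj v u)"
    using edgeD[OF y] by (intro member_le_sum) (auto simp: adj_nonneg)
  then show ?thesis using y by (simp add: deg_eq_sum adj_def)
qed

lemma handshake: "(\<Sum>v<n. d v) = 2 * real (card E)"
proof -
  have "deg n E v = card {e \<in> E. v \<in> e}" for v
  proof -
    have "bij_betw (\<lambda>u. {u, v}) {u \<in> {..<n}. {u, v} \<in> E} {e \<in> E. v \<in> e}"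
    proof (rule bij_betw_imageI)
      show "inj_on (\<lambda>u. {u, v}) {u \<in> {..<n}. {u, v} \<in> E}"
        by (auto simp: inj_on_def doubleton_eq_iff)
      show "(\<lambda>u. {u, v}) ` {u \<in> {..<n}. {u, v} \<in> E} = {e \<in> E. v \<in> e}"
      proof (intro equalityI subsetI)
        fix e assume "e \<in> {e \<in> E. v \<in> e}"
        then have e: "e \<in> E" "v \<in> e" by auto
        obtain x y where "e = {x, y}" "x < n" "y < n" "x \<noteq> y" by (rule edgeE[OF e(1)])
        then show "e \<in> (\<lambda>u. {u, v}) ` {u \<in> {..<n}. {u, v} \<in> E}"
          using e by (cases "v = x") (auto simp: insert_commute image_iff)
      qed auto
    qed
    then show ?thesis unfolding deg_def deg_in_def by (rule bij_betw_same_card)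
  qed
  then have "(\<Sum>v<n. deg n E v) = (\<Sum>v<n. \<Sum>e\<in>E. if v \<in> e then 1 else 0)"
    by (simp add: finite_E sum.If_cases Int_def)
  also have "\<dots> = (\<Sum>e\<in>E. \<Sum>v<n. if v \<in> e then 1 else 0)"
    by (rule sum.swap)
  also have "\<dots> = (\<Sum>e\<in>E. 2)"
  proof (rule sum.cong[OF refl])
    fix e assume "e \<in> E"
    then obtain x y where e: "e = {x, y}" "x < n" "y < n" "x \<noteq> y" by (rule edgeE)
    have "(\<Sum>v<n. if v \<in> e then 1 else 0 :: nat) = card ({..<n} \<inter> e)"
      by (simp add: sum.If_cases)
    also have "{..<n} \<inter> e = e" using e by auto
    finally show "(\<Sum>v<n. if v \<in> e then 1 else 0 :: nat) = 2" using e by simp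
  qed
  finally have "(\<Sum>v<n. deg n E v) = 2 * card E" by simp
  then show ?thesis by (metis of_nat_mult of_nat_numeral of_nat_sum)
qed

definition vol :: real where "vol = 2 * real (card E)"

lemma vol_pos: "vol > 0"
proof -
  have "0 < (\<Sum>v<n. d v)"
    using n_ge_2 deg_pos by (intro sum_pos) (auto simp: lessThan_empty_iff)
  then show ?thesis unfolding handshake vol_def .
qed

lemma degree_dist_eq: "\<pi> v = d v / vol"
  by (simp add: degree_dist_def vol_def)

lemma degree_dist_pos: "v < n \<Longrightarrow> \<pi> v > 0"
  using vol_pos deg_pos by (simp add: degree_dist_eq)

lemma sum_degree_dist: "(\<Sum>v<n. \<pi> v) = 1"
  using vol_pos handshake by (simp add: degree_dist_eq vol_def flip: sum_divide_distrib)

lemma deg_le: "d v \<le> n"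
proof -
  have "(\<Sum>u<n. adj v u) \<le> (\<Sum>u<n. 1)" by (intro sum_mono) (auto simp: adj_def)
  then show ?thesis by (simp add: deg_eq_sum)
qed

lemma degree_dist_ge: "v < n \<Longrightarrow> \<pi> v \<ge> 1 / (real n)\<^sup>2"
proof -
  assume v: "v < n"
  have "vol \<le> (\<Sum>v<n. real n)" unfolding vol_def handshake[symmetric] by (intro sum_mono deg_le)
  then have 1: "vol \<le> (real n)\<^sup>2" by (simp add: power2_eq_square)
  have "d v \<ge> 1" using deg_pos[OF v] by simp
  then have "1 / (real n)\<^sup>2 \<le> d v / vol" using 1 vol_pos n_ge_2 by (intro frac_le) auto
  then show ?thesis by (simp add: degree_dist_eq)
qed

lemma degree_dist_le:
  assumes "real (max_deg n E) \<le> C * avg_deg n E" "v < n"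
  shows "\<pi> v \<le> C / n"
proof -
  have "deg n E v \<le> max_deg n E" unfolding max_deg_def using assms(2) by (intro Max_ge) auto
  then have "d v \<le> C * avg_deg n E" using assms(1) by linarith
  also have "\<dots> = C * vol / n" unfolding avg_deg_def handshake vol_def by simp
  finally show ?thesis using vol_pos n_ge_2 by (simp add: degree_dist_eq field_simps)
qed

lemma degree_dist_W: "v < n \<Longrightarrow> \<pi> v * W g v = (\<Sum>u<n. adj v u * g u) / vol"
  using deg_pos[of v] by (simp add: degree_dist_eq W_def)

lemma W_eq: "v < n \<Longrightarrow> d v * W g v = (\<Sum>u<n. adj v u * g u)"
  using deg_pos[of v] by (simp add: W_def)

lemma ip_commute: "ip g h = ip h g"
  by (simp add: ip_def mult_ac)

text \<open>Detailed balance: \<open>\<pi> v\<close> times the transition probability from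
  \<open>v\<close> to \<open>u\<close> is \<open>adj v u / vol\<close>, which is symmetric.\<close>

lemma W_self_adjoint: "ip (W g) h = ip g (W h)"
proof -
  have l: "ip (W g) h = (\<Sum>v<n. \<Sum>u<n. adj v u * g u * h v / vol)" for g h
    unfolding ip_def by (intro sum.cong refl)
      (simp add: degree_dist_W sum_distrib_right sum_divide_distrib)
  have "ip g (W h) = (\<Sum>v<n. \<Sum>u<n. adj v u * h u * g v / vol)"
    using l[of h g] by (simp add: ip_commute)
  also have "\<dots> = (\<Sum>u<n. \<Sum>v<n. adj v u * h u * g v / vol)"
    by (rule sum.swap)
  finally show ?thesis unfolding l by (simp add: adj_commute mult_ac)
qed

lemma W_const: "v < n \<Longrightarrow> W (\<lambda>_. c) v = c"
  using deg_pos[of v] by (simp add: W_def deg_eq_sum flip: sum_distrib_right)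

lemma W_add: "W (\<lambda>v. g v + h v) u = W g u + W h u"
  by (simp add: W_def algebra_simps sum.distrib add_divide_distrib)

lemma W_scale: "W (\<lambda>v. c * g v) u = c * W g u"
  by (simp add: W_def sum_distrib_left mult_ac)

lemma W_cong: "(\<And>v. v < n \<Longrightarrow> g v = h v) \<Longrightarrow> W g u = W h u"
  by (simp add: W_def)

lemma ip_cong: "(\<And>v. v < n \<Longrightarrow> g v = g' v) \<Longrightarrow> (\<And>v. v < n \<Longrightarrow> h v = h' v) \<Longrightarrow> ip g h = ip g' h'"
  by (simp add: ip_def)

lemma ip_add_left: "ip (\<lambda>v. g v + h v) k = ip g k + ip h k"
  by (simp add: ip_def algebra_simps sum.distrib)

lemma ip_scale_left: "ip (\<lambda>v. c * g v) h = c * ip g h"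
  by (simp add: ip_def sum_distrib_left mult_ac)

lemma ip_add_right: "ip k (\<lambda>v. g v + h v) = ip k g + ip k h"
  by (simp add: ip_def algebra_simps sum.distrib)

lemma ip_scale_right: "ip h (\<lambda>v. c * g v) = c * ip h g"
  by (simp add: ip_def sum_distrib_left mult_ac)

lemma ip_nonneg: "ip g g \<ge> 0"
  unfolding ip_def by (intro sum_nonneg) (simp add: degree_dist_pos less_imp_le mult.assoc)

lemma ip_eq_0: assumes "ip g g = 0" "v < n" shows "g v = 0"
proof -
  have "\<forall>v\<in>{..<n}. \<pi> v * g v * g v = 0"
    using assms(1) unfolding ip_def
    by (subst (asm) sum_nonneg_eq_0_iff) (auto simp: degree_dist_pos less_imp_le mult.assoc)
  then have "\<pi> v * g v * g v = 0" using assms(2) by blast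
  then show ?thesis using degree_dist_pos[OF assms(2)] by simp
qed

lemma ip_W_one: "ip (W g) (\<lambda>_. 1) = ip g (\<lambda>_. 1)"
proof -
  have "ip g (W (\<lambda>_. 1)) = ip g (\<lambda>_. 1)" by (rule ip_cong) (simp_all add: W_const)
  then show ?thesis by (simp add: W_self_adjoint)
qed

text \<open>Maximum principle: at a vertex where \<open>|g|\<close> is largest, the average over the
  neighbours cannot exceed \<open>|g|\<close> in absolute value.\<close>

lemma W_eigenvalue_bound:
  assumes "\<And>v. v < n \<Longrightarrow> W g v = k * g v" "w < n" "g w \<noteq> 0"
  shows "\<bar>k\<bar> \<le> 1"
proof -
  obtain v where v: "v < n" "\<And>u. u < n \<Longrightarrow> \<bar>g u\<bar> \<le> \<bar>g v\<bar>"
    using finite_argmax[of "{..<n}" w "\<lambda>u. \<bar>g u\<bar>"] assms(2) by auto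
  have "\<bar>k\<bar> * \<bar>g v\<bar> * d v = \<bar>\<Sum>u<n. adj v u * g u\<bar>"
    using W_eq[OF v(1), of g] assms(1)[OF v(1)]
    by (metis abs_mult abs_of_nat mult.commute)
  also have "\<dots> \<le> (\<Sum>u<n. adj v u * \<bar>g v\<bar>)"
    by (rule order.trans[OF sum_abs])
      (intro sum_mono, auto simp: abs_mult adj_nonneg intro!: mult_left_mono v(2))
  also have "\<dots> = 1 * \<bar>g v\<bar> * d v"
    by (simp add: deg_eq_sum mult_ac flip: sum_distrib_left)
  finally have "\<bar>k\<bar> * \<bar>g v\<bar> * d v \<le> 1 * \<bar>g v\<bar> * d v" .
  moreover have "\<bar>g v\<bar> > 0" using v(2)[OF assms(2)] assms(3) by linarith
  ultimately show ?thesis using deg_pos[OF v(1)] by simp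
qed

text \<open>Where \<open>g\<close> attains its maximum, equality with the average over the
  neighbours forces the maximum at every neighbour; connectivity carries it along paths to all
  vertices.\<close>

lemma W_harmonic_const:
  assumes "\<And>v. v < n \<Longrightarrow> W g v = g v"
  obtains c where "\<And>v. v < n \<Longrightarrow> g v = c"
proof -
  obtain v where v: "v < n" "\<And>u. u < n \<Longrightarrow> g u \<le> g v"
    using finite_argmax[of "{..<n}" 0 g] n_ge_2 by auto
  have step: "g y = g v" if "{x, y} \<in> E" "g x = g v" for x y
  proof -
    have x: "x < n" and y: "y < n" using edgeD[OF that(1)] by auto
    have "(\<Sum>u<n. adj x u * (g x - g u)) = d x * g x - d x * W g x"
    proof -
      have "d x * g x = (\<Sum>u<n. adj x u * g x)" by (simp add: deg_eq_sum sum_distrib_right)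
      then show ?thesis unfolding W_eq[OF x] by (simp add: right_diff_distrib sum_subtractf)
    qed
    then have "(\<Sum>u<n. adj x u * (g x - g u)) = 0" using assms[OF x] by simp
    then have "\<forall>u\<in>{..<n}. adj x u * (g x - g u) = 0"
      by (subst (asm) sum_nonneg_eq_0_iff) (use that v in \<open>auto simp: adj_nonneg\<close>)
    then have "adj x y * (g x - g y) = 0" using y by blast
    then show ?thesis using that by (simp add: adj_def)
  qed
  have "g w = g v" if w: "w < n" for w
  proof -
    have "(v, w) \<in> {(x, y). {x, y} \<in> E}\<^sup>*"
      using conn v(1) w unfolding connected_graph_def by blast
    then show ?thesis by (induction rule: rtrancl_induct) (auto intro: step)
  qed
  then show ?thesis by (rule that)
qed

end

section \<open>Real eigenvalues and the contraction of mean-zero functions\<close>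

lemma size_proots_eq_degree:
  fixes p :: "real poly"
  assumes "p \<noteq> 0" "\<And>z. poly (map_poly complex_of_real p) z = 0 \<Longrightarrow> z \<in> \<real>"
  shows "size (proots p) = degree p"
  using assms
proof (induction "degree p" arbitrary: p)
  case 0
  then show ?case using size_proots_le[of p] by simp
next
  case (Suc k)
  have "degree (map_poly complex_of_real p) \<noteq> 0"
    using Suc(2) by (simp add: degree_map_poly)
  then have "\<not> constant (poly (map_poly complex_of_real p))"
    by (simp add: constant_degree)
  then obtain z where z: "poly (map_poly complex_of_real p) z = 0"
    using fundamental_theorem_of_algebra by blast
  obtain r where r: "z = complex_of_real r" using Suc(4)[OF z] by (auto elim: Reals_cases)
  have "complex_of_real (poly p r) = 0"
    using z unfolding r by (simp add: of_real_hom.poly_map_poly)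
  then have "poly p r = 0" by simp
  then obtain q where q: "p = [:-r, 1:] * q" by (auto simp: poly_eq_0_iff_dvd dvd_def)
  have "q \<noteq> 0" using q Suc(3) by auto
  have deg: "degree p = Suc (degree q)"
    unfolding q using \<open>q \<noteq> 0\<close> by (subst degree_mult_eq) auto
  have "size (proots q) = degree q"
  proof (rule Suc(1))
    fix w assume "poly (map_poly complex_of_real q) w = 0"
    interpret map_poly_comm_ring_hom complex_of_real ..
    have "map_poly complex_of_real p = map_poly complex_of_real [:-r, 1:] * map_poly complex_of_real q"
      unfolding q by (rule hom_mult)
    then have "poly (map_poly complex_of_real p) w = 0"
      using \<open>poly (map_poly complex_of_real q) w = 0\<close> by simp
    then show "w \<in> \<real>" by (rule Suc(4))
  qed (use deg Suc(2) \<open>q \<noteq> 0\<close> in auto)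
  then show ?case
    unfolding deg unfolding q using \<open>q \<noteq> 0\<close> by (subst proots_mult) auto
qed

context voting_graph begin

abbreviation "P \<equiv> walk_matrix n E"

lemma walk_matrix_carrier: "P \<in> carrier_mat n n"
  by (simp add: walk_matrix_def)

lemma walk_matrix_index: "i < n \<Longrightarrow> j < n \<Longrightarrow> P $$ (i, j) = adj i j / d i"
  by (simp add: walk_matrix_def adj_def)

lemma walk_matrix_mult_vec:
  assumes "i < n" "v \<in> carrier_vec n"
  shows "(P *\<^sub>v v) $ i = W (\<lambda>j. v $ j) i"
proof -
  have "(P *\<^sub>v v) $ i = (\<Sum>j<n. P $$ (i, j) * v $ j)"
    using assms walk_matrix_carrier by (simp add: scalar_prod_def lessThan_atLeast0)
  also have "\<dots> = W (\<lambda>j. v $ j) i"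
    using assms by (simp add: walk_matrix_index W_def sum_divide_distrib)
  finally show ?thesis .
qed

lemma walk_eigenvalue_iff:
  "eigenvalue P k \<longleftrightarrow> (\<exists>g. (\<forall>v<n. W g v = k * g v) \<and> (\<exists>w<n. g w \<noteq> 0))"
proof
  assume "eigenvalue P k"
  then obtain v where v: "v \<in> carrier_vec n" "v \<noteq> 0\<^sub>v n" "P *\<^sub>v v = k \<cdot>\<^sub>v v"
    using walk_matrix_carrier unfolding eigenvalue_def eigenvector_def by auto
  have "W (\<lambda>j. v $ j) i = k * v $ i" if "i < n" for i
    using walk_matrix_mult_vec[OF that v(1)] v(1) that by (simp add: v(3))
  moreover have "\<exists>w<n. v $ w \<noteq> 0" using v(1,2) by (metis carrier_vecD eq_vecI index_zero_vec)
  ultimately show "\<exists>g. (\<forall>v<n. W g v = k * g v) \<and> (\<exists>w<n. g w \<noteq> 0)" by blast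
next
  assume "\<exists>g. (\<forall>v<n. W g v = k * g v) \<and> (\<exists>w<n. g w \<noteq> 0)"
  then obtain g w where g: "\<And>v. v < n \<Longrightarrow> W g v = k * g v" and w: "w < n" "g w \<noteq> 0" by blast
  let ?v = "Matrix.vec n g"
  have "P *\<^sub>v ?v = k \<cdot>\<^sub>v ?v"
  proof (rule eq_vecI)
    fix i assume "i < dim_vec (k \<cdot>\<^sub>v ?v)"
    then have i: "i < n" by simp
    have "(P *\<^sub>v ?v) $ i = W (\<lambda>j. ?v $ j) i" by (rule walk_matrix_mult_vec[OF i]) simp
    also have "\<dots> = W g i" by (rule W_cong) simp
    finally show "(P *\<^sub>v ?v) $ i = (k \<cdot>\<^sub>v ?v) $ i" using g i by simp
  qed (use walk_matrix_carrier in auto)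
  moreover have "?v \<noteq> 0\<^sub>v n" using w by (metis index_vec index_zero_vec(1))
  ultimately show "eigenvalue P k"
    unfolding eigenvalue_def eigenvector_def using walk_matrix_carrier
    by (intro exI[of _ ?v]) auto
qed

lemma char_poly_nonzero: "char_poly P \<noteq> 0"
  using degree_monic_char_poly[OF walk_matrix_carrier] by auto

text \<open>Reversibility makes \<open>\<Sum> \<pi> u * cnj (z u) * (P z) u\<close> invariant under conjugation.\<close>

lemma walk_char_poly_roots_real:
  assumes "poly (map_poly complex_of_real (char_poly P)) k = 0"
  shows "k \<in> \<real>"
proof -
  let ?P = "map_mat complex_of_real P"
  have carr: "?P \<in> carrier_mat n n" using walk_matrix_carrier by simp
  have "char_poly ?P = map_poly complex_of_real (char_poly P)"
    by (rule of_real_hom.char_poly_hom[OF walk_matrix_carrier])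
  then have "eigenvalue ?P k"
    using assms eigenvalue_root_char_poly[OF carr] by simp
  then obtain z where z: "z \<in> carrier_vec n" "z \<noteq> 0\<^sub>v n" "?P *\<^sub>v z = k \<cdot>\<^sub>v z"
    using carr unfolding eigenvalue_def eigenvector_def by auto
  have ev: "(\<Sum>j<n. complex_of_real (adj i j) * z $ j) = k * complex_of_real (d i) * z $ i" if i: "i < n" for i
  proof -
    have "(?P *\<^sub>v z) $ i = (\<Sum>j<n. complex_of_real (P $$ (i, j)) * z $ j)"
      using i z(1) walk_matrix_carrier by (simp add: scalar_prod_def lessThan_atLeast0)
    also have "\<dots> = (\<Sum>j<n. complex_of_real (adj i j) * z $ j) / d i"
      using i by (simp add: walk_matrix_index sum_divide_distrib)
    finally have "k * z $ i = (\<Sum>j<n. complex_of_real (adj i j) * z $ j) / d i"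
      using z i by simp
    then show ?thesis using deg_pos[OF i] by (simp add: field_simps)
  qed
  define S where "S = (\<Sum>i<n. \<Sum>j<n. complex_of_real (adj i j) * cnj (z $ i) * z $ j)"
  define D where "D = (\<Sum>i<n. d i * (cmod (z $ i))\<^sup>2)"
  have "S = (\<Sum>i<n. cnj (z $ i) * (\<Sum>j<n. complex_of_real (adj i j) * z $ j))"
    unfolding S_def by (simp add: sum_distrib_left mult_ac)
  also have "\<dots> = (\<Sum>i<n. k * complex_of_real (d i * (cmod (z $ i))\<^sup>2))"
  proof (intro sum.cong refl)
    fix i assume "i \<in> {..<n}"
    then have "cnj (z $ i) * (\<Sum>j<n. complex_of_real (adj i j) * z $ j)
        = k * complex_of_real (d i) * (z $ i * cnj (z $ i))"
      by (simp add: ev)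
    also have "z $ i * cnj (z $ i) = complex_of_real ((cmod (z $ i))\<^sup>2)"
      by (rule complex_norm_square[symmetric])
    finally show "cnj (z $ i) * (\<Sum>j<n. complex_of_real (adj i j) * z $ j)
        = k * complex_of_real (d i * (cmod (z $ i))\<^sup>2)" by simp
  qed
  finally have S: "S = k * complex_of_real D"
    by (simp add: D_def sum_distrib_left)
  have "cnj S = (\<Sum>i<n. \<Sum>j<n. complex_of_real (adj i j) * z $ i * cnj (z $ j))"
    by (simp add: S_def)
  also have "\<dots> = (\<Sum>j<n. \<Sum>i<n. complex_of_real (adj i j) * z $ i * cnj (z $ j))"
    by (rule sum.swap)
  also have "\<dots> = S" unfolding S_def by (simp add: adj_commute mult_ac)
  finally have "S \<in> \<real>" by (simp add: Reals_cnj_iff)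
  moreover have "D > 0"
  proof -
    obtain w where w: "w < n" "z $ w \<noteq> 0" using z(1,2) by (metis carrier_vecD eq_vecI index_zero_vec)
    show ?thesis unfolding D_def
      by (rule sum_pos2[of _ w]) (use w deg_pos[OF w(1)] in auto)
  qed
  then have "k = S / complex_of_real D" using S by simp
  ultimately show ?thesis by (simp add: Reals_divide)
qed

text \<open>The spectral hypothesis speaks of two list entries only. Since 1 is an eigenvalue and
  none is larger, the sorted list starts with 1; an eigenvalue other than 1 stands at a later index
  and is squeezed between the entries at 1 and \<open>n - 1\<close>.\<close>

lemma expander_eigenvalue:
  assumes "expander lam n E"
    and g: "\<And>v. v < n \<Longrightarrow> W g v = k * g v" "w < n" "g w \<noteq> 0" "k \<noteq> 1"
  shows "\<bar>k\<bar> \<le> lam"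
proof -
  define es where "es = eigenvalues_desc P"
  let ?M = "proots (char_poly P)"
  have root: "x \<in> set es \<longleftrightarrow> eigenvalue P x" for x
    using char_poly_nonzero eigenvalue_root_char_poly[OF walk_matrix_carrier]
    by (simp add: es_def eigenvalues_desc_def)
  \<comment> \<open>Because all complex roots are real, the list has length \<open>n\<close>, so
    that index \<open>n - 1\<close> is its last entry.\<close>
  have "length es = size ?M"
    unfolding es_def eigenvalues_desc_def length_rev by (metis mset_sorted_list_of_multiset size_mset)
  also have "\<dots> = n"
    using size_proots_eq_degree[OF char_poly_nonzero walk_char_poly_roots_real]
      degree_monic_char_poly[OF walk_matrix_carrier] by simp
  finally have len: "length es = n" .
  have desc: "es ! j \<le> es ! i" if "i \<le> j" "j < n" for i j
    using that len sorted_rev_nth_mono[of es i j]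
    by (simp add: es_def eigenvalues_desc_def)
  have le1: "\<bar>x\<bar> \<le> 1" if "x \<in> set es" for x
    using that W_eigenvalue_bound unfolding root walk_eigenvalue_iff by blast
  have "eigenvalue P 1"
    unfolding walk_eigenvalue_iff using W_const[of _ 1] n_ge_2
    by (intro exI[of _ "\<lambda>_. 1"] conjI exI[of _ 0]) auto
  then obtain i where i: "i < n" "es ! i = 1" unfolding root[symmetric] by (auto simp: in_set_conv_nth len)
  have "es ! 0 = 1" using desc[of 0 i] i le1[of "es ! 0"] len n_ge_2 by (auto simp: nth_mem)
  have "k \<in> set es" unfolding root walk_eigenvalue_iff using g by blast
  then obtain j where j: "j < n" "es ! j = k" by (auto simp: in_set_conv_nth len)
  then have "j \<noteq> 0" using g(4) \<open>es ! 0 = 1\<close> by metis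
  then have "k \<le> es ! 1" "es ! (n - 1) \<le> k" using desc[of 1 j] desc[of j "n - 1"] j by auto
  moreover have "\<bar>es ! 1\<bar> \<le> lam" "\<bar>es ! (n - 1)\<bar> \<le> lam"
    using assms(1) by (auto simp: expander_def Let_def es_def)
  ultimately show ?thesis by linarith
qed

text \<open>By connectivity the eigenfunctions for 1 are constant, and a constant of mean zero
  vanishes; having mean zero thus excludes \<open>k = 1\<close> without counting
  multiplicities.\<close>

lemma expander_eigenvalue_orthogonal:
  assumes "expander lam n E"
    and g: "\<And>v. v < n \<Longrightarrow> W g v = k * g v" "w < n" "g w \<noteq> 0" "ip g (\<lambda>_. 1) = 0"
  shows "\<bar>k\<bar> \<le> lam"
proof (rule expander_eigenvalue[OF assms(1) g(1-3)])
  show "k \<noteq> 1"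
  proof
    assume "k = 1"
    then have "\<And>v. v < n \<Longrightarrow> W g v = g v" using g(1) by simp
    then obtain c where c: "\<And>v. v < n \<Longrightarrow> g v = c" using W_harmonic_const by blast
    have "ip g (\<lambda>_. 1) = (\<Sum>v<n. \<pi> v * c)" using c by (simp add: ip_def)
    also have "\<dots> = c" using sum_degree_dist by (simp flip: sum_distrib_right)
    finally show False using c g by auto
  qed
qed

text \<open>A maximiser of \<open>\<parallel>W g\<parallel>\<close> on the unit sphere of the mean-zero functions is an eigenvector of
  \<open>W\<^sup>2 = (W - s) (W + s) + s\<^sup>2\<close>.\<close>

lemma W_maximiser:
  assumes "v0 < n" "g0 v0 \<noteq> 0" "ip g0 (\<lambda>_. 1) = 0"
  obtains g where "ip g g = 1" "ip g (\<lambda>_. 1) = 0"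
    "\<And>h. ip h (\<lambda>_. 1) = 0 \<Longrightarrow> ip (W h) (W h) \<le> ip (W g) (W g) * ip h h"
proof -
  \<comment> \<open>On the unit sphere \<open>\<pi> i * (g i)^2 <= 1\<close> and
    \<open>\<pi> i >= 1 / n^2\<close>, so coordinates are at most \<open>n\<close>. Coordinates
    beyond the vertices are pinned to 0, which makes the admissible set compact in the product
    topology on functions.\<close>
  define B where "B = real n"
  define Kc where "Kc i = (if i < n then {-B..B} else {0::real})" for i :: nat
  have compK: "compact (PiE UNIV Kc)"
  proof -
    have "compactin (product_topology (\<lambda>_. euclidean) UNIV) (PiE UNIV Kc)"
      unfolding compactin_PiE by (auto simp: Kc_def)
    then show ?thesis by (simp add: euclidean_product_topology)
  qed
  define S where "S = {g. ip g g = 1} \<inter> {g. ip g (\<lambda>_. 1) = 0} \<inter> PiE UNIV Kc"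
  have cont_coord: "continuous_on UNIV (\<lambda>g. g i :: real)" for i :: nat
    by (rule continuous_on_product_coordinates)
  have cont: "continuous_on UNIV (\<lambda>g. ip g g)" "continuous_on UNIV (\<lambda>g. ip g (\<lambda>_. 1))"
    "continuous_on UNIV (\<lambda>g. ip (W g) (W g))"
    unfolding ip_def W_def divide_inverse by (intro continuous_intros cont_coord)+
  have "compact S"
    unfolding S_def
    by (intro closed_Int_compact closed_Int compK closed_Collect_eq cont continuous_on_const)
  have normalise: "\<exists>g\<in>S. ip (W g) (W g) * ip h h = ip (W h) (W h)"
    if h: "ip h (\<lambda>_. 1) = 0" "ip h h \<noteq> 0" for h
  proof -
    define s where "s = 1 / sqrt (ip h h)"
    have pos: "ip h h > 0" using h(2) ip_nonneg[of h] by linarith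
    have s2: "s * s = 1 / ip h h" using pos by (simp add: s_def)
    define g where "g v = (if v < n then s * h v else 0)" for v
    have gg: "ip g g = 1"
    proof -
      have "ip g g = ip (\<lambda>v. s * h v) (\<lambda>v. s * h v)" by (rule ip_cong) (simp_all add: g_def)
      also have "\<dots> = s * s * ip h h" by (simp add: ip_scale_left ip_scale_right)
      finally show ?thesis using s2 pos by simp
    qed
    have g1: "ip g (\<lambda>_. 1) = 0"
    proof -
      have "ip g (\<lambda>_. 1) = ip (\<lambda>v. s * h v) (\<lambda>_. 1)" by (rule ip_cong) (simp_all add: g_def)
      then show ?thesis using h(1) by (simp add: ip_scale_left)
    qed
    have Wg: "ip (W g) (W g) = s * s * ip (W h) (W h)"
    proof -
      have "W g v = s * W h v" for v
        using W_cong[of g "\<lambda>v. s * h v" v] by (simp add: g_def W_scale)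
      then show ?thesis by (simp add: ip_def sum_distrib_left mult_ac)
    qed
    have "\<bar>g i\<bar> \<le> B" if i: "i < n" for i
    proof -
      have "\<pi> i * g i * g i \<le> ip g g"
        unfolding ip_def using i
        by (intro member_le_sum[of i "{..<n}" "\<lambda>i. \<pi> i * g i * g i"])
          (auto simp: degree_dist_pos less_imp_le mult.assoc)
      moreover have "1 / (real n)\<^sup>2 * (g i * g i) \<le> \<pi> i * (g i * g i)"
        by (intro mult_right_mono degree_dist_ge i) auto
      ultimately have "(g i)\<^sup>2 / (real n)\<^sup>2 \<le> 1" using gg by (simp add: power2_eq_square mult.assoc)
      then have "(g i)\<^sup>2 \<le> B\<^sup>2" using n_ge_2 by (simp add: B_def divide_le_eq)
      then show ?thesis by (simp add: B_def abs_le_square_iff[symmetric])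
    qed
    then have "g \<in> PiE UNIV Kc" by (auto simp: Kc_def g_def PiE_UNIV_domain abs_le_iff minus_le_iff)
    then have "g \<in> S" using gg g1 by (simp add: S_def)
    moreover have "ip (W g) (W g) * ip h h = ip (W h) (W h)" using Wg s2 pos by simp
    ultimately show ?thesis by blast
  qed
  have "ip g0 g0 \<noteq> 0" using ip_eq_0 assms by blast
  then have "S \<noteq> {}" using normalise assms(3) by blast
  then obtain g where g: "g \<in> S" "\<And>h. h \<in> S \<Longrightarrow> ip (W h) (W h) \<le> ip (W g) (W g)"
    using continuous_attains_sup[OF \<open>compact S\<close>, of "\<lambda>g. ip (W g) (W g)"]
      continuous_on_subset[OF cont(3)] by blast
  show ?thesis
  proof (rule that)
    fix h assume h: "ip h (\<lambda>_. 1) = 0"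
    show "ip (W h) (W h) \<le> ip (W g) (W g) * ip h h"
    proof (cases "ip h h = 0")
      case True
      then have "h v = 0" if "v < n" for v using ip_eq_0 that by blast
      then have "W h v = 0" for v by (simp add: W_def)
      then show ?thesis using True by (simp add: ip_def)
    next
      case False
      then obtain k where k: "k \<in> S" "ip (W k) (W k) * ip h h = ip (W h) (W h)"
        using normalise h by blast
      have "ip (W k) (W k) * ip h h \<le> ip (W g) (W g) * ip h h"
        by (intro mult_right_mono g(2) k(1) ip_nonneg)
      then show ?thesis using k(2) by simp
    qed
  qed (use g in \<open>auto simp: S_def\<close>)
qed

theorem W_contraction:
  assumes "expander lam n E" and h: "ip h (\<lambda>_. 1) = 0"
  shows "ip (W h) (W h) \<le> lam\<^sup>2 * ip h h"
proof (cases "\<exists>v<n. h v \<noteq> 0")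
  case False
  then have "W h v = 0" for v by (simp add: W_def)
  then have "ip (W h) (W h) = 0" by (simp add: ip_def)
  then show ?thesis by (simp add: ip_nonneg)
next
  case True
  then obtain g where gg: "ip g g = 1" and g1: "ip g (\<lambda>_. 1) = 0"
    and max: "\<And>h. ip h (\<lambda>_. 1) = 0 \<Longrightarrow> ip (W h) (W h) \<le> ip (W g) (W g) * ip h h"
    using W_maximiser h by blast
  define M where "M = ip (W g) (W g)"
  \<comment> \<open>The residual of the eigenvalue equation for \<open>W^2\<close> has mean zero and
    is thus an admissible direction. Along it the functional
    \<open>ip (W k) (W k) - M * ip k k\<close> has slope \<open>2 * ip r r\<close> at
    \<open>g\<close>, so maximality forces \<open>r\<close> to vanish.\<close>
  define r where "r v = W (W g) v + (- M) * g v" for v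
  have r1: "ip r (\<lambda>_. 1) = 0"
    unfolding r_def ip_add_left ip_scale_left ip_W_one g1 by simp
  have gr: "ip (W g) (W r) - M * ip g r = ip r r"
  proof -
    have "ip r r = ip (W (W g)) r + (- M) * ip g r"
    proof -
      have "ip (\<lambda>v. W (W g) v + (- M) * g v) h = ip (W (W g)) h + (- M) * ip g h" for h
        by (simp only: ip_add_left ip_scale_left)
      then show ?thesis by (simp only: r_def[abs_def])
    qed
    also have "ip (W (W g)) r = ip (W g) (W r)" by (rule W_self_adjoint)
    finally show ?thesis by simp
  qed
  have quad: "2 * t * ip r r \<le> t\<^sup>2 * (M * ip r r - ip (W r) (W r))" for t
  proof -
    define k where "k v = g v + t * r v" for v
    have "ip k (\<lambda>_. 1) = 0" unfolding k_def ip_add_left ip_scale_left g1 r1 by simp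
    then have le: "ip (W k) (W k) \<le> M * ip k k" using max by (simp add: M_def)
    have Wk: "W k = (\<lambda>v. W g v + t * W r v)"
      by (rule ext) (simp only: k_def[abs_def] W_add W_scale)
    have 1: "ip (W k) (W k) = M + 2 * t * ip (W g) (W r) + t\<^sup>2 * ip (W r) (W r)"
      unfolding Wk by (simp add: ip_add_left ip_add_right ip_scale_left ip_scale_right
        M_def ip_commute[of "W r" "W g"] power2_eq_square algebra_simps)
    have 2: "ip k k = 1 + 2 * t * ip g r + t\<^sup>2 * ip r r"
      unfolding k_def by (simp add: ip_add_left ip_add_right ip_scale_left ip_scale_right
        gg ip_commute[of r g] power2_eq_square algebra_simps)
    have "2 * t * (ip (W g) (W r) - M * ip g r) \<le> t\<^sup>2 * (M * ip r r - ip (W r) (W r))"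
      using le unfolding 1 2 by (simp add: algebra_simps)
    then show ?thesis unfolding gr .
  qed
  have rr: "ip r r = 0"
  proof (rule ccontr)
    assume "ip r r \<noteq> 0"
    then have pos: "ip r r > 0" using ip_nonneg[of r] by linarith
    define c where "c = M * ip r r - ip (W r) (W r)"
    \<comment> \<open>With this step length the second-order term is at most \<open>ip r r\<close>,
      half of what \<open>quad\<close> demands.\<close>
    define t where "t = ip r r / (\<bar>c\<bar> + 1)"
    have t: "t > 0" using pos by (simp add: t_def)
    have "2 * ip r r \<le> t * c" using quad[of t] t by (simp add: c_def power2_eq_square mult.assoc)
    also have "t * c \<le> t * (\<bar>c\<bar> + 1)" using t by (intro mult_left_mono) auto
    also have "\<dots> = ip r r" by (simp add: t_def)
    finally show False using pos by simp
  qed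
  have WW: "W (W g) v = M * g v" if "v < n" for v
    using ip_eq_0[OF rr that] by (simp add: r_def)
  define s where "s = sqrt M"
  have M: "M = s * s" "s \<ge> 0" using ip_nonneg[of "W g"] by (auto simp: s_def M_def)
  obtain w where w: "w < n" "g w \<noteq> 0"
  proof -
    have "\<exists>w<n. g w \<noteq> 0"
    proof (rule ccontr)
      assume "\<not> ?thesis"
      then have "ip g g = 0" by (simp add: ip_def)
      then show False using gg by simp
    qed
    then show ?thesis using that by blast
  qed
  \<comment> \<open>\<open>W^2 - s^2\<close> factors: either \<open>W g + s * g\<close> is an
    eigenfunction for \<open>s\<close>, or it vanishes and \<open>g\<close> is one for
    \<open>- s\<close>. Both have mean zero, so \<open>lam\<close> bounds \<open>s\<close>.\<close>
  have "s \<le> lam"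
  proof (cases "\<exists>v<n. W g v + s * g v \<noteq> 0")
    case True
    then obtain v where v: "v < n" "W g v + s * g v \<noteq> 0" by blast
    define u where "u v = W g v + s * g v" for v
    have "W u i = s * u i" if "i < n" for i
      unfolding u_def W_add W_scale WW[OF that] M(1) by (simp add: algebra_simps)
    moreover have "ip u (\<lambda>_. 1) = 0"
      unfolding u_def ip_add_left ip_scale_left ip_W_one g1 by simp
    ultimately show ?thesis
      using expander_eigenvalue_orthogonal[OF assms(1), of u s v] v M(2) by (simp add: u_def)
  next
    case False
    then have "W g v = (- s) * g v" if "v < n" for v using that by (simp add: add_eq_0_iff2)
    then show ?thesis
      using expander_eigenvalue_orthogonal[OF assms(1), of g "- s" w] w g1 M(2) by simp
  qed
  then have "M \<le> lam\<^sup>2" using M by (simp add: power2_eq_square mult_mono)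
  then show ?thesis
    using max[OF h] mult_right_mono[OF _ ip_nonneg[of h], of M "lam\<^sup>2"] unfolding M_def by linarith
qed

lemma expander_nonneg: "expander lam n E \<Longrightarrow> lam \<ge> 0"
  unfolding expander_def Let_def by linarith

end

section \<open>Survival probabilities of the chain\<close>

text \<open>The probability that the chain started at \<open>A\<close> lies in \<open>X\<close> at
  all times from 0 to \<open>t\<close>, as a recursion on the first step. For \<open>X\<close> the
  non-consensus sets it is the probability that the consensus time exceeds \<open>t\<close>.\<close>

primrec surv :: "('a \<Rightarrow> 'a pmf) \<Rightarrow> 'a set \<Rightarrow> nat \<Rightarrow> 'a \<Rightarrow> real" where
  "surv K X 0 = indicator X"
| "surv K X (Suc t) = (\<lambda>A. indicator X A * measure_pmf.expectation (K A) (surv K X t))"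

lemma expectation_mono_finite:
  fixes f g :: "'a \<Rightarrow> real"
  assumes "finite (set_pmf M)" "\<And>x. x \<in> set_pmf M \<Longrightarrow> f x \<le> g x"
  shows "measure_pmf.expectation M f \<le> measure_pmf.expectation M g"
  using assms by (intro integral_mono_AE integrable_measure_pmf_finite) (auto simp: AE_measure_pmf_iff)

locale finite_kernel =
  fixes K :: "'a \<Rightarrow> 'a pmf"
  assumes finite_set_pmf: "finite (set_pmf (K A))"
begin

lemma integrable [simp]: "integrable (measure_pmf (K A)) (f :: 'a \<Rightarrow> real)"
  by (rule integrable_measure_pmf_finite[OF finite_set_pmf])

lemmas expectation_mono = expectation_mono_finite[OF finite_set_pmf]

lemma surv_nonneg: "surv K X t A \<ge> 0"
  by (induction t arbitrary: A) (auto intro!: mult_nonneg_nonneg integral_nonneg_AE)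

lemma surv_le_1: "surv K X t A \<le> 1"
proof (induction t arbitrary: A)
  case (Suc t)
  have "measure_pmf.expectation (K A) (surv K X t) \<le> measure_pmf.expectation (K A) (\<lambda>_. 1)"
    by (intro expectation_mono Suc)
  then show ?case by (simp split: split_indicator)
qed (simp add: indicator_def)

lemma surv_Suc_le: "surv K X (Suc t) A \<le> surv K X t A"
proof (induction t arbitrary: A)
  case 0
  show ?case using surv_le_1[of X "Suc 0" A] by (auto split: split_indicator)
next
  case (Suc t)
  have "measure_pmf.expectation (K A) (surv K X (Suc t)) \<le> measure_pmf.expectation (K A) (surv K X t)"
    by (intro expectation_mono Suc)
  then show ?case
    unfolding surv.simps(2)[of K X "Suc t"] surv.simps(2)[of K X t]
    by (intro mult_left_mono) auto
qed

lemma surv_antimono: "s \<le> t \<Longrightarrow> surv K X t A \<le> surv K X s A"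
  using lift_Suc_antimono_le[of "\<lambda>t. surv K X t A" s t] surv_Suc_le by blast

lemma surv_outside: "A \<notin> X \<Longrightarrow> surv K X t A = 0"
  by (cases t) auto

text \<open>Markov property at the first step with an exceptional event of probability at most
  \<open>p\<close>; iterating it gives the union bounds of the phases.\<close>

lemma surv_Suc_bound:
  assumes "\<And>B. B \<in> S \<Longrightarrow> surv K X t B \<le> q" "measure_pmf.prob (K A) (- S) \<le> p" "q \<ge> 0" "p \<ge> 0"
  shows "surv K X (Suc t) A \<le> q + p"
proof -
  have "measure_pmf.expectation (K A) (surv K X t)
      \<le> measure_pmf.expectation (K A) (\<lambda>B. q + indicator (- S) B)"
  proof (intro expectation_mono)
    fix B show "surv K X t B \<le> q + indicator (- S) B"
      using assms(1)[of B] assms(3) surv_le_1[of X t B] by (auto split: split_indicator)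
  qed
  also have "\<dots> = q + measure_pmf.prob (K A) (- S)" by simp
  finally have "measure_pmf.expectation (K A) (surv K X t) \<le> q + p" using assms(2) by simp
  then show ?thesis using assms(3,4) by (auto split: split_indicator)
qed

lemma surv_Suc_lower:
  assumes "\<And>B. B \<in> S \<Longrightarrow> q \<le> surv K X t B" "measure_pmf.prob (K A) (- S) \<le> p" "q \<le> 1" "A \<in> X"
  shows "q - p \<le> surv K X (Suc t) A"
proof -
  have "q - p \<le> q - measure_pmf.prob (K A) (- S)" using assms(2) by simp
  also have "\<dots> = measure_pmf.expectation (K A) (\<lambda>B. q - indicator (- S) B)" by simp
  also have "\<dots> \<le> measure_pmf.expectation (K A) (surv K X t)"
  proof (intro expectation_mono)
    fix B show "q - indicator (- S) B \<le> surv K X t B"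
      using assms(1)[of B] assms(3) surv_nonneg[of X t B] by (auto split: split_indicator)
  qed
  finally show ?thesis using assms(4) by simp
qed

text \<open>A supermartingale argument with leakage. On \<open>X\<close> the indicator is at most
  \<open>\<phi>\<close>, so decay of the expected \<open>\<phi>\<close> bounds survival. Outside
  \<open>G\<close> nothing is known about \<open>\<phi>\<close>; it is replaced by 0 there, and each
  round pays \<open>p\<close> for leaving \<open>G\<close>.\<close>

lemma surv_lyapunov:
  assumes "\<And>A. A \<in> G \<Longrightarrow> A \<in> X \<Longrightarrow>
      measure_pmf.expectation (K A) (\<lambda>B. if B \<in> G then \<phi> B else 0) \<le> r * \<phi> A"
    and "\<And>A. A \<in> G \<Longrightarrow> A \<in> X \<Longrightarrow> measure_pmf.prob (K A) (- G) \<le> p"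
    and "\<And>A. A \<in> G \<Longrightarrow> A \<in> X \<Longrightarrow> \<phi> A \<ge> 1" "\<And>A. A \<in> G \<Longrightarrow> \<phi> A \<ge> 0"
    and "r \<ge> 0" "p \<ge> 0" "A \<in> G"
  shows "surv K X t A \<le> r ^ t * \<phi> A + real t * p"
  using assms(7)
proof (induction t arbitrary: A)
  case 0
  then show ?case using assms(3,4)[of A] by (auto split: split_indicator)
next
  case (Suc t)
  show ?case
  proof (cases "A \<in> X")
    case True
    let ?\<phi> = "\<lambda>B. if B \<in> G then \<phi> B else 0"
    have "measure_pmf.expectation (K A) (surv K X t)
        \<le> measure_pmf.expectation (K A) (\<lambda>B. r ^ t * ?\<phi> B + (real t * p + indicator (- G) B))"
    proof (intro expectation_mono)
      fix B
      have "0 \<le> real t * p" using assms(6) by simp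
      then show "surv K X t B \<le> r ^ t * ?\<phi> B + (real t * p + indicator (- G) B)"
        using Suc.IH[of B] surv_le_1[of X t B] by (auto split: split_indicator)
    qed
    also have "\<dots> = r ^ t * measure_pmf.expectation (K A) ?\<phi> + (real t * p + measure_pmf.prob (K A) (- G))"
      by simp
    also have "\<dots> \<le> r ^ t * (r * \<phi> A) + (real t * p + p)"
      using assms(1,2)[OF Suc.prems True] assms(5) by (intro add_mono mult_left_mono) auto
    also have "\<dots> = r ^ Suc t * \<phi> A + real (Suc t) * p" by (simp add: algebra_simps)
    finally show ?thesis using True by simp
  next
    case False
    have "0 \<le> r ^ Suc t * \<phi> A + real (Suc t) * p"
      using assms(4)[OF Suc.prems] assms(5,6) by (intro add_nonneg_nonneg mult_nonneg_nonneg) auto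
    then show ?thesis by (simp only: surv_outside[OF False])
  qed
qed

text \<open>The left-hand side splits off the last step of the paths, the recursion of \<open>surv\<close> the first.\<close>

lemma sum_paths_eq_surv:
  assumes X: "finite X"
  shows "(\<Sum>s\<in>PiE {..t} (\<lambda>_. X). if s 0 = A then \<Prod>i<t. pmf (K (s i)) (s (Suc i)) else 0) = surv K X t A"
proof -
  define U where "U h B = indicator X B * measure_pmf.expectation (K B) h" for h :: "'a \<Rightarrow> real" and B
  define w where "w t s = (if s 0 = A then \<Prod>i<t. pmf (K (s i)) (s (Suc i)) else 0)"
    for t and s :: "nat \<Rightarrow> 'a"
  \<comment> \<open>An arbitrary weight \<open>h\<close> at the endpoint makes the induction close:
    summing out the last step produces a new weight at the endpoint of the shorter path.\<close>
  have "(\<Sum>s\<in>PiE {..t} (\<lambda>_. X). w t s * h (s t)) = (U ^^ t) (\<lambda>B. indicator X B * h B) A" for h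
  proof (induction t arbitrary: h)
    case 0
    have "(\<Sum>s\<in>PiE {..0} (\<lambda>_. X). w 0 s * h (s 0))
        = (\<Sum>x\<in>X. if x = A then h x else 0)"
    proof (rule sum.reindex_bij_witness[of _ "\<lambda>x. (\<lambda>i. if i = 0 then x else undefined)" "\<lambda>s. s 0"])
      fix s assume "s \<in> PiE {..0::nat} (\<lambda>_. X)"
      then show "(\<lambda>i. if i = 0 then s 0 else undefined) = s"
        by (auto simp: PiE_iff extensional_def)
    qed (auto simp: w_def PiE_iff extensional_def)
    then show ?case using X by (simp add: indicator_def)
  next
    case (Suc t)
    let ?g = "\<lambda>B. measure_pmf.expectation (K B) (\<lambda>B'. indicator X B' * h B')"
    have g: "?g B = (\<Sum>x\<in>X. pmf (K B) x * h x)" for B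
      using X by (subst integral_measure_pmf_real[of X]) (auto simp: indicator_def mult_ac split: if_splits)
    have ins: "{..Suc t} = insert (Suc t) {..t}" by auto
    have "(\<Sum>s\<in>PiE {..Suc t} (\<lambda>_. X). w (Suc t) s * h (s (Suc t)))
        = (\<Sum>(x, s)\<in>X \<times> PiE {..t} (\<lambda>_. X). w (Suc t) (s(Suc t := x)) * h x)"
      unfolding ins PiE_insert_eq
      by (subst sum.reindex[OF inj_combinator]) (auto simp: case_prod_unfold)
    also have "\<dots> = (\<Sum>x\<in>X. \<Sum>s\<in>PiE {..t} (\<lambda>_. X). w t s * (pmf (K (s t)) x * h x))"
      unfolding sum.cartesian_product[symmetric]
      by (intro sum.cong refl) (auto simp: w_def intro!: prod.cong)
    also have "\<dots> = (\<Sum>s\<in>PiE {..t} (\<lambda>_. X). w t s * ?g (s t))"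
      unfolding g sum_distrib_left by (rule sum.swap)
    also have "\<dots> = (U ^^ t) (\<lambda>B. indicator X B * ?g B) A" by (rule Suc.IH)
    also have "(\<lambda>B. indicator X B * ?g B) = U (\<lambda>B. indicator X B * h B)" by (auto simp: U_def)
    also have "(U ^^ t) (U (\<lambda>B. indicator X B * h B)) = (U ^^ Suc t) (\<lambda>B. indicator X B * h B)"
      by (simp only: funpow_Suc_right comp_apply)
    finally show ?case .
  qed
  from this[of "\<lambda>_. 1"] have "(\<Sum>s\<in>PiE {..t} (\<lambda>_. X). w t s) = (U ^^ t) (indicator X) A" by simp
  also have "(U ^^ t) (indicator X) = surv K X t"
  proof (induction t)
    case (Suc t)
    have "(U ^^ Suc t) (indicator X) = U (surv K X t)" by (simp only: funpow.simps comp_apply Suc.IH)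
    also have "\<dots> = surv K X (Suc t)" by (simp add: U_def fun_eq_iff)
    finally show ?case .
  qed simp
  finally show ?thesis unfolding w_def .
qed

end

section \<open>Path measure and consensus time\<close>

lemma set_pmf_voting_step: "set_pmf (voting_step f n E A) \<subseteq> Pow {..<n}"
  by (auto simp: voting_step_def)

interpretation voting_step: finite_kernel "voting_step f n E" for f n E
  by unfold_locales (rule finite_subset[OF set_pmf_voting_step], simp)

lemma space_voting_chain: "space (voting_chain f n E A) = UNIV"
proof -
  interpret IT: Ionescu_Tulcea "voting_kernel f n E A" "\<lambda>_. count_space UNIV"
    by (rule Ionescu_Tulcea_voting_kernel)
  show ?thesis unfolding voting_chain_def IT.PF.space_lim by (simp add: space_PiM)
qed

lemma prob_space_voting_chain: "prob_space (voting_chain f n E A)"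
proof -
  interpret IT: Ionescu_Tulcea "voting_kernel f n E A" "\<lambda>_. count_space UNIV"
    by (rule Ionescu_Tulcea_voting_kernel)
  let ?M = "\<lambda>_::nat. count_space (UNIV :: nat set set)"
  interpret CI: prob_space "IT.CI {}" by (rule IT.PF.prob_space_P) auto
  have sp: "space (IT.CI {}) = space (PiM {} ?M)" by (rule IT.PF.space_P) auto
  have "emeasure (voting_chain f n E A) (prod_emb UNIV ?M {} (space (PiM {} ?M))) = emeasure (IT.CI {}) (space (PiM {} ?M))"
    unfolding voting_chain_def by (rule IT.lim) auto
  also have "prod_emb UNIV ?M {} (space (PiM {} ?M)) = space (voting_chain f n E A)"
    unfolding space_voting_chain by (auto simp: prod_emb_def space_PiM)
  also have "emeasure (IT.CI {}) (space (PiM {} ?M)) = 1"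
    unfolding sp[symmetric] by (rule CI.emeasure_space_1)
  finally show ?thesis by (rule prob_spaceI)
qed

lemma voting_chain_coordinate_sets: "{\<omega>. \<omega> i \<in> S} \<in> sets (voting_chain f n E A)"
proof -
  interpret IT: Ionescu_Tulcea "voting_kernel f n E A" "\<lambda>_. count_space UNIV"
    by (rule Ionescu_Tulcea_voting_kernel)
  have sets: "sets (voting_chain f n E A) = sets (PiM UNIV (\<lambda>_. count_space UNIV))"
    unfolding voting_chain_def by (rule IT.PF.sets_lim)
  have "(\<lambda>\<omega>. \<omega> i) \<in> voting_chain f n E A \<rightarrow>\<^sub>M count_space UNIV"
    unfolding measurable_cong_sets[OF sets refl] by (rule measurable_component_singleton) simp
  from measurable_sets[OF this, of S] show ?thesis
    by (simp add: space_voting_chain vimage_def)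
qed

lemma voting_chain_all_sets: "{\<omega>. \<forall>i\<in>I. \<omega> i \<in> S i} \<in> sets (voting_chain f n E A)"
proof -
  have "{\<omega>\<in>space (voting_chain f n E A). \<forall>i\<in>I. \<omega> i \<in> S i} \<in> sets (voting_chain f n E A)"
    using voting_chain_coordinate_sets
    by (intro sets.sets_Collect_countable_Ball) (auto simp: space_voting_chain)
  then show ?thesis by (simp add: space_voting_chain)
qed

text \<open>Finiteness of \<open>X\<close> makes the event a finite disjoint union of cylinders, one
  per path in \<open>X\<close>, whose measures are known.\<close>

lemma measure_voting_chain_surv:
  assumes "X \<subseteq> Pow {..<n}"
  shows "measure (voting_chain f n E A) {\<omega>. \<forall>i\<le>t. \<omega> i \<in> X} = surv (voting_step f n E) X t A"
proof -
  let ?M = "voting_chain f n E A"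
  interpret M: prob_space ?M by (rule prob_space_voting_chain)
  have X: "finite X" using assms finite_subset by auto
  have cyl: "measure ?M {\<omega>. \<forall>i\<le>t. \<omega> i = s i}
      = (if s 0 = A then \<Prod>i<t. pmf (voting_step f n E (s i)) (s (Suc i)) else 0)" for s
    using emeasure_voting_chain_cylinder[of f n E A t s]
    by (auto simp: measure_def space_voting_chain prod_ennreal prod_nonneg)
  have "{\<omega>. \<forall>i\<le>t. \<omega> i \<in> X} = (\<Union>s\<in>PiE {..t} (\<lambda>_. X). {\<omega>. \<forall>i\<le>t. \<omega> i = s i})"
  proof (intro equalityI subsetI)
    fix \<omega> :: "nat \<Rightarrow> nat set" assume "\<omega> \<in> {\<omega>. \<forall>i\<le>t. \<omega> i \<in> X}"
    then have "restrict \<omega> {..t} \<in> PiE {..t} (\<lambda>_. X)" by auto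
    then show "\<omega> \<in> (\<Union>s\<in>PiE {..t} (\<lambda>_. X). {\<omega>. \<forall>i\<le>t. \<omega> i = s i})"
      by (rule UN_I) auto
  qed (auto simp: PiE_iff)
  also have "measure ?M \<dots> = (\<Sum>s\<in>PiE {..t} (\<lambda>_. X). measure ?M {\<omega>. \<forall>i\<le>t. \<omega> i = s i})"
  proof (rule M.finite_measure_finite_Union)
    show "finite (PiE {..t} (\<lambda>_. X))" using X by (intro finite_PiE) auto
    show "(\<lambda>s. {\<omega>. \<forall>i\<le>t. \<omega> i = s i}) ` PiE {..t} (\<lambda>_. X) \<subseteq> sets ?M"
    proof (intro image_subsetI)
      fix s
      show "{\<omega>. \<forall>i\<le>t. \<omega> i = s i} \<in> sets ?M"
        using voting_chain_all_sets[of "{..t}" "\<lambda>i. {s i}" f n E A] by (simp add: Ball_def)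
    qed
    show "disjoint_family_on (\<lambda>s. {\<omega>. \<forall>i\<le>t. \<omega> i = s i}) (PiE {..t} (\<lambda>_. X))"
    proof (unfold disjoint_family_on_def, intro ballI impI)
      fix s s' assume s: "s \<in> PiE {..t} (\<lambda>_. X)" "s' \<in> PiE {..t} (\<lambda>_. X)" and ne: "s \<noteq> s'"
      have "s = s'" if "\<forall>i\<le>t. \<omega> i = s i" "\<forall>i\<le>t. \<omega> i = s' i" for \<omega>
        by (rule PiE_ext[OF s]) (use that in auto)
      then show "{\<omega>. \<forall>i\<le>t. \<omega> i = s i} \<inter> {\<omega>. \<forall>i\<le>t. \<omega> i = s' i} = {}" using ne by auto
    qed
  qed
  also have "\<dots> = surv (voting_step f n E) X t A"
    unfolding cyl by (rule voting_step.sum_paths_eq_surv[OF X])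
  finally show ?thesis .
qed

abbreviation dissent :: "nat \<Rightarrow> nat set set" where
  "dissent n \<equiv> Pow {..<n} - {{}, {..<n}}"

lemma T_cons_le_iff: "T_cons n \<omega> \<le> enat t \<longleftrightarrow> (\<exists>i\<le>t. \<omega> i \<in> {{}, {..<n}})"
proof
  assume le: "T_cons n \<omega> \<le> enat t"
  show "\<exists>i\<le>t. \<omega> i \<in> {{}, {..<n}}"
  proof (rule ccontr)
    assume "\<not> ?thesis"
    then have "enat (Suc t) \<le> T_cons n \<omega>"
      unfolding T_cons_def by (intro Inf_greatest) (auto simp: not_le Suc_le_eq)
    with le have "enat (Suc t) \<le> enat t" by (rule order.trans[rotated])
    then show False by simp
  qed
next
  assume "\<exists>i\<le>t. \<omega> i \<in> {{}, {..<n}}"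
  then obtain i where "i \<le> t" "\<omega> i = {} \<or> \<omega> i = {..<n}" by auto
  then have "T_cons n \<omega> \<le> enat i" unfolding T_cons_def by (intro Inf_lower) auto
  also have "\<dots> \<le> enat t" using \<open>i \<le> t\<close> by simp
  finally show "T_cons n \<omega> \<le> enat t" .
qed

lemma T_cons_le_real_iff:
  "ereal_of_enat (T_cons n \<omega>) \<le> ereal x \<longleftrightarrow> (\<exists>i. real i \<le> x \<and> \<omega> i \<in> {{}, {..<n}})"
proof
  assume le: "ereal_of_enat (T_cons n \<omega>) \<le> ereal x"
  then obtain k where k: "T_cons n \<omega> = enat k" by (cases "T_cons n \<omega>") auto
  then obtain i where i: "i \<le> k" "\<omega> i \<in> {{}, {..<n}}" using T_cons_le_iff[of n \<omega> k] by auto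
  have "real k \<le> x" using le k by simp
  then have "real i \<le> x" using i(1) by linarith
  then show "\<exists>i. real i \<le> x \<and> \<omega> i \<in> {{}, {..<n}}" using i(2) by blast
next
  assume "\<exists>i. real i \<le> x \<and> \<omega> i \<in> {{}, {..<n}}"
  then obtain i where i: "real i \<le> x" "\<omega> i \<in> {{}, {..<n}}" by blast
  then have "T_cons n \<omega> \<le> enat i" using T_cons_le_iff by blast
  then have "ereal_of_enat (T_cons n \<omega>) \<le> ereal_of_enat (enat i)" by (simp only: ereal_of_enat_le_iff)
  also have "\<dots> \<le> ereal x" using i by simp
  finally show "ereal_of_enat (T_cons n \<omega>) \<le> ereal x" .
qed

lemma T_cons_ge_real:
  assumes "\<And>i. i \<le> t \<Longrightarrow> \<omega> i \<notin> {{}, {..<n}}" "x \<le> real t + 1"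
  shows "ereal x \<le> ereal_of_enat (T_cons n \<omega>)"
proof -
  have "\<not> T_cons n \<omega> \<le> enat t" using assms(1) unfolding T_cons_le_iff by blast
  then have "enat (Suc t) \<le> T_cons n \<omega>" by (simp add: not_le Suc_ile_eq)
  then have "ereal_of_enat (enat (Suc t)) \<le> ereal_of_enat (T_cons n \<omega>)" by (simp only: ereal_of_enat_le_iff)
  then have "ereal (real t + 1) \<le> ereal_of_enat (T_cons n \<omega>)" by (simp add: add.commute)
  then show ?thesis using assms(2) by (meson ereal_less_eq(3) order.trans)
qed

lemma T_cons_sets:
  "{\<omega>. ereal_of_enat (T_cons n \<omega>) \<le> ereal x} \<in> sets (voting_chain f n E A)"
  "{\<omega>. ereal_of_enat (T_cons n \<omega>) \<ge> ereal x} \<in> sets (voting_chain f n E A)"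
proof -
  let ?M = "voting_chain f n E A"
  have le: "{\<omega>. ereal_of_enat (T_cons n \<omega>) \<le> ereal x} \<in> sets ?M" for x
  proof -
    have "{\<omega>. ereal_of_enat (T_cons n \<omega>) \<le> ereal x} = (\<Union>i\<in>{i. real i \<le> x}. {\<omega>. \<omega> i \<in> {{}, {..<n}}})"
      unfolding T_cons_le_real_iff by auto
    also have "\<dots> \<in> sets ?M"
      by (intro sets.countable_UN') (use voting_chain_coordinate_sets in blast)+
    finally show ?thesis .
  qed
  then show "{\<omega>. ereal_of_enat (T_cons n \<omega>) \<le> ereal x} \<in> sets ?M" .
  have "{\<omega>. ereal_of_enat (T_cons n \<omega>) \<ge> ereal x}
      = UNIV - (\<Union>i\<in>{i. real i < x}. {\<omega>. \<omega> i \<in> {{}, {..<n}}})"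
  proof (intro equalityI subsetI)
    fix \<omega> assume \<omega>: "\<omega> \<in> {\<omega>. ereal x \<le> ereal_of_enat (T_cons n \<omega>)}"
    have "\<omega> i \<notin> {{}, {..<n}}" if "real i < x" for i
    proof
      assume "\<omega> i \<in> {{}, {..<n}}"
      then have "ereal_of_enat (T_cons n \<omega>) \<le> ereal (real i)" using T_cons_le_real_iff by blast
      also have "\<dots> < ereal x" using that by simp
      finally show False using \<omega> by auto
    qed
    then show "\<omega> \<in> UNIV - (\<Union>i\<in>{i. real i < x}. {\<omega>. \<omega> i \<in> {{}, {..<n}}})" by blast
  next
    fix \<omega> assume *: "\<omega> \<in> UNIV - (\<Union>i\<in>{i. real i < x}. {\<omega>. \<omega> i \<in> {{}, {..<n}}})"
    show "\<omega> \<in> {\<omega>. ereal x \<le> ereal_of_enat (T_cons n \<omega>)}"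
    proof (rule ccontr)
      assume "\<not> ?thesis"
      then have lt: "ereal_of_enat (T_cons n \<omega>) < ereal x" by simp
      then obtain k where k: "T_cons n \<omega> = enat k" by (cases "T_cons n \<omega>") auto
      then obtain i where i: "i \<le> k" "\<omega> i \<in> {{}, {..<n}}" using T_cons_le_iff[of n \<omega> k] by auto
      have "real k < x" using lt k by simp
      then have "real i < x" using i(1) by linarith
      then show False using * i(2) by blast
    qed
  qed
  moreover have "(\<Union>i\<in>{i. real i < x}. {\<omega>. \<omega> i \<in> {{}, {..<n}}}) \<in> sets ?M"
    by (intro sets.countable_UN') (use voting_chain_coordinate_sets in blast)+
  ultimately show "{\<omega>. ereal_of_enat (T_cons n \<omega>) \<ge> ereal x} \<in> sets ?M"
    by (metis sets.compl_sets space_voting_chain)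
qed

lemma surv_Pow: "A \<subseteq> {..<n} \<Longrightarrow> surv (voting_step f n E) (Pow {..<n}) t A = 1"
proof (induction t arbitrary: A)
  case (Suc t)
  have "surv (voting_step f n E) (Pow {..<n}) t B = 1" if "B \<in> set_pmf (voting_step f n E A)" for B
    using that set_pmf_voting_step[of f n E A] by (intro Suc.IH) blast
  then have "measure_pmf.expectation (voting_step f n E A) (surv (voting_step f n E) (Pow {..<n}) t)
      = measure_pmf.expectation (voting_step f n E A) (\<lambda>_. 1)"
    by (intro integral_cong_AE) (simp_all add: AE_measure_pmf_iff)
  then show ?case using Suc.prems by simp
qed simp

text \<open>Trajectories range over all sets of naturals, so consensus is not the mere complement of
  \<open>dissent n\<close>. Staying in \<open>Pow {..<n}\<close> has full measure, and removing the
  event of staying in \<open>dissent n\<close> leaves a subset of the target event.\<close>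

lemma prob_T_cons_le:
  assumes "A \<subseteq> {..<n}" "real t \<le> x"
  shows "\<P>(\<omega> in voting_chain f n E A. ereal_of_enat (T_cons n \<omega>) \<le> ereal x)
    \<ge> 1 - surv (voting_step f n E) (dissent n) t A"
proof -
  let ?M = "voting_chain f n E A"
  let ?S = "\<lambda>X. {\<omega>. \<forall>i\<le>t. \<omega> i \<in> X}"
  interpret M: prob_space ?M by (rule prob_space_voting_chain)
  have S: "?S X \<in> sets ?M" for X
    using voting_chain_all_sets[of "{..t}" "\<lambda>_. X" f n E A] by (simp add: Ball_def)
  have "measure ?M (?S (Pow {..<n})) = 1"
    by (subst measure_voting_chain_surv[OF order_refl]) (rule surv_Pow[OF assms(1)])
  moreover have "measure ?M (?S (dissent n)) = surv (voting_step f n E) (dissent n) t A"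
    by (rule measure_voting_chain_surv) blast
  ultimately have "1 - surv (voting_step f n E) (dissent n) t A
      = measure ?M (?S (Pow {..<n})) - measure ?M (?S (dissent n))" by linarith
  also have "\<dots> = measure ?M (?S (Pow {..<n}) - ?S (dissent n))"
    by (rule M.finite_measure_Diff[symmetric, OF S S]) blast
  also have "\<dots> \<le> measure ?M {\<omega>. ereal_of_enat (T_cons n \<omega>) \<le> ereal x}"
  proof (rule M.finite_measure_mono[OF _ T_cons_sets(1)])
    show "?S (Pow {..<n}) - ?S (dissent n) \<subseteq> {\<omega>. ereal_of_enat (T_cons n \<omega>) \<le> ereal x}"
    proof
      fix \<omega> assume "\<omega> \<in> ?S (Pow {..<n}) - ?S (dissent n)"
      then obtain i where "i \<le> t" "\<omega> i \<in> {{}, {..<n}}" by blast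
      moreover have "real i \<le> x" using \<open>i \<le> t\<close> assms(2) by linarith
      ultimately show "\<omega> \<in> {\<omega>. ereal_of_enat (T_cons n \<omega>) \<le> ereal x}"
        unfolding mem_Collect_eq T_cons_le_real_iff by blast
    qed
  qed
  finally show ?thesis by (simp add: space_voting_chain)
qed

text \<open>Dissent at times 0 to \<open>t\<close> puts the consensus time at \<open>t + 1\<close>
  or later; the extra 1 compensates for rounding \<open>t\<close> down.\<close>

lemma prob_T_cons_ge:
  assumes "x \<le> real t + 1"
  shows "\<P>(\<omega> in voting_chain f n E A. ereal_of_enat (T_cons n \<omega>) \<ge> ereal x)
    \<ge> surv (voting_step f n E) (dissent n) t A"
proof -
  let ?M = "voting_chain f n E A"
  interpret M: prob_space ?M by (rule prob_space_voting_chain)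
  have "surv (voting_step f n E) (dissent n) t A = measure ?M {\<omega>. \<forall>i\<le>t. \<omega> i \<in> dissent n}"
    by (subst measure_voting_chain_surv) auto
  also have "\<dots> \<le> measure ?M {\<omega>. ereal_of_enat (T_cons n \<omega>) \<ge> ereal x}"
    by (intro M.finite_measure_mono T_cons_sets(2)) (use assms T_cons_ge_real in blast)
  finally show ?thesis by (simp add: space_voting_chain)
qed

section \<open>One round of voting\<close>

lemma Pi_bernoulli_component_sum:
  fixes w p :: "'a \<Rightarrow> real"
  assumes "finite I" "\<And>i. i \<in> I \<Longrightarrow> p i \<in> {0..1}"
  shows "measure_pmf.expectation (Pi_pmf I False (\<lambda>i. bernoulli_pmf (p i))) (\<lambda>b. \<Sum>i\<in>I. w i * of_bool (b i))
    = (\<Sum>i\<in>I. w i * p i)"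
proof -
  let ?M = "Pi_pmf I False (\<lambda>i. bernoulli_pmf (p i))"
  have fin: "finite (set_pmf ?M)"
    using assms(1) by (intro finite_subset[OF set_Pi_pmf_subset'] finite_PiE_dflt) auto
  have "measure_pmf.expectation ?M (\<lambda>b. of_bool (b i)) = p i" if i: "i \<in> I" for i
  proof -
    have "p i = measure_pmf.expectation (bernoulli_pmf (p i)) of_bool"
      using assms(2)[OF i] by simp
    also have "bernoulli_pmf (p i) = map_pmf (\<lambda>b. b i) ?M"
      using i by (subst Pi_pmf_component[OF assms(1)]) auto
    finally show ?thesis by simp
  qed
  then show ?thesis
    using integrable_measure_pmf_finite[OF fin] by (subst Bochner_Integration.integral_sum) auto
qed

lemma Pi_bernoulli_Hoeffding:
  fixes w p :: "'a \<Rightarrow> real"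
  assumes I: "finite I" "I \<noteq> {}" and p: "\<And>i. i \<in> I \<Longrightarrow> p i \<in> {0..1}" and w: "\<And>i. i \<in> I \<Longrightarrow> w i > 0"
    and s: "(\<Sum>i\<in>I. (w i)\<^sup>2) \<le> s" and t: "t \<ge> 0"
  defines "M \<equiv> Pi_pmf I False (\<lambda>i. bernoulli_pmf (p i))"
  defines "m \<equiv> \<Sum>i\<in>I. w i * p i"
  shows "measure_pmf.prob M {b. (\<Sum>i\<in>I. w i * of_bool (b i)) \<ge> m + t} \<le> exp (-2 * t\<^sup>2 / s)"
    and "measure_pmf.prob M {b. (\<Sum>i\<in>I. w i * of_bool (b i)) \<le> m - t} \<le> exp (-2 * t\<^sup>2 / s)"
proof -
  let ?X = "\<lambda>i b. w i * of_bool (b i)"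
  have fin: "finite (set_pmf M)" unfolding M_def
    using I(1) by (intro finite_subset[OF set_Pi_pmf_subset'] finite_PiE_dflt) auto
  have "prob_space.indep_vars (measure_pmf M) (\<lambda>_. borel) (\<lambda>i. (\<lambda>x. w i * of_bool x) \<circ> (\<lambda>b. b i)) I"
    unfolding M_def
    by (intro prob_space.indep_vars_compose[OF measure_pmf.prob_space_axioms indep_vars_Pi_pmf[OF I(1)]]) auto
  then have indep: "prob_space.indep_vars (measure_pmf M) (\<lambda>_. borel) ?X I" by (simp add: comp_def)
  have m: "m = (\<Sum>i\<in>I. measure_pmf.expectation M (?X i))"
  proof -
    have "m = measure_pmf.expectation M (\<lambda>b. \<Sum>i\<in>I. ?X i b)"
      unfolding m_def M_def by (rule Pi_bernoulli_component_sum[symmetric, OF I(1) p])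
    also have "\<dots> = (\<Sum>i\<in>I. measure_pmf.expectation M (?X i))"
      using integrable_measure_pmf_finite[OF fin] by (intro Bochner_Integration.integral_sum) auto
    finally show ?thesis .
  qed
  interpret Hoeffding_ineq "measure_pmf M" I ?X "\<lambda>_. 0" w m
    by unfold_locales (use I indep w m in \<open>auto simp: AE_measure_pmf_iff less_imp_le\<close>)
  have pos: "(\<Sum>i\<in>I. (w i - 0)\<^sup>2) > 0"
  proof (rule sum_pos[OF I])
    show "(w i - 0)\<^sup>2 > 0" if "i \<in> I" for i using w[OF that] by simp
  qed
  have mono: "exp (-2 * t\<^sup>2 / (\<Sum>i\<in>I. (w i - 0)\<^sup>2)) \<le> exp (-2 * t\<^sup>2 / s)"
    using s pos by (simp add: divide_left_mono mult_pos_pos)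
  show "measure_pmf.prob M {b. (\<Sum>i\<in>I. ?X i b) \<ge> m + t} \<le> exp (-2 * t\<^sup>2 / s)"
    using order.trans[OF Hoeffding_ineq_ge[OF t pos] mono] by simp
  show "measure_pmf.prob M {b. (\<Sum>i\<in>I. ?X i b) \<le> m - t} \<le> exp (-2 * t\<^sup>2 / s)"
    using order.trans[OF Hoeffding_ineq_le[OF t pos] mono] by simp
qed

text \<open>For \<open>p\<close> strictly between 0 and 1 the left-hand side is one plus the
  chi-square divergence, \<open>1 + (q - p)^2 / (p * (1 - p))\<close>. The alternative
  \<open>q = p\<close> covers coordinates that are not tilted, where \<open>p\<close> may be 0 or
  1.\<close>

lemma bernoulli_second_moment_ratio:
  fixes p q :: real
  assumes "p \<in> {0..1}" "q \<in> {0..1}" "q = p \<or> (e \<le> p \<and> p \<le> 1 - e)" "\<bar>q - p\<bar> \<le> d" "e > 0"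
  shows "measure_pmf.expectation (bernoulli_pmf p)
      (\<lambda>x. (pmf (bernoulli_pmf q) x / pmf (bernoulli_pmf p) x)\<^sup>2) \<le> exp (d\<^sup>2 / e\<^sup>2)"
proof (cases "q = p")
  case True
  have "(x / x)\<^sup>2 \<le> 1" for x :: real by (cases "x = 0") auto
  then have "measure_pmf.expectation (bernoulli_pmf p)
      (\<lambda>x. (pmf (bernoulli_pmf q) x / pmf (bernoulli_pmf p) x)\<^sup>2)
      \<le> measure_pmf.expectation (bernoulli_pmf p) (\<lambda>x. 1)"
    unfolding True by (intro expectation_mono_finite) auto
  also have "\<dots> \<le> exp (d\<^sup>2 / e\<^sup>2)" by simp
  finally show ?thesis .
next
  case False
  then have pe: "e \<le> p" "e \<le> 1 - p" "0 < p" "0 < 1 - p" using assms by auto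
  have "measure_pmf.expectation (bernoulli_pmf p)
      (\<lambda>x. (pmf (bernoulli_pmf q) x / pmf (bernoulli_pmf p) x)\<^sup>2) = q\<^sup>2 / p + (1 - q)\<^sup>2 / (1 - p)"
  proof -
    have "p * (q / p)\<^sup>2 = q\<^sup>2 / p" "(1 - p) * ((1 - q) / (1 - p))\<^sup>2 = (1 - q)\<^sup>2 / (1 - p)"
      using pe by (simp_all add: power2_eq_square)
    then show ?thesis using assms(1,2) by (simp add: mult.commute)
  qed
  also have "\<dots> = 1 + (q - p)\<^sup>2 / (p * (1 - p))"
    using pe by (simp add: field_simps power2_eq_square)
  also have "\<dots> \<le> 1 + d\<^sup>2 / (e * e)"
    using assms pe by (intro add_left_mono frac_le mult_mono) (auto simp: abs_le_square_iff[symmetric])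
  also have "\<dots> \<le> exp (d\<^sup>2 / e\<^sup>2)" by (simp add: power2_eq_square)
  finally show ?thesis .
qed

text \<open>Cauchy-Schwarz for the likelihood ratio of two product measures.\<close>

lemma Pi_bernoulli_tilt:
  fixes p q :: "'a \<Rightarrow> real"
  assumes I: "finite I" and p: "\<And>i. i \<in> I \<Longrightarrow> p i \<in> {0..1}" and q: "\<And>i. i \<in> I \<Longrightarrow> q i \<in> {0..1}"
    and pq: "\<And>i. i \<in> I \<Longrightarrow> q i = p i \<or> (e \<le> p i \<and> p i \<le> 1 - e)"
    and d: "\<And>i. i \<in> I \<Longrightarrow> \<bar>q i - p i\<bar> \<le> d" and e: "e > 0"
  defines "M \<equiv> \<lambda>p. Pi_pmf I False (\<lambda>i. bernoulli_pmf (p i))"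
  shows "(measure_pmf.prob (M q) S)\<^sup>2 \<le> measure_pmf.prob (M p) S * exp (real (card I) * d\<^sup>2 / e\<^sup>2)"
proof -
  define \<Omega> where "\<Omega> = PiE_dflt I False (\<lambda>_. UNIV :: bool set)"
  have fin: "finite \<Omega>" unfolding \<Omega>_def using I by (intro finite_PiE_dflt) auto
  have supp: "set_pmf (M p) \<subseteq> \<Omega>" for p
    unfolding M_def \<Omega>_def by (rule order.trans[OF set_Pi_pmf_subset'[OF I]]) (auto simp: PiE_dflt_def)
  have prob: "measure_pmf.prob (M p) S = (\<Sum>b\<in>S \<inter> \<Omega>. pmf (M p) b)" for p
  proof -
    have "measure_pmf.prob (M p) S = measure_pmf.prob (M p) (S \<inter> \<Omega>)"
      using supp[of p] by (intro measure_prob_cong_0) (auto simp: set_pmf_iff)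
    then show ?thesis using fin by (simp add: measure_measure_pmf_finite)
  qed
  have pm: "pmf (M p) b = (\<Prod>i\<in>I. pmf (bernoulli_pmf (p i)) (b i))" if "b \<in> \<Omega>" for p b
    using that I unfolding M_def \<Omega>_def by (intro pmf_Pi') (auto simp: PiE_dflt_def)
  \<comment> \<open>Absolute continuity: a vanishing factor of the untilted mass means that
    \<open>p i\<close> is 0 or 1, and such a coordinate is not tilted. This settles the division by
    zero in the likelihood ratio.\<close>
  have zero: "pmf (M q) b = 0" if b: "b \<in> \<Omega>" "pmf (M p) b = 0" for b
  proof -
    obtain i where i: "i \<in> I" "pmf (bernoulli_pmf (p i)) (b i) = 0"
      using b(2) I unfolding pm[OF b(1)] by auto
    then have "q i = p i" using pq[OF i(1)] p[OF i(1)] e by (cases "b i") auto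
    then show ?thesis unfolding pm[OF b(1)] using i I by (intro prod_zero bexI[of _ i]) auto
  qed
  have "measure_pmf.prob (M q) S = (\<Sum>b\<in>S \<inter> \<Omega>. sqrt (pmf (M p) b) * (pmf (M q) b / sqrt (pmf (M p) b)))"
    unfolding prob using zero by (intro sum.cong refl) auto
  then have "(measure_pmf.prob (M q) S)\<^sup>2
      \<le> (\<Sum>b\<in>S \<inter> \<Omega>. (sqrt (pmf (M p) b))\<^sup>2) * (\<Sum>b\<in>S \<inter> \<Omega>. (pmf (M q) b / sqrt (pmf (M p) b))\<^sup>2)"
    by (simp only: Cauchy_Schwarz_ineq_sum)
  also have "\<dots> \<le> measure_pmf.prob (M p) S * exp (real (card I) * d\<^sup>2 / e\<^sup>2)"
  proof (rule mult_mono)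
    show "(\<Sum>b\<in>S \<inter> \<Omega>. (sqrt (pmf (M p) b))\<^sup>2) \<le> measure_pmf.prob (M p) S"
      unfolding prob by simp
    have "(\<Sum>b\<in>S \<inter> \<Omega>. (pmf (M q) b / sqrt (pmf (M p) b))\<^sup>2) \<le> (\<Sum>b\<in>\<Omega>. (pmf (M q) b / sqrt (pmf (M p) b))\<^sup>2)"
      using fin by (intro sum_mono2) auto
    also have "\<dots> = (\<Sum>b\<in>\<Omega>. pmf (M p) b * (\<Prod>i\<in>I. (pmf (bernoulli_pmf (q i)) (b i) / pmf (bernoulli_pmf (p i)) (b i))\<^sup>2))"
    proof (intro sum.cong refl)
      fix b assume b: "b \<in> \<Omega>"
      have "(pmf (M q) b / sqrt (pmf (M p) b))\<^sup>2 = pmf (M p) b * (pmf (M q) b / pmf (M p) b)\<^sup>2"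
        by (cases "pmf (M p) b = 0") (auto simp: power_divide power2_eq_square)
      also have "pmf (M q) b / pmf (M p) b = (\<Prod>i\<in>I. pmf (bernoulli_pmf (q i)) (b i) / pmf (bernoulli_pmf (p i)) (b i))"
        by (simp add: pm[OF b] prod_dividef)
      finally show "(pmf (M q) b / sqrt (pmf (M p) b))\<^sup>2
        = pmf (M p) b * (\<Prod>i\<in>I. (pmf (bernoulli_pmf (q i)) (b i) / pmf (bernoulli_pmf (p i)) (b i))\<^sup>2)"
        by (simp add: prod_power_distrib)
    qed
    also have "\<dots> = measure_pmf.expectation (M p)
        (\<lambda>b. \<Prod>i\<in>I. (pmf (bernoulli_pmf (q i)) (b i) / pmf (bernoulli_pmf (p i)) (b i))\<^sup>2)"
      using supp[of p] by (subst integral_measure_pmf_real[OF fin]) (auto simp: mult.commute)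
    also have "\<dots> = (\<Prod>i\<in>I. measure_pmf.expectation (bernoulli_pmf (p i))
        (\<lambda>x. (pmf (bernoulli_pmf (q i)) x / pmf (bernoulli_pmf (p i)) x)\<^sup>2))"
      unfolding M_def by (rule expectation_prod_Pi_pmf[OF I]) (auto intro: integrable_measure_pmf_finite)
    also have "\<dots> \<le> (\<Prod>i\<in>I. exp (d\<^sup>2 / e\<^sup>2))"
      using p q pq d e
      by (intro prod_mono conjI bernoulli_second_moment_ratio integral_nonneg_AE) auto
    also have "\<dots> = exp (real (card I) * d\<^sup>2 / e\<^sup>2)" by (simp add: exp_of_nat_mult flip: times_divide_eq_right)
    finally show "(\<Sum>b\<in>S \<inter> \<Omega>. (pmf (M q) b / sqrt (pmf (M p) b))\<^sup>2) \<le> exp (real (card I) * d\<^sup>2 / e\<^sup>2)" .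
  qed (auto intro: sum_nonneg)
  finally show ?thesis .
qed

section \<open>Drift and concentration of the mass\<close>

locale expander_voting = voting_graph n E + quasi_majority_voting f f' K
  for n :: nat and E :: "nat set set" and f f' :: "real \<Rightarrow> real" and K :: real +
  fixes lam C1 :: real
  assumes expander: "expander lam n E" and max_deg: "real (max_deg n E) \<le> C1 * avg_deg n E"
    and C1_pos: "C1 > 0"
begin

abbreviation "V \<equiv> {..<n}"
abbreviation "step \<equiv> voting_step f n E"
abbreviation "nbr A v \<equiv> W (indicator A) v"
abbreviation "q A v \<equiv> next_zero_prob f n E A v"

definition mass :: "nat set \<Rightarrow> real" where
  "mass A = (\<Sum>v\<in>A. \<pi> v)"

definition mean_mass :: "nat set \<Rightarrow> real" where
  "mean_mass A = (\<Sum>v<n. \<pi> v * q A v)"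

lemma lam_nonneg: "lam \<ge> 0"
  by (rule expander_nonneg[OF expander])

lemma n_pos: "real n > 0"
  using n_ge_2 by simp

lemma mass_eq: "A \<subseteq> V \<Longrightarrow> mass A = (\<Sum>v<n. \<pi> v * indicator A v)"
  unfolding mass_def by (intro sum.mono_neutral_cong_left) (auto simp: indicator_def)

lemma mass_range: assumes "A \<subseteq> V" shows "mass A \<in> {0..1}"
proof -
  have "mass A \<le> (\<Sum>v<n. \<pi> v)"
    unfolding mass_def using assms by (intro sum_mono2) (auto simp: degree_dist_pos less_imp_le)
  moreover have "0 \<le> mass A"
    unfolding mass_def using assms by (intro sum_nonneg) (auto simp: degree_dist_pos less_imp_le)
  ultimately show ?thesis by (simp add: sum_degree_dist)
qed

lemma bias_eq: assumes "A \<subseteq> V" shows "bias n E A = 2 * mass A - 1"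
proof -
  have "(\<Sum>v\<in>V - A. \<pi> v) = (\<Sum>v<n. \<pi> v) - mass A"
    unfolding mass_def using assms by (intro sum_diff) auto
  then show ?thesis by (simp add: bias_def mass_def sum_degree_dist)
qed

lemma abs_bias_le_1: "A \<subseteq> V \<Longrightarrow> \<bar>bias n E A\<bar> \<le> 1"
  using mass_range[of A] by (auto simp: bias_eq)

text \<open>Both \<open>A\<close> and its complement contain a vertex, and every vertex has mass at
  least \<open>1 / n^2\<close>. This turns decay of \<open>1 - |bias|\<close> below a polynomial
  threshold into consensus.\<close>

lemma one_minus_abs_bias_ge:
  assumes "A \<in> dissent n" shows "1 - \<bar>bias n E A\<bar> \<ge> 2 / (real n)\<^sup>2"
proof -
  have ge: "mass B \<ge> 1 / (real n)\<^sup>2" if "B \<subseteq> V" "B \<noteq> {}" for B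
  proof -
    obtain v where v: "v \<in> B" "v < n" using \<open>B \<subseteq> V\<close> \<open>B \<noteq> {}\<close> by auto
    have "\<pi> v \<le> mass B"
      unfolding mass_def using that v finite_subset[OF \<open>B \<subseteq> V\<close>]
      by (intro member_le_sum) (auto simp: degree_dist_pos less_imp_le subset_eq)
    then show ?thesis using degree_dist_ge[OF v(2)] by linarith
  qed
  have A: "A \<subseteq> V" "A \<noteq> {}" "V - A \<noteq> {}" using assms by auto
  have "mass (V - A) = 1 - mass A"
    unfolding mass_def using A(1) by (subst sum_diff) (auto simp: sum_degree_dist)
  then show ?thesis using ge[of A] ge[of "V - A"] A by (auto simp: bias_eq abs_if)
qed

text \<open>The degree condition enters concentration here: no vertex has more than
  \<open>C1\<close> times the average mass, so the mass fluctuates on the scale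
  \<open>C1 / sqrt n\<close>.\<close>

lemma sum_degree_dist_sq_le: "(\<Sum>v<n. (\<pi> v)\<^sup>2) \<le> C1\<^sup>2 / n"
proof -
  have "(\<Sum>v<n. (\<pi> v)\<^sup>2) \<le> (\<Sum>v<n. (C1 / n)\<^sup>2)"
    using degree_dist_le[OF max_deg] degree_dist_pos by (intro sum_mono power_mono) (auto intro: less_imp_le)
  also have "\<dots> = C1\<^sup>2 / n" using n_ge_2 by (simp add: power2_eq_square)
  finally show ?thesis .
qed

lemma deg_in_eq_nbr:
  assumes "A \<subseteq> V" "v < n" shows "real (deg_in E A v) / d v = nbr A v"
  using assms by (simp add: deg_in_eq_sum W_def)

lemma nbr_range: assumes "v < n" shows "nbr A v \<in> {0..1}"
proof -
  have "0 \<le> (\<Sum>u<n. adj v u * indicator A u)"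
    by (intro sum_nonneg) (auto simp: adj_nonneg)
  moreover have "(\<Sum>u<n. adj v u * indicator A u) \<le> d v"
    unfolding deg_eq_sum by (intro sum_mono) (auto simp: adj_def indicator_def)
  ultimately show ?thesis using deg_pos[OF assms] by (simp add: W_def divide_le_eq)
qed

lemma nbr_compl: assumes "v < n" shows "nbr (V - A) v = 1 - nbr A v"
proof -
  have "nbr (V - A) v = W (\<lambda>u. 1 + (-1) * indicator A u) v"
    by (rule W_cong) (simp add: indicator_def)
  also have "\<dots> = 1 - nbr A v" using W_const[OF assms, of 1] by (simp only: W_add W_scale)
  finally show ?thesis .
qed

lemma q_eq:
  assumes "A \<subseteq> V" "v < n"
  shows "q A v = (if v \<in> A then 1 - f (1 - nbr A v) else f (nbr A v))"
  using assms deg_in_eq_nbr[of "V - A" v] by (simp add: next_zero_prob_def deg_in_eq_nbr nbr_compl)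

lemma q_range: assumes "A \<subseteq> V" "v < n" shows "q A v \<in> {0..1}"
  using f_range[of "nbr A v"] f_range[of "1 - nbr A v"] nbr_range[OF assms(2), of A]
  by (auto simp: q_eq[OF assms])

lemma ip_Cauchy_Schwarz: "(ip g h)\<^sup>2 \<le> ip g g * ip h h"
proof -
  have sq: "sqrt (\<pi> v) * sqrt (\<pi> v) = \<pi> v" if "v < n" for v
    using degree_dist_pos[OF that] by simp
  have "ip g h = (\<Sum>v<n. (sqrt (\<pi> v) * g v) * (sqrt (\<pi> v) * h v))"
    unfolding ip_def using sq by (intro sum.cong refl) (simp add: mult.assoc mult.left_commute)
  moreover have "ip g g = (\<Sum>v<n. (sqrt (\<pi> v) * g v)\<^sup>2)" for g
    unfolding ip_def power2_eq_square using sq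
    by (intro sum.cong refl) (simp add: mult.assoc mult.left_commute)
  ultimately show ?thesis by (simp only: Cauchy_Schwarz_ineq_sum)
qed

text \<open>The indicator with its mean removed, so that \<open>W_contraction\<close>
  applies.\<close>

definition centered :: "nat set \<Rightarrow> nat \<Rightarrow> real" where
  "centered A v = indicator A v - mass A"

lemma ip_centered:
  assumes "A \<subseteq> V"
  shows "ip (centered A) (\<lambda>_. 1) = 0" "ip (centered A) (centered A) = mass A * (1 - mass A)"
proof -
  have c: "ip (centered A) h = ip (indicator A) h - mass A * ip (\<lambda>_. 1) h" for h
    unfolding ip_def centered_def by (simp add: algebra_simps sum_subtractf sum_distrib_left)
  have 1: "ip (\<lambda>_. 1) (\<lambda>_. 1) = 1" by (simp add: ip_def sum_degree_dist)
  have A1: "ip (indicator A) (\<lambda>_. 1) = mass A" using assms by (simp add: ip_def mass_eq)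
  have AA: "ip (indicator A) (indicator A) = mass A"
  proof -
    have "indicator A v * indicator A v = (indicator A v :: real)" for v by (simp add: indicator_def)
    then show ?thesis unfolding mass_eq[OF assms] ip_def by (simp only: mult.assoc)
  qed
  show c1: "ip (centered A) (\<lambda>_. 1) = 0" unfolding c 1 A1 by simp
  show "ip (centered A) (centered A) = mass A * (1 - mass A)"
  proof -
    have "ip (centered A) (centered A) = ip (centered A) (indicator A) - mass A * ip (centered A) (\<lambda>_. 1)"
      unfolding c[of "centered A"] by (simp only: ip_commute)
    also have "\<dots> = mass A - mass A * ip (indicator A) (\<lambda>_. 1)"
      unfolding c1 c[of "indicator A"] AA by (simp add: ip_commute)
    finally show ?thesis unfolding A1 by (simp add: algebra_simps)
  qed
qed

lemma W_centered: assumes "v < n" shows "W (centered A) v = nbr A v - mass A"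
proof -
  have "W (centered A) v = W (\<lambda>u. indicator A u + (- mass A)) v"
    by (rule W_cong) (simp add: centered_def)
  then show ?thesis using W_const[OF assms, of "- mass A"] by (simp only: W_add)
qed

lemma neighbourhood_variance:
  assumes "A \<subseteq> V"
  shows "(\<Sum>v<n. \<pi> v * (nbr A v - mass A)\<^sup>2) \<le> lam\<^sup>2 * (mass A * (1 - mass A))"
proof -
  have "(\<Sum>v<n. \<pi> v * (nbr A v - mass A)\<^sup>2) = ip (W (centered A)) (W (centered A))"
    unfolding ip_def by (intro sum.cong refl) (simp add: W_centered power2_eq_square)
  also have "\<dots> \<le> lam\<^sup>2 * ip (centered A) (centered A)"
    by (rule W_contraction[OF expander ip_centered(1)[OF assms]])
  finally show ?thesis by (simp add: ip_centered(2)[OF assms])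
qed

lemma expander_mixing:
  assumes "A \<subseteq> V"
  shows "\<bar>ip (centered A) (W (centered A))\<bar> \<le> lam * (mass A * (1 - mass A))"
proof -
  let ?g = "centered A" and ?b = "mass A * (1 - mass A)"
  have b: "?b \<ge> 0" using mass_range[OF assms] by auto
  have "(ip ?g (W ?g))\<^sup>2 \<le> ip ?g ?g * ip (W ?g) (W ?g)" by (rule ip_Cauchy_Schwarz)
  also have "\<dots> \<le> ?b * (lam\<^sup>2 * ?b)"
    using W_contraction[OF expander ip_centered(1)[OF assms]] b
    by (intro mult_mono) (auto simp: ip_centered(2)[OF assms] ip_nonneg)
  also have "\<dots> = (lam * ?b)\<^sup>2" by (simp add: power2_eq_square)
  finally have "\<bar>ip ?g (W ?g)\<bar> \<le> \<bar>lam * ?b\<bar>" by (simp only: abs_le_square_iff)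
  also have "\<dots> = lam * ?b" by (rule abs_of_nonneg[OF mult_nonneg_nonneg[OF lam_nonneg b]])
  finally show ?thesis .
qed

text \<open>The first-order terms of the Taylor expansions at \<open>mass A\<close> on \<open>A\<close> and on its complement
  are opposite multiples of the same sum, so the coefficient that survives is
  \<open>f' (1 - mass A) - f' (mass A)\<close>, which is of the order of the bias.\<close>

lemma mean_mass_drift:
  assumes "A \<subseteq> V"
  defines "a \<equiv> mass A"
  shows "\<bar>mean_mass A - H a\<bar> \<le> K * lam * (\<bar>2 * a - 1\<bar> + lam) * (a * (1 - a))"
proof -
  define i where "i v = (indicator A v :: real)" for v
  define x where "x v = nbr A v - a" for v
  define base where "base v = i v * (1 - f (1 - a)) + (1 - i v) * f a" for v
  define c where "c v = i v * f' (1 - a) + (1 - i v) * f' a" for v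
  have a: "a \<in> {0..1}" unfolding a_def by (rule mass_range[OF assms(1)])
  have err: "\<bar>q A v - base v - c v * x v\<bar> \<le> K * (x v)\<^sup>2" if v: "v < n" for v
  proof (cases "v \<in> A")
    case True
    have "\<bar>f (1 - nbr A v) - f (1 - a) - f' (1 - a) * ((1 - nbr A v) - (1 - a))\<bar>
        \<le> K * ((1 - nbr A v) - (1 - a))\<^sup>2"
      using a nbr_range[OF v, of A] by (intro f_taylor) auto
    moreover have "((1 - nbr A v) - (1 - a))\<^sup>2 = (x v)\<^sup>2"
      by (simp add: x_def power2_commute)
    moreover have "q A v - base v - c v * x v
        = - (f (1 - nbr A v) - f (1 - a) - f' (1 - a) * ((1 - nbr A v) - (1 - a)))"
      using True v assms(1) by (simp add: q_eq base_def c_def i_def x_def algebra_simps)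
    ultimately show ?thesis by (simp only: abs_minus_cancel)
  next
    case False
    have "\<bar>f (nbr A v) - f a - f' a * (nbr A v - a)\<bar> \<le> K * (nbr A v - a)\<^sup>2"
      using a nbr_range[OF v, of A] by (intro f_taylor) auto
    then show ?thesis using False v assms(1) by (simp add: q_eq base_def c_def i_def x_def algebra_simps)
  qed
  have sum_i: "(\<Sum>v<n. \<pi> v * i v) = a" by (simp add: a_def mass_eq[OF assms(1)] i_def)
  have sum_base: "(\<Sum>v<n. \<pi> v * base v) = H a"
  proof -
    have "(\<Sum>v<n. \<pi> v * base v) = (\<Sum>v<n. (1 - f (1 - a) - f a) * (\<pi> v * i v) + f a * \<pi> v)"
      by (intro sum.cong refl) (simp add: base_def algebra_simps)
    also have "\<dots> = (1 - f (1 - a) - f a) * a + f a"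
      by (simp add: sum.distrib sum_i sum_degree_dist flip: sum_distrib_left)
    finally show ?thesis by (simp add: updating_function_def algebra_simps)
  qed
  let ?g = "centered A"
  have x: "x v = W ?g v" if "v < n" for v using that by (simp add: x_def W_centered a_def)
  have sum_x: "(\<Sum>v<n. \<pi> v * x v) = 0"
    using ip_W_one[of ?g] ip_centered(1)[OF assms(1)] by (simp add: ip_def x)
  have sum_lin: "(\<Sum>v<n. \<pi> v * (c v * x v)) = (f' (1 - a) - f' a) * ip ?g (W ?g)"
  proof -
    \<comment> \<open>The coefficient \<open>c v\<close> is \<open>f' (1 - a) - f' a\<close> times
      the centered indicator plus a constant; the constant drops out by
      \<open>sum_x\<close>.\<close>
    have "(\<Sum>v<n. \<pi> v * (c v * x v))
        = (\<Sum>v<n. (f' (1 - a) - f' a) * (\<pi> v * ?g v * x v)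
            + ((f' (1 - a) - f' a) * a + f' a) * (\<pi> v * x v))"
      by (intro sum.cong refl) (simp add: c_def centered_def i_def a_def algebra_simps)
    also have "\<dots> = (f' (1 - a) - f' a) * (\<Sum>v<n. \<pi> v * ?g v * x v)"
      by (simp only: sum.distrib sum_distrib_left[symmetric] sum_x mult_zero_right add_0_right)
    also have "(\<Sum>v<n. \<pi> v * ?g v * x v) = ip ?g (W ?g)" by (simp add: ip_def x)
    finally show ?thesis .
  qed
  have "mean_mass A - H a = (\<Sum>v<n. \<pi> v * (q A v - base v - c v * x v)) + (\<Sum>v<n. \<pi> v * (c v * x v))"
    by (simp add: mean_mass_def sum_base[symmetric] sum_subtractf right_diff_distrib)
  then have "\<bar>mean_mass A - H a\<bar> \<le> \<bar>\<Sum>v<n. \<pi> v * (q A v - base v - c v * x v)\<bar>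
      + \<bar>(f' (1 - a) - f' a) * ip ?g (W ?g)\<bar>"
    unfolding sum_lin by linarith
  also have "\<dots> \<le> K * (lam\<^sup>2 * (a * (1 - a))) + K * \<bar>2 * a - 1\<bar> * (lam * (a * (1 - a)))"
  proof (rule add_mono)
    have "\<bar>\<Sum>v<n. \<pi> v * (q A v - base v - c v * x v)\<bar> \<le> (\<Sum>v<n. \<pi> v * (K * (x v)\<^sup>2))"
      using err degree_dist_pos
      by (intro order.trans[OF sum_abs] sum_mono) (auto simp: abs_mult abs_of_pos intro!: mult_left_mono)
    also have "\<dots> = K * (\<Sum>v<n. \<pi> v * (nbr A v - mass A)\<^sup>2)"
      by (simp add: sum_distrib_left x_def a_def mult_ac)
    also have "\<dots> \<le> K * (lam\<^sup>2 * (a * (1 - a)))"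
      using neighbourhood_variance[OF assms(1)] K_ge by (intro mult_left_mono) (auto simp: a_def)
    finally show "\<bar>\<Sum>v<n. \<pi> v * (q A v - base v - c v * x v)\<bar> \<le> K * (lam\<^sup>2 * (a * (1 - a)))" .
    have "\<bar>f' (1 - a) - f' a\<bar> \<le> K * \<bar>(1 - a) - a\<bar>" using a by (intro f'_lipschitz) auto
    also have "\<bar>(1 - a) - a\<bar> = \<bar>2 * a - 1\<bar>" by linarith
    finally show "\<bar>(f' (1 - a) - f' a) * ip ?g (W ?g)\<bar> \<le> K * \<bar>2 * a - 1\<bar> * (lam * (a * (1 - a)))"
      using expander_mixing[OF assms(1)] K_ge unfolding abs_mult a_def by (intro mult_mono) auto
  qed
  also have "\<dots> = K * lam * (\<bar>2 * a - 1\<bar> + lam) * (a * (1 - a))"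
    by (simp add: algebra_simps power2_eq_square)
  finally show ?thesis .
qed

lemma mass_Collect: "mass {v. v < n \<and> b v} = (\<Sum>v\<in>V \<inter> Collect b. \<pi> v)"
  unfolding mass_def by (rule sum.cong) auto

lemma expectation_mass:
  assumes "A \<subseteq> V" shows "measure_pmf.expectation (step A) mass = mean_mass A"
  using Pi_bernoulli_component_sum[of V "q A" \<pi>] q_range[OF assms]
  by (simp add: voting_step_def mass_Collect mean_mass_def)

lemma mass_tail:
  assumes "A \<subseteq> V" "t \<ge> 0"
  shows "measure_pmf.prob (step A) {B. mass B \<ge> mean_mass A + t} \<le> exp (-2 * t\<^sup>2 * n / C1\<^sup>2)"
    and "measure_pmf.prob (step A) {B. mass B \<le> mean_mass A - t} \<le> exp (-2 * t\<^sup>2 * n / C1\<^sup>2)"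
proof -
  have prem: "V \<noteq> {}" "\<And>v. v \<in> V \<Longrightarrow> q A v \<in> {0..1}" "\<And>v. v \<in> V \<Longrightarrow> \<pi> v > 0"
    using n_ge_2 q_range[OF assms(1)] degree_dist_pos by (auto simp: lessThan_empty_iff)
  note Hoeffding = Pi_bernoulli_Hoeffding[OF finite_lessThan prem sum_degree_dist_sq_le assms(2)]
  have sum: "(\<Sum>v\<in>V. \<pi> v * of_bool (b v)) = (\<Sum>v\<in>V \<inter> Collect b. \<pi> v)" for b
    by simp
  show "measure_pmf.prob (step A) {B. mass B \<ge> mean_mass A + t} \<le> exp (-2 * t\<^sup>2 * n / C1\<^sup>2)"
    using Hoeffding(1) unfolding sum
    by (simp add: voting_step_def vimage_def mass_Collect mean_mass_def)
  show "measure_pmf.prob (step A) {B. mass B \<le> mean_mass A - t} \<le> exp (-2 * t\<^sup>2 * n / C1\<^sup>2)"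
    using Hoeffding(2) unfolding sum
    by (simp add: voting_step_def vimage_def mass_Collect mean_mass_def)
qed

end

section \<open>Evolution of the bias\<close>

context expander_voting begin

abbreviation "y A \<equiv> \<bar>bias n E A\<bar>"
abbreviation "expect A \<equiv> measure_pmf.expectation (step A)"
abbreviation "prob A \<equiv> measure_pmf.prob (step A)"

text \<open>The Hoeffding bound for a deviation \<open>t\<close> of the mass, hence of
  \<open>2 * t\<close> of the signed bias.\<close>

definition tail :: "real \<Rightarrow> real" where
  "tail t = exp (-2 * t\<^sup>2 * n / C1\<^sup>2)"

lemma tail_antimono: "0 \<le> s \<Longrightarrow> s \<le> t \<Longrightarrow> tail t \<le> tail s"
  unfolding tail_def using C1_pos by (auto intro!: divide_right_mono mult_right_mono power_mono)

lemma tail_pos: "tail t > 0"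
  by (simp add: tail_def)

lemma step_subset: "B \<in> set_pmf (step A) \<Longrightarrow> B \<subseteq> V"
  using set_pmf_voting_step by blast

lemma step_prob_mono:
  assumes "\<And>B. B \<subseteq> V \<Longrightarrow> B \<in> S \<Longrightarrow> B \<in> T"
  shows "prob A S \<le> prob A T"
  using assms step_subset
  by (intro measure_pmf.finite_measure_mono_AE) (auto simp: AE_measure_pmf_iff)

text \<open>\<open>Z\<close> is the mass of whichever opinion is currently in the minority.\<close>

lemma minority_mass:
  assumes A: "A \<subseteq> V"
  obtains Z where
    "\<And>B. B \<subseteq> V \<Longrightarrow> (1 - y B) / 2 \<le> Z B"
    "expect A Z \<le> H ((1 - y A) / 2) + K * lam * (y A + lam) * ((1 - y A) / 2)"
    "\<And>t. t \<ge> 0 \<Longrightarrow> prob A {B. Z B \<ge> expect A Z + t} \<le> tail t"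
proof -
  have drift: "\<bar>mean_mass A - H (mass A)\<bar> \<le> K * lam * (y A + lam) * (mass A * (1 - mass A))"
    using mean_mass_drift[OF A] by (simp add: bias_eq[OF A])
  have c: "K * lam * (y A + lam) \<ge> 0" using K_ge lam_nonneg by simp
  have r: "mass A \<in> {0..1}" by (rule mass_range[OF A])
  \<comment> \<open>\<open>Z\<close> is fixed by the minority in \<open>A\<close>, hence affine in
    the mass with known expectation. After the round the other opinion may be in the minority, so
    \<open>Z B\<close> only bounds \<open>(1 - y B) / 2\<close> from above.\<close>
  show ?thesis
  proof (cases "mass A \<le> 1/2")
    case True
    then have a: "(1 - y A) / 2 = mass A" by (simp add: bias_eq[OF A])
    have "K * lam * (y A + lam) * (mass A * (1 - mass A)) \<le> K * lam * (y A + lam) * mass A"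
      using r c by (intro mult_left_mono) (auto simp: mult_left_le)
    then show ?thesis
      using drift mass_tail(1)[OF A]
      by (intro that[of mass]) (auto simp: a expectation_mass[OF A] bias_eq tail_def)
  next
    case False
    then have a: "(1 - y A) / 2 = 1 - mass A" by (simp add: bias_eq[OF A])
    have e: "expect A (\<lambda>B. 1 - mass B) = 1 - mean_mass A"
      by (simp add: expectation_mass[OF A])
    have "K * lam * (y A + lam) * (mass A * (1 - mass A)) \<le> K * lam * (y A + lam) * (1 - mass A)"
      using r c by (intro mult_left_mono) (auto simp: mult_left_le_one_le)
    then have "1 - mean_mass A \<le> H (1 - mass A) + K * lam * (y A + lam) * (1 - mass A)"
      using drift H_flip[of "mass A"] by linarith
    moreover have "{B. 1 - mass B \<ge> 1 - mean_mass A + t} = {B. mass B \<le> mean_mass A - t}" for t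
      by auto
    ultimately show ?thesis
      using mass_tail(2)[OF A]
      by (intro that[of "\<lambda>B. 1 - mass B"]) (auto simp only: a e tail_def, auto simp: bias_eq)
  qed
qed

text \<open>\<open>H\<close> contributes \<open>3 * K * y A\<close>; the drift error contributes
  \<open>K * y A\<close>, because \<open>lam <= 1\<close>, and \<open>K * lam^2\<close>.\<close>

lemma mean_bias_bound:
  assumes "A \<subseteq> V" "lam \<le> 1"
  shows "\<bar>2 * mean_mass A - 1\<bar> \<le> 4 * K * y A + K * lam\<^sup>2"
proof -
  have r: "mass A \<in> {0..1}" by (rule mass_range[OF assms(1)])
  have "mass A * (1 - mass A) = 1/4 - (mass A - 1/2)\<^sup>2" by (simp add: power2_eq_square algebra_simps)
  then have q: "mass A * (1 - mass A) \<le> 1/2" using zero_le_power2[of "mass A - 1/2"] by linarith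
  have c: "K * lam * (y A + lam) \<ge> 0" using K_ge lam_nonneg by simp
  have "\<bar>mean_mass A - H (mass A)\<bar> \<le> K * lam * (y A + lam) * (mass A * (1 - mass A))"
    using mean_mass_drift[OF assms(1)] by (simp add: bias_eq[OF assms(1)])
  also have "\<dots> \<le> K * lam * (y A + lam) * (1/2)" using q c by (intro mult_left_mono)
  finally have "\<bar>2 * mean_mass A - 2 * H (mass A)\<bar> \<le> K * lam * (y A + lam)" by (simp add: abs_if split: if_splits)
  also have "\<dots> = lam * (K * y A) + K * lam\<^sup>2" by (simp add: algebra_simps power2_eq_square)
  also have "\<dots> \<le> 1 * (K * y A) + K * lam\<^sup>2" using assms(2) K_ge by (intro add_mono mult_right_mono) auto
  finally have 1: "\<bar>2 * mean_mass A - 2 * H (mass A)\<bar> \<le> K * y A + K * lam\<^sup>2" by simp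
  have 2: "\<bar>2 * H (mass A) - 1\<bar> \<le> 3 * K * y A"
    using H_expansion_bound[OF r] by (simp add: bias_eq[OF assms(1)])
  have "\<bar>2 * mean_mass A - 1\<bar> \<le> \<bar>2 * mean_mass A - 2 * H (mass A)\<bar> + \<bar>2 * H (mass A) - 1\<bar>" by linarith
  then show ?thesis using 1 2 by linarith
qed

lemma bias_upper_tail:
  assumes A: "A \<subseteq> V" and lam: "lam \<le> 1" and t: "t \<ge> 0"
  shows "prob A {B. y B \<ge> 4 * K * y A + K * lam\<^sup>2 + 2 * t} \<le> 2 * tail t"
proof -
  let ?U = "{B. mass B \<ge> mean_mass A + t}" and ?L = "{B. mass B \<le> mean_mass A - t}"
  have "prob A {B. y B \<ge> 4 * K * y A + K * lam\<^sup>2 + 2 * t}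
      \<le> prob A (?U \<union> ?L)"
  proof (rule step_prob_mono)
    fix B assume B: "B \<subseteq> V" "B \<in> {B. y B \<ge> 4 * K * y A + K * lam\<^sup>2 + 2 * t}"
    have "\<bar>2 * mass B - 1\<bar> \<le> \<bar>2 * mean_mass A - 1\<bar> + 2 * \<bar>mass B - mean_mass A\<bar>" by (auto simp: abs_if)
    moreover have "4 * K * y A + K * lam\<^sup>2 + 2 * t \<le> \<bar>2 * mass B - 1\<bar>"
      using B by (simp add: bias_eq)
    ultimately have "t \<le> \<bar>mass B - mean_mass A\<bar>" using mean_bias_bound[OF A lam] by linarith
    then have "mass B \<ge> mean_mass A + t \<or> mass B \<le> mean_mass A - t" by linarith
    then show "B \<in> ?U \<union> ?L" by blast
  qed
  also have "\<dots> \<le> prob A ?U + prob A ?L"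
    by (intro measure_Un_le) auto
  also have "\<dots> \<le> tail t + tail t" unfolding tail_def by (intro add_mono mass_tail A t)
  finally show ?thesis by simp
qed

text \<open>Raising the update probabilities of the vertices with a balanced neighbourhood by \<open>D / \<surd>n\<close>
  shifts the mean mass by at least \<open>D / (2 \<surd>n)\<close>, while the second moment of the likelihood ratio
  stays bounded.\<close>

lemma bias_anticoncentration:
  assumes A: "A \<subseteq> V" and z: "0 < z" and e: "0 < e"
    and f_half: "\<And>x. \<bar>x - 1/2\<bar> \<le> z \<Longrightarrow> e \<le> f x \<and> f x \<le> 1 - e"
    and yA: "y A \<le> z" and lam1: "lam \<le> 1" and lamz: "lam\<^sup>2 \<le> z\<^sup>2 / 2"
    and D: "D > 0" "D / sqrt n \<le> e"
  shows "prob A {B. y B \<ge> (D - 2 * C1) / sqrt n - 4 * K * y A - K * lam\<^sup>2}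
    \<ge> exp (- D\<^sup>2 / e\<^sup>2) / 4"
proof -
  define a where "a = mass A"
  \<comment> \<open>By Chebyshev's inequality and \<open>neighbourhood_variance\<close> these
    vertices carry at least half of the mass. Their update probabilities lie in
    \<open>[e, 1 - e]\<close>, which leaves room for a tilt by \<open>d <= e\<close>.\<close>
  define S where "S = {v \<in> V. \<bar>nbr A v - a\<bar> \<le> z / 2}"
  define d where "d = D / sqrt n"
  have d: "d > 0" "d \<le> e" using D n_pos by (auto simp: d_def)
  define q' where "q' v = q A v + (if v \<in> S then d else 0)" for v
  have a: "a \<in> {0..1}" unfolding a_def by (rule mass_range[OF A])
  have ahalf: "\<bar>a - 1/2\<bar> \<le> z / 2"
    using yA unfolding bias_eq[OF A] a_def[symmetric] by linarith
  have qS: "e \<le> q A v \<and> q A v \<le> 1 - e" if "v \<in> S" for v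
  proof -
    have "\<bar>nbr A v - a\<bar> \<le> z / 2" "v < n" using that by (auto simp: S_def)
    then have "\<bar>nbr A v - 1/2\<bar> \<le> z" "\<bar>(1 - nbr A v) - 1/2\<bar> \<le> z" using ahalf by linarith+
    then show ?thesis using f_half[of "nbr A v"] f_half[of "1 - nbr A v"] q_eq[OF A \<open>v < n\<close>] by auto
  qed
  have q': "q' v \<in> {0..1}" if "v \<in> V" for v
    using q_range[OF A, of v] qS[of v] d that by (auto simp: q'_def)
  have bad: "(\<Sum>v\<in>V - S. \<pi> v) \<le> 1/2"
  proof -
    have "(\<Sum>v\<in>V - S. \<pi> v) * (z / 2)\<^sup>2 \<le> (\<Sum>v\<in>V - S. \<pi> v * (nbr A v - a)\<^sup>2)"
      unfolding sum_distrib_right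
    proof (intro sum_mono mult_left_mono)
      fix v assume v: "v \<in> V - S"
      then have "\<bar>z / 2\<bar> \<le> \<bar>nbr A v - a\<bar>" using z by (auto simp: S_def)
      then show "(z / 2)\<^sup>2 \<le> (nbr A v - a)\<^sup>2" by (simp only: abs_le_square_iff)
      show "0 \<le> \<pi> v" using degree_dist_pos v by (simp add: less_imp_le)
    qed
    also have "\<dots> \<le> (\<Sum>v\<in>V. \<pi> v * (nbr A v - a)\<^sup>2)"
      by (intro sum_mono2) (auto simp: degree_dist_pos less_imp_le)
    also have "\<dots> \<le> lam\<^sup>2 * (a * (1 - a))"
      unfolding a_def by (rule neighbourhood_variance[OF A])
    also have "\<dots> \<le> lam\<^sup>2 * (1 / 4)"
    proof (rule mult_left_mono)
      have "a * (1 - a) = 1/4 - (a - 1/2)\<^sup>2" by (simp add: power2_eq_square algebra_simps)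
      then show "a * (1 - a) \<le> 1/4" using zero_le_power2[of "a - 1/2"] by linarith
    qed simp
    also have "\<dots> \<le> 1/2 * (z / 2)\<^sup>2" using lamz by (simp add: power_divide)
    finally show ?thesis using z by (simp add: mult_le_cancel_right)
  qed
  have good: "(\<Sum>v\<in>S. \<pi> v) \<ge> 1/2"
  proof -
    have "(\<Sum>v\<in>V - S. \<pi> v) = 1 - (\<Sum>v\<in>S. \<pi> v)"
      by (subst sum_diff) (auto simp: S_def sum_degree_dist)
    then show ?thesis using bad by linarith
  qed
  define m' where "m' = (\<Sum>v\<in>V. \<pi> v * q' v)"
  have m': "m' \<ge> mean_mass A + d / 2"
  proof -
    have "m' = (\<Sum>v\<in>V. \<pi> v * q A v + (if v \<in> S then \<pi> v * d else 0))"
      unfolding m'_def q'_def by (intro sum.cong) (auto simp: algebra_simps)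
    also have "\<dots> = mean_mass A + (\<Sum>v\<in>S. \<pi> v * d)"
      by (simp add: sum.distrib mean_mass_def sum.If_cases Int_absorb1 Int_def S_def)
    also have "\<dots> = mean_mass A + (\<Sum>v\<in>S. \<pi> v) * d"
      by (simp add: sum_distrib_right)
    finally show ?thesis using mult_right_mono[OF good, of d] d by simp
  qed
  define M where "M p = Pi_pmf V False (\<lambda>v. bernoulli_pmf (p v))" for p
  \<comment> \<open>Under the tilted measure the sum falls one Hoeffding scale
    \<open>C1 / sqrt n\<close> below its mean with probability at most \<open>exp (-2)\<close>, so
    \<open>T\<close> has probability at least 1/2 there. The square in
    \<open>Pi_bernoulli_tilt\<close> yields the factor 1/4.\<close>
  define T where "T = {b. (\<Sum>v\<in>V. \<pi> v * of_bool (b v)) > m' - C1 / sqrt n}"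
  have "measure_pmf.prob (M q') (- T) \<le> 1/2"
  proof -
    have prem: "V \<noteq> {}" "\<And>v. v \<in> V \<Longrightarrow> \<pi> v > 0" "C1 / sqrt n \<ge> 0"
      using n_ge_2 degree_dist_pos C1_pos by (auto simp: lessThan_empty_iff)
    have "measure_pmf.prob (M q') (- T) \<le> exp (-2 * (C1 / sqrt n)\<^sup>2 / (C1\<^sup>2 / n))"
      using Pi_bernoulli_Hoeffding(2)[OF finite_lessThan prem(1) q' prem(2) sum_degree_dist_sq_le prem(3)]
      unfolding M_def T_def m'_def by (simp add: Collect_neg_eq[symmetric] not_less)
    also have "-2 * (C1 / sqrt n)\<^sup>2 / (C1\<^sup>2 / n) = (-2 :: real)"
      using C1_pos n_pos by (simp add: power_divide)
    also have "exp (-2 :: real) \<le> 1/2"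
      using exp_ge_add_one_self[of "2::real"] by (simp add: exp_minus field_simps)
    finally show ?thesis .
  qed
  then have "1/2 \<le> measure_pmf.prob (M q') T"
    using measure_pmf.prob_compl[of T "M q'"] by (simp add: Compl_eq_Diff_UNIV)
  then have "(1/2)\<^sup>2 \<le> (measure_pmf.prob (M q') T)\<^sup>2" by (intro power_mono) auto
  also have "\<dots> \<le> measure_pmf.prob (M (q A)) T * exp (real (card V) * d\<^sup>2 / e\<^sup>2)"
    unfolding M_def using q_range[OF A] q' qS d e
    by (intro Pi_bernoulli_tilt) (auto simp: q'_def)
  also have "real (card V) * d\<^sup>2 = D\<^sup>2" using n_pos by (simp add: d_def power_divide)
  finally have "exp (- D\<^sup>2 / e\<^sup>2) * (1/4) \<le> exp (- D\<^sup>2 / e\<^sup>2) * (measure_pmf.prob (M (q A)) T * exp (D\<^sup>2 / e\<^sup>2))"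
    by (intro mult_left_mono) (auto simp: power2_eq_square)
  also have "\<dots> = measure_pmf.prob (M (q A)) T" by (simp add: exp_minus)
  also have "\<dots> = prob A {B. mass B > m' - C1 / sqrt n}"
    by (simp add: voting_step_def M_def T_def vimage_def mass_Collect)
  also have "\<dots> \<le> prob A {B. y B \<ge> (D - 2 * C1) / sqrt n - 4 * K * y A - K * lam\<^sup>2}"
  proof (rule step_prob_mono)
    fix B assume B: "B \<subseteq> V" "B \<in> {B. mass B > m' - C1 / sqrt n}"
    have "2 * mass B - 1 > 2 * mean_mass A - 1 + d - 2 * (C1 / sqrt n)" using B(2) m' by simp
    also have "2 * mean_mass A - 1 + d - 2 * (C1 / sqrt n) = 2 * mean_mass A - 1 + (D - 2 * C1) / sqrt n"
      by (simp add: d_def diff_divide_distrib)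
    finally have "\<bar>2 * mass B - 1\<bar> \<ge> (D - 2 * C1) / sqrt n - \<bar>2 * mean_mass A - 1\<bar>" by linarith
    then show "B \<in> {B. y B \<ge> (D - 2 * C1) / sqrt n - 4 * K * y A - K * lam\<^sup>2}"
      using mean_bias_bound[OF A lam1] by (simp add: bias_eq[OF B(1)])
  qed
  finally show ?thesis by simp
qed

text \<open>With \<open>a\<close> the minority mass, \<open>H\<close> is quadratic at 0 and
  contributes \<open>6 * K * m * a\<close>; the drift error contributes \<open>2 * K * m * a\<close>
  because \<open>y A + lam <= 2\<close>.\<close>

lemma H_quadratic_mean:
  assumes A: "A \<subseteq> V" and H0: "deriv H 0 = 0" and "lam \<le> m" "(1 - y A) / 2 \<le> m" "lam \<le> 1"
  shows "H ((1 - y A) / 2) + K * lam * (y A + lam) * ((1 - y A) / 2) \<le> 8 * K * m * ((1 - y A) / 2)"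
proof -
  define a where "a = (1 - y A) / 2"
  have a: "a \<in> {0..1/2}" using abs_bias_le_1[OF A] by (auto simp: a_def)
  have "H a \<le> 6 * K * (a * a)" using H_quadratic[OF H0 a] by (simp add: power2_eq_square)
  also have "\<dots> \<le> 6 * K * (m * a)" using a assms(4) K_ge by (intro mult_left_mono mult_right_mono) (auto simp: a_def)
  finally have 1: "H a \<le> 6 * K * (m * a)" .
  have "K * lam * (y A + lam) * a \<le> K * m * 2 * a"
    using a K_ge lam_nonneg assms(3,5) abs_bias_le_1[OF A] by (intro mult_right_mono mult_mono) auto
  then show ?thesis using 1 unfolding a_def[symmetric] by (simp add: algebra_simps)
qed

text \<open>While the minority mass \<open>a\<close> is at least \<open>lam\<close>, its mean after
  a round is at most \<open>8 * K * a^2\<close>; one more \<open>a^2\<close> is the margin for the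
  fluctuation.\<close>

lemma minority_squares:
  assumes A: "A \<subseteq> V" and H0: "deriv H 0 = 0" and "lam \<le> (1 - y A) / 2" "lam \<le> 1"
  shows "prob A {B. (1 - y B) / 2 \<ge> (8 * K + 1) * ((1 - y A) / 2)\<^sup>2} \<le> tail (((1 - y A) / 2)\<^sup>2)"
proof -
  obtain Z where Z: "\<And>B. B \<subseteq> V \<Longrightarrow> (1 - y B) / 2 \<le> Z B"
    "expect A Z \<le> H ((1 - y A) / 2) + K * lam * (y A + lam) * ((1 - y A) / 2)"
    "\<And>t. t \<ge> 0 \<Longrightarrow> prob A {B. Z B \<ge> expect A Z + t} \<le> tail t"
    using minority_mass[OF A] by metis
  define a where "a = (1 - y A) / 2"
  have "expect A Z \<le> 8 * K * a\<^sup>2"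
    using order.trans[OF Z(2) H_quadratic_mean[OF A H0, of "(1 - y A) / 2"]] assms
    by (simp add: a_def power2_eq_square mult.assoc)
  then have "expect A Z + a\<^sup>2 \<le> (8 * K + 1) * a\<^sup>2" by (simp add: algebra_simps)
  then have "B \<in> {B. Z B \<ge> expect A Z + a\<^sup>2}"
    if "B \<subseteq> V" "B \<in> {B. (1 - y B) / 2 \<ge> (8 * K + 1) * a\<^sup>2}" for B
    using Z(1)[OF that(1)] that(2) unfolding mem_Collect_eq by linarith
  then have "prob A {B. (1 - y B) / 2 \<ge> (8 * K + 1) * a\<^sup>2}
      \<le> prob A {B. Z B \<ge> expect A Z + a\<^sup>2}"
    by (rule step_prob_mono)
  also have "\<dots> \<le> tail (a\<^sup>2)" by (rule Z(3)) simp
  finally show ?thesis unfolding a_def .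
qed

text \<open>The threshold \<open>m\<close> dominates both \<open>lam\<close> and the minority. With
  \<open>16 * K * m <= 1\<close> the mean minority is at most \<open>m / 2\<close>, and the other
  half of \<open>m\<close> is the fluctuation margin, so the threshold is rarely exceeded.\<close>

lemma minority_shrinks:
  assumes A: "A \<subseteq> V" and H0: "deriv H 0 = 0" and m: "lam \<le> m" "(1 - y A) / 2 \<le> m" "16 * K * m \<le> 1"
  shows "expect A (\<lambda>B. 1 - y B) \<le> 8 * K * m * (1 - y A)"
    and "prob A {B. (1 - y B) / 2 > m} \<le> tail (m / 2)"
proof -
  obtain Z where Z: "\<And>B. B \<subseteq> V \<Longrightarrow> (1 - y B) / 2 \<le> Z B"
    "expect A Z \<le> H ((1 - y A) / 2) + K * lam * (y A + lam) * ((1 - y A) / 2)"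
    "\<And>t. t \<ge> 0 \<Longrightarrow> prob A {B. Z B \<ge> expect A Z + t} \<le> tail t"
    using minority_mass[OF A] by metis
  define a where "a = (1 - y A) / 2"
  have m0: "m \<ge> 0" using m lam_nonneg by linarith
  have "m \<le> K * m" using m0 K_ge by (simp add: mult_le_cancel_right1)
  then have "lam \<le> 1" using m lam_nonneg by linarith
  then have EZ: "expect A Z \<le> 8 * K * m * a"
    using order.trans[OF Z(2) H_quadratic_mean[OF A H0 m(1,2)]] by (simp add: a_def)
  have "expect A (\<lambda>B. 1 - y B) \<le> expect A (\<lambda>B. 2 * Z B)"
    using Z(1) step_subset by (intro voting_step.expectation_mono) (force simp: field_simps)
  also have "\<dots> \<le> 8 * K * m * (1 - y A)" using EZ by (simp add: a_def)
  finally show "expect A (\<lambda>B. 1 - y B) \<le> 8 * K * m * (1 - y A)" .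
  have "8 * K * m * a \<le> (1/2) * m" using m m0 abs_bias_le_1[OF A] by (intro mult_mono) (auto simp: a_def)
  then have "expect A Z + m / 2 \<le> m" using EZ by linarith
  then have "B \<in> {B. Z B \<ge> expect A Z + m / 2}"
    if "B \<subseteq> V" "B \<in> {B. (1 - y B) / 2 > m}" for B
    using Z(1)[OF that(1)] that(2) unfolding mem_Collect_eq by linarith
  then have "prob A {B. (1 - y B) / 2 > m}
      \<le> prob A {B. Z B \<ge> expect A Z + m / 2}"
    by (rule step_prob_mono)
  also have "\<dots> \<le> tail (m / 2)" using m0 by (intro Z(3)) simp
  finally show "prob A {B. (1 - y B) / 2 > m} \<le> tail (m / 2)" .
qed

end

section \<open>Growth of the bias and the contracting potential\<close>

locale expander_voting_gap = expander_voting +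
  fixes g :: real
  assumes g: "0 < g" "g \<le> 1/2"
    and H_gap: "\<And>a. a \<in> {0..1/2} \<Longrightarrow> H a \<le> a - 2 * g * a * (1 - 2 * a)"
    and K_lam: "K * lam \<le> g / 2"
begin

text \<open>Half of the gap \<open>2 * g\<close> pays for the drift error:
  \<open>K * lam <= g / 2\<close> handles the part proportional to the bias, and
  \<open>small\<close> the part of order \<open>lam^2\<close>. This is where the bias has to exceed
  a multiple of \<open>lam^2\<close>.\<close>

lemma minority_mass_contracts:
  assumes A: "A \<subseteq> V" and small: "K * lam\<^sup>2 \<le> g / 2 * y A"
  obtains Z where
    "\<And>B. B \<subseteq> V \<Longrightarrow> (1 - y B) / 2 \<le> Z B"
    "expect A Z \<le> (1 - y A) / 2 * (1 - g * y A)"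
    "\<And>t. t \<ge> 0 \<Longrightarrow> prob A {B. Z B \<ge> expect A Z + t} \<le> tail t"
proof -
  define a where "a = (1 - y A) / 2"
  have a: "a \<in> {0..1/2}" using abs_bias_le_1[OF A] by (auto simp: a_def)
  have ya: "1 - 2 * a = y A" by (simp add: a_def field_simps)
  have "K * lam * (y A + lam) = (K * lam) * y A + K * lam\<^sup>2" by (simp add: power2_eq_square algebra_simps)
  also have "\<dots> \<le> g / 2 * y A + g / 2 * y A" using K_lam small by (intro add_mono mult_right_mono) auto
  finally have "K * lam * (y A + lam) * a \<le> g * y A * a" using a by (intro mult_right_mono) auto
  then have le: "H a + K * lam * (y A + lam) * a \<le> a * (1 - g * y A)"
    using H_gap[OF a] unfolding ya by (simp add: algebra_simps)
  obtain Z where Z: "\<And>B. B \<subseteq> V \<Longrightarrow> (1 - y B) / 2 \<le> Z B"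
    "expect A Z \<le> H a + K * lam * (y A + lam) * a"
    "\<And>t. t \<ge> 0 \<Longrightarrow> prob A {B. Z B \<ge> expect A Z + t} \<le> tail t"
    using minority_mass[OF A] unfolding a_def by metis
  show ?thesis by (rule that[OF Z(1) order.trans[OF Z(2) le, unfolded a_def] Z(3)])
qed

lemma bias_growth:
  assumes A: "A \<subseteq> V" and small: "K * lam\<^sup>2 \<le> g / 2 * y A" and t: "t \<ge> 0"
  shows "prob A {B. y B \<le> y A + g * (1 - y A) * y A - 2 * t} \<le> tail t"
proof -
  obtain Z where Z: "\<And>B. B \<subseteq> V \<Longrightarrow> (1 - y B) / 2 \<le> Z B"
    "expect A Z \<le> (1 - y A) / 2 * (1 - g * y A)"
    "\<And>t. t \<ge> 0 \<Longrightarrow> prob A {B. Z B \<ge> expect A Z + t} \<le> tail t"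
    using minority_mass_contracts[OF A small] by metis
  have "prob A {B. y B \<le> y A + g * (1 - y A) * y A - 2 * t}
      \<le> prob A {B. Z B \<ge> expect A Z + t}"
  proof (rule step_prob_mono)
    fix B assume B: "B \<subseteq> V" "B \<in> {B. y B \<le> y A + g * (1 - y A) * y A - 2 * t}"
    have "2 * ((1 - y A) / 2 * (1 - g * y A)) = 1 - y A - g * (1 - y A) * y A" by (simp add: field_simps)
    then show "B \<in> {B. Z B \<ge> expect A Z + t}"
      using Z(1)[OF B(1)] Z(2) B(2) by simp
  qed
  also have "\<dots> \<le> tail t" by (rule Z(3)[OF t])
  finally show ?thesis .
qed

text \<open>A minority of mass at least \<open>al\<close> makes the drift at least
  \<open>2 * g * al * y A\<close>; half of it is given up as fluctuation margin.\<close>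

lemma bias_growth_minority:
  assumes A: "A \<subseteq> V" and small: "K * lam\<^sup>2 \<le> g / 2 * y A" and al: "0 \<le> al" "al \<le> (1 - y A) / 2"
  shows "prob A {B. y B \<le> y A * (1 + g * al)} \<le> tail (g * al * y A / 2)"
proof -
  have "al * (g * y A) \<le> (1 - y A) / 2 * (g * y A)" using al g by (intro mult_right_mono) auto
  then have "y A * (1 + g * al) \<le> y A + g * (1 - y A) * y A - 2 * (g * al * y A / 2)"
    by (simp add: field_simps)
  then have "prob A {B. y B \<le> y A * (1 + g * al)}
      \<le> prob A {B. y B \<le> y A + g * (1 - y A) * y A - 2 * (g * al * y A / 2)}"
    by (intro step_prob_mono) auto
  also have "\<dots> \<le> tail (g * al * y A / 2)" using al g by (intro bias_growth A small) simp
  finally show ?thesis .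
qed

text \<open>Below 1/2 the bias grows by a definite factor. Above 1/2 the growth may be negligible
  near consensus, but either it or the distance to \<open>L <= 1/2\<close> leaves a constant
  margin.\<close>

lemma bias_exit:
  assumes A: "A \<subseteq> V" and small: "K * lam\<^sup>2 \<le> g / 2 * y A" and L: "0 \<le> L" "L \<le> y A" "L \<le> 1/2"
  shows "prob A {B. y B < L} \<le> tail (g * L / 8)"
proof (cases "y A < 1/2")
  case True
  have "prob A {B. y B < L} \<le> prob A {B. y B \<le> y A * (1 + g * (1/4))}"
  proof (rule step_prob_mono)
    fix B assume "B \<in> {B. y B < L}"
    moreover have "y A * 1 \<le> y A * (1 + g * (1/4))" using g by (intro mult_left_mono) auto
    ultimately show "B \<in> {B. y B \<le> y A * (1 + g * (1/4))}" using L by auto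
  qed
  also have "\<dots> \<le> tail (g * (1/4) * y A / 2)" using True by (intro bias_growth_minority A small) auto
  also have "\<dots> \<le> tail (g * L / 8)" using L g by (intro tail_antimono) (auto intro: mult_left_mono)
  finally show ?thesis .
next
  case False
  have "L \<le> y A + g * (1 - y A) * y A - 2 * (g / 16)"
  proof (cases "y A \<le> 3/4")
    case True
    have "1/4 * (1/2) \<le> (1 - y A) * y A" using True False by (intro mult_mono) auto
    then have "g * (1/8) \<le> g * ((1 - y A) * y A)" using g by (intro mult_left_mono) auto
    then show ?thesis using L by (simp add: mult.assoc)
  next
    case False
    have "0 \<le> g * (1 - y A) * y A" using g abs_bias_le_1[OF A] by auto
    then show ?thesis using False L g by linarith
  qed
  then have "prob A {B. y B < L}
      \<le> prob A {B. y B \<le> y A + g * (1 - y A) * y A - 2 * (g / 16)}"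
    by (intro step_prob_mono) auto
  also have "\<dots> \<le> tail (g / 16)" using g by (intro bias_growth A small) simp
  also have "\<dots> \<le> tail (g * L / 8)" using L g by (intro tail_antimono) auto
  finally show ?thesis .
qed

text \<open>The numerator measures the distance to consensus, the denominator the distance from
  balance. The floor \<open>L\<close> caps the value at \<open>1 / L\<close> for nearly balanced
  sets.\<close>

definition potential :: "real \<Rightarrow> nat set \<Rightarrow> real" where
  "potential L A = (1 - y A) / max (y A) L"

lemma potential_le:
  assumes "A \<subseteq> V" "L > 0" shows "potential L A \<le> 1 / L"
proof -
  have "1 - y A \<le> 1" "L \<le> max (y A) L" by simp_all
  then show ?thesis unfolding potential_def using assms(2) by (intro frac_le) simp_all
qed

lemma potential_nonneg:
  assumes "A \<subseteq> V" "L > 0" shows "potential L A \<ge> 0"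
proof -
  have "0 \<le> 1 - y A" using abs_bias_le_1[OF assms(1)] by simp
  moreover have "0 < max (y A) L" using assms(2) by simp
  ultimately show ?thesis unfolding potential_def by (rule divide_nonneg_pos)
qed

text \<open>The numerator shrinks by \<open>1 - g / 2\<close> on average, and outside
  \<open>F\<close> the denominator drops by at most \<open>g / 8\<close>. On \<open>F\<close> the
  potential is at most \<open>1 / L <= n\<close>; this is compared with
  \<open>1 - y A >= 2 / n^2\<close>, whence the cube of \<open>n\<close> in the last
  assumption.\<close>

lemma potential_contracts_far:
  assumes A: "A \<in> dissent n" and small: "K * lam\<^sup>2 \<le> g / 2 * y A" and half: "y A \<ge> 1/2"
    and L: "1 / n \<le> L" "L \<le> y A" and N: "tail (g / 16) * real n ^ 3 \<le> g / 4"
  shows "expect A (potential L) \<le> (1 - g / 8) * potential L A"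
proof -
  have AV: "A \<subseteq> V" using A by auto
  obtain Z where Z: "\<And>B. B \<subseteq> V \<Longrightarrow> (1 - y B) / 2 \<le> Z B"
    "expect A Z \<le> (1 - y A) / 2 * (1 - g * y A)"
    "\<And>t. t \<ge> 0 \<Longrightarrow> prob A {B. Z B \<ge> expect A Z + t} \<le> tail t"
    using minority_mass_contracts[OF AV small] by metis
  define F where "F = {B. Z B \<ge> expect A Z + g / 16}"
  define w where "w = y A - g / 8"
  have "0 < 1 / real n" using n_pos by simp
  then have L0: "L > 0" using L(1) by linarith
  have y1: "y A \<le> 1" by (rule abs_bias_le_1[OF AV])
  have w: "w > 0" using half g by (simp add: w_def)
  have "expect A (potential L)
      \<le> expect A (\<lambda>B. (2 / w) * Z B + indicator F B * (1 / L))"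
  proof (rule voting_step.expectation_mono)
    fix B assume "B \<in> set_pmf (step A)"
    then have B: "B \<subseteq> V" by (rule step_subset)
    have "0 \<le> (1 - y B) / 2" using abs_bias_le_1[OF B] by simp
    then have Z0: "Z B \<ge> 0" using Z(1)[OF B] by (rule order.trans)
    show "potential L B \<le> (2 / w) * Z B + indicator F B * (1 / L)"
    proof (cases "B \<in> F")
      case True
      then show ?thesis using potential_le[OF B L0] Z0 w by (simp add: add_increasing)
    next
      case False
      have "2 * ((1 - y A) / 2 * (1 - g * y A)) = 1 - y A - g * (1 - y A) * y A" by (simp add: field_simps)
      moreover have "g * (1 - y A) * y A \<ge> 0" using g y1 by auto
      ultimately have "2 * Z B < 1 - w"
        using False Z(2) unfolding F_def w_def by simp
      then have "w \<le> max (y B) L" using Z(1)[OF B] by simp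
      then have "(1 - y B) / max (y B) L \<le> (2 * Z B) / w"
        using Z(1)[OF B] w Z0 by (intro frac_le) auto
      then show ?thesis using False by (simp add: potential_def)
    qed
  qed
  also have "\<dots> = (2 / w) * expect A Z + prob A F * (1 / L)"
    by simp
  also have "\<dots> \<le> (1 - g / 4) * ((1 - y A) / y A) + g / 8 * ((1 - y A) / y A)"
  proof (rule add_mono)
    have "g * (1/2) \<le> g * y A" using half g by (intro mult_left_mono) auto
    then have "(1 - y A) / 2 * (1 - g * y A) \<le> (1 - y A) / 2 * (1 - g / 2)"
      using y1 by (intro mult_left_mono) auto
    then have "(2 / w) * expect A Z \<le> (2 / w) * ((1 - y A) / 2 * (1 - g / 2))"
      using Z(2) w by (intro mult_left_mono) auto
    also have "\<dots> = (1 - y A) * ((1 - g / 2) / w)" by simp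
    also have "\<dots> \<le> (1 - y A) * ((1 - g / 4) / y A)"
    proof (rule mult_left_mono)
      have "g * (1/2) \<le> g * y A" using half g by (intro mult_left_mono) auto
      then have "0 \<le> g * y A / 4 - g / 8 + g * g / 32" using zero_le_square[of g] by simp
      also have "\<dots> = (1 - g / 4) * w - (1 - g / 2) * y A" by (simp add: w_def algebra_simps)
      finally have "(1 - g / 2) * y A \<le> (1 - g / 4) * w" by simp
      then show "(1 - g / 2) / w \<le> (1 - g / 4) / y A" using w half by (simp add: divide_simps)
    qed (use y1 in simp)
    finally show "(2 / w) * expect A Z \<le> (1 - g / 4) * ((1 - y A) / y A)"
      by (simp add: mult.commute)
    have "prob A F * (1 / L) \<le> tail (g / 16) * n"
    proof (rule mult_mono)
      show "prob A F \<le> tail (g / 16)" unfolding F_def using g by (intro Z(3)) simp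
      show "1 / L \<le> n" using L(1) L0 n_pos by (simp add: field_simps)
    qed (use L0 tail_pos less_imp_le in auto)
    also have "\<dots> \<le> g / 8 * (2 / (real n)\<^sup>2)"
      using N n_pos by (simp add: field_simps power2_eq_square power3_eq_cube)
    also have "\<dots> \<le> g / 8 * (1 - y A)"
      using one_minus_abs_bias_ge[OF A] g by (intro mult_left_mono) auto
    also have "\<dots> \<le> g / 8 * ((1 - y A) / y A)"
    proof -
      have "1 - y A \<le> (1 - y A) / y A" using half y1 by (simp add: le_divide_eq mult_left_le)
      then show ?thesis using g by (intro mult_left_mono) auto
    qed
    finally show "prob A F * (1 / L) \<le> g / 8 * ((1 - y A) / y A)" .
  qed
  also have "\<dots> = (1 - g / 8) * potential L A"
    unfolding distrib_right[symmetric] using L(2) by (simp add: potential_def max_absorb1)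
  finally show ?thesis .
qed

text \<open>Outside \<open>F\<close> the bias grows by the factor \<open>1 + g / 4\<close> and the
  numerator does not increase. For \<open>y A\<close> of order \<open>1 / sqrt n\<close> the bound
  on the probability of \<open>F\<close> is only a constant; it is charged to the expectation, and a
  large \<open>h\<close> makes the charge small.\<close>

lemma potential_contracts_near:
  assumes A: "A \<subseteq> V" and small: "K * lam\<^sup>2 \<le> g / 2 * y A" and half: "y A \<le> 1/2"
    and L: "h / sqrt n \<le> L" "L \<le> y A" and h: "96 * C1 / g\<^sup>2 \<le> h"
  shows "expect A (potential L) \<le> (1 - g / 16) * potential L A"
proof -
  define F where "F = {B. y B \<le> y A * (1 + g * (1/4))}"
  have "0 < 96 * C1 / g\<^sup>2" using g C1_pos by simp
  then have "h > 0" using h by linarith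
  then have "0 < h / sqrt n" using n_pos by simp
  then have L0: "L > 0" using L(1) by linarith
  have y0: "y A > 0" using L L0 by linarith
  have "expect A (potential L)
      \<le> expect A (\<lambda>B. (1 - y A) / (y A * (1 + g * (1/4))) + indicator F B * (1 / L))"
  proof (rule voting_step.expectation_mono)
    fix B assume "B \<in> set_pmf (step A)"
    then have B: "B \<subseteq> V" by (rule step_subset)
    have pos: "0 < y A * (1 + g * (1/4))" "y A * 1 \<le> y A * (1 + g * (1/4))"
      using y0 g by (auto intro!: mult_pos_pos add_pos_pos)
    show "potential L B \<le> (1 - y A) / (y A * (1 + g * (1/4))) + indicator F B * (1 / L)"
    proof (cases "B \<in> F")
      case True
      have "0 \<le> (1 - y A) / (y A * (1 + g * (1/4)))" using pos half by auto
      then show ?thesis using potential_le[OF B L0] True by simp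
    next
      case False
      then have "y B > y A * (1 + g * (1/4))" by (simp add: F_def)
      then have "(1 - y B) / max (y B) L \<le> (1 - y A) / (y A * (1 + g * (1/4)))"
        using pos half by (intro frac_le) auto
      then show ?thesis using False by (simp add: potential_def)
    qed
  qed
  also have "\<dots> = (1 - y A) / (y A * (1 + g * (1/4))) + prob A F * (1 / L)"
    by simp
  also have "\<dots> \<le> (1 - g / 8) * ((1 - y A) / y A) + g / 16 * ((1 - y A) / y A)"
  proof (rule add_mono)
    have "1 \<le> (1 - g / 8) * (1 + g * (1/4))"
    proof -
      have "g * g \<le> 1 * g" using g by (intro mult_right_mono) auto
      then show ?thesis using g by (simp add: algebra_simps)
    qed
    then have "1 / (1 + g * (1/4)) \<le> 1 - g / 8" using g by (simp add: divide_le_eq)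
    then have "(1 - y A) / y A * (1 / (1 + g * (1/4))) \<le> (1 - y A) / y A * (1 - g / 8)"
      using y0 half by (intro mult_left_mono) auto
    then show "(1 - y A) / (y A * (1 + g * (1/4))) \<le> (1 - g / 8) * ((1 - y A) / y A)"
      by (simp add: mult.commute)
    \<comment> \<open>Up to enlarging 32 to 36, \<open>w\<close> is the square root of the Hoeffding
      exponent. The weak bound \<open>exp (- w^2) <= 1 / (2 * w)\<close> suffices: it supplies the
      factor \<open>1 / y A\<close> of the potential, and \<open>1 / L\<close> is absorbed by
      \<open>L * sqrt n >= h\<close>.\<close>
    define w where "w = g * y A * sqrt n / (6 * C1)"
    have w0: "w > 0" using g y0 n_pos C1_pos by (simp add: w_def)
    have w2: "w\<^sup>2 \<le> 2 * (g * (1/4) * y A / 2)\<^sup>2 * n / C1\<^sup>2"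
    proof -
      have "w\<^sup>2 = (g * y A)\<^sup>2 * n / C1\<^sup>2 * (1/36)"
        using n_pos by (simp add: w_def power_mult_distrib power_divide)
      also have "\<dots> \<le> (g * y A)\<^sup>2 * n / C1\<^sup>2 * (1/32)" by (intro mult_left_mono) auto
      also have "\<dots> = 2 * (g * (1/4) * y A / 2)\<^sup>2 * n / C1\<^sup>2"
        by (simp add: power_mult_distrib power_divide)
      finally show ?thesis .
    qed
    have "prob A F \<le> tail (g * (1/4) * y A / 2)"
      unfolding F_def using half by (intro bias_growth_minority A small) auto
    also have "\<dots> \<le> exp (- (w\<^sup>2))" using w2 by (simp add: tail_def)
    also have "\<dots> \<le> 1 / (1 + w\<^sup>2)"
      using exp_ge_add_one_self[of "w\<^sup>2"] by (simp add: exp_minus divide_simps add_pos_nonneg)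
    also have "\<dots> \<le> 1 / (2 * w)"
    proof (intro frac_le)
      have "(1 - w)\<^sup>2 \<ge> 0" by simp
      then show "2 * w \<le> 1 + w\<^sup>2" by (simp add: power2_eq_square algebra_simps)
    qed (use w0 in auto)
    also have "\<dots> = 3 * C1 / (g * sqrt n) * (1 / y A)"
      using g C1_pos y0 n_pos by (simp add: w_def field_simps)
    finally have "prob A F * (1 / L) \<le> 3 * C1 / (g * sqrt n) * (1 / y A) * (1 / L)"
      using L0 by (intro mult_right_mono) auto
    also have "\<dots> \<le> g / 32 * (1 / y A)"
    proof -
      have "96 * C1 \<le> h * g\<^sup>2" using h g by (simp add: divide_le_eq)
      also have "\<dots> \<le> (L * sqrt n) * g\<^sup>2"
        using L(1) n_pos by (intro mult_right_mono) (auto simp: divide_le_eq)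
      finally have "3 * C1 / (g * sqrt n) * (1 / L) \<le> g / 32"
        using g n_pos L0 by (simp add: field_simps power2_eq_square)
      then have "3 * C1 / (g * sqrt n) * (1 / L) * (1 / y A) \<le> g / 32 * (1 / y A)"
        using y0 by (intro mult_right_mono) auto
      then show ?thesis by (simp add: mult_ac)
    qed
    also have "\<dots> = g / 16 * ((1/2) / y A)" by simp
    also have "\<dots> \<le> g / 16 * ((1 - y A) / y A)"
      using half y0 g by (intro mult_left_mono divide_right_mono) auto
    finally show "prob A F * (1 / L) \<le> g / 16 * ((1 - y A) / y A)" .
  qed
  also have "\<dots> = (1 - g / 16) * potential L A"
    unfolding distrib_right[symmetric] using L(2) by (simp add: potential_def max_absorb1)
  finally show ?thesis .
qed

end

section \<open>Survival bounds\<close>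

context expander_voting begin

text \<open>Vertices are added one by one until the mass first reaches 1/2; the overshoot is at most
  the mass of one vertex.\<close>

lemma exists_balanced_set: "\<exists>A\<subseteq>V. y A \<le> 2 * C1 / n"
proof -
  define P where "P j \<longleftrightarrow> mass {..<j} \<ge> 1/2" for j :: nat
  have "P n" by (simp add: P_def mass_def sum_degree_dist)
  define j where "j = (LEAST j. P j)"
  have Pj: "P j" and jn: "j \<le> n" unfolding j_def using \<open>P n\<close> by (auto intro: LeastI Least_le)
  have "j \<noteq> 0"
  proof
    assume "j = 0"
    then have "mass {..<j} = 0" by (simp add: mass_def)
    then show False using Pj by (simp add: P_def)
  qed
  then obtain i where i: "j = Suc i" by (cases j) auto
  have "\<not> P i" using not_less_Least[of i P] i unfolding j_def by simp
  then have "mass {..<i} < 1/2" by (simp add: P_def)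
  moreover have "mass {..<j} = mass {..<i} + \<pi> i" by (simp add: mass_def i)
  moreover have "\<pi> i \<le> C1 / n" using degree_dist_le[OF max_deg] i jn by simp
  moreover have "mass {..<j} \<ge> 1/2" using Pj by (simp add: P_def)
  ultimately have "\<bar>2 * mass {..<j} - 1\<bar> \<le> 2 * (C1 / n)" by simp
  then show ?thesis using jn by (intro exI[of _ "{..<j}"]) (auto simp: bias_eq)
qed

lemma dissentI: assumes "A \<subseteq> V" "y A < 1" shows "A \<in> dissent n"
proof -
  have "A \<noteq> {}" "A \<noteq> V" using assms by (auto simp: bias_eq mass_def sum_degree_dist)
  then show ?thesis using assms(1) by auto
qed

text \<open>In one round the bound \<open>w\<close> on the bias grows to \<open>5 * K * w\<close>: a
  factor \<open>4 * K\<close> comes from \<open>bias_upper_tail\<close>, and the remaining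
  \<open>K * w >= w0\<close> covers the \<open>lam^2\<close> term and the fluctuation, at most
  \<open>w0 / 2\<close> each. The noise scale \<open>w0\<close> stays fixed while \<open>w\<close>
  varies in the induction.\<close>

lemma surv_lower_bound:
  assumes small: "K * lam\<^sup>2 \<le> w0 / 2" and lam1: "lam \<le> 1" and w0: "0 < w0" "w0 \<le> w"
    and A: "A \<subseteq> V" "y A \<le> w" and t: "(5 * K) ^ t * w < 1"
  shows "surv step (dissent n) t A \<ge> 1 - real t * (2 * tail (w0 / 4))"
  using w0(2) A t
proof (induction t arbitrary: A w)
  case 0
  then show ?case using dissentI[of A] by simp
next
  case (Suc t)
  have K1: "1 \<le> 5 * K" using K_ge by simp
  have "1 * w \<le> (5 * K) ^ Suc t * w"
    using Suc.prems(1) w0(1) one_le_power[OF K1, of "Suc t"] by (intro mult_right_mono) auto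
  then have w1: "w < 1" using Suc.prems(4) by linarith
  have w': "w0 \<le> 5 * K * w"
  proof -
    have "1 * w \<le> 5 * K * w" using K1 Suc.prems(1) w0(1) by (intro mult_right_mono) auto
    then show ?thesis using Suc.prems(1) by linarith
  qed
  have IH: "1 - real t * (2 * tail (w0 / 4)) \<le> surv step (dissent n) t B"
    if B: "B \<in> {B. B \<subseteq> V \<and> y B \<le> 5 * K * w}" for B
  proof (rule Suc.IH[OF w'])
    show "(5 * K) ^ t * (5 * K * w) < 1" using Suc.prems(4) by (simp add: mult_ac)
  qed (use B in auto)
  have "prob A (- {B. B \<subseteq> V \<and> y B \<le> 5 * K * w})
      \<le> prob A {B. y B \<ge> 4 * K * y A + K * lam\<^sup>2 + 2 * (w0 / 4)}"
  proof (rule step_prob_mono)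
    fix B assume B: "B \<subseteq> V" "B \<in> - {B. B \<subseteq> V \<and> y B \<le> 5 * K * w}"
    have 1: "K * y A \<le> K * w" using Suc.prems(3) K_ge by (intro mult_left_mono) auto
    have 2: "1 * w \<le> K * w" using K_ge Suc.prems(1) w0(1) by (intro mult_right_mono) auto
    have 3: "5 * (K * w) < y B" using B by (simp add: mult.assoc)
    have "4 * (K * y A) + K * lam\<^sup>2 + 2 * (w0 / 4) \<le> y B"
      using 1 2 3 small Suc.prems(1) by argo
    then show "B \<in> {B. y B \<ge> 4 * K * y A + K * lam\<^sup>2 + 2 * (w0 / 4)}" by (simp add: mult.assoc)
  qed
  also have "\<dots> \<le> 2 * tail (w0 / 4)" using Suc.prems(2) lam1 w0(1) by (intro bias_upper_tail) auto
  finally have p: "prob A (- {B. B \<subseteq> V \<and> y B \<le> 5 * K * w}) \<le> 2 * tail (w0 / 4)" .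
  have "1 - real t * (2 * tail (w0 / 4)) - 2 * tail (w0 / 4) \<le> surv step (dissent n) (Suc t) A"
  proof (rule voting_step.surv_Suc_lower[OF IH p])
    show "1 - real t * (2 * tail (w0 / 4)) \<le> 1" using tail_pos by (simp add: less_imp_le)
    show "A \<in> dissent n" using Suc.prems(2,3) w1 by (intro dissentI) auto
  qed
  then show ?case by (simp add: algebra_simps)
qed

text \<open>Scaled by \<open>n^2\<close>, the quantity \<open>1 - y\<close> is at least 1 on every
  dissenting set and contracts by \<open>8 * K * m\<close> in expectation.\<close>

lemma surv_small_minority:
  assumes H0: "deriv H 0 = 0" and m: "lam \<le> m" "16 * K * m \<le> 1" and A: "A \<subseteq> V" "(1 - y A) / 2 \<le> m"
  shows "surv step (dissent n) t A \<le> (8 * K * m) ^ t * (real n)\<^sup>2 + real t * tail (m / 2)"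
proof -
  define G where "G = {B. B \<subseteq> V \<and> (1 - y B) / 2 \<le> m}"
  define \<phi> where "\<phi> B = (real n)\<^sup>2 * (1 - y B)" for B
  have m0: "m \<ge> 0" using m(1) lam_nonneg by linarith
  have ph: "\<phi> B \<ge> 0" if "B \<subseteq> V" for B using abs_bias_le_1[OF that] by (simp add: \<phi>_def)
  have r0: "8 * K * m \<ge> 0" using m0 K_ge by simp
  have "surv step (dissent n) t A \<le> (8 * K * m) ^ t * \<phi> A + real t * tail (m / 2)"
  proof (rule voting_step.surv_lyapunov[where G = G])
    fix B assume B: "B \<in> G" "B \<in> dissent n"
    then have BV: "B \<subseteq> V" "(1 - y B) / 2 \<le> m" by (auto simp: G_def)
    have "expect B (\<lambda>C. if C \<in> G then \<phi> C else 0) \<le> expect B \<phi>"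
      using ph step_subset by (intro voting_step.expectation_mono) auto
    also have "\<dots> = (real n)\<^sup>2 * expect B (\<lambda>C. 1 - y C)" by (simp add: \<phi>_def[abs_def])
    also have "\<dots> \<le> (real n)\<^sup>2 * (8 * K * m * (1 - y B))"
      by (intro mult_left_mono minority_shrinks(1)[OF BV(1) H0 m(1) BV(2) m(2)]) simp
    finally show "expect B (\<lambda>C. if C \<in> G then \<phi> C else 0) \<le> 8 * K * m * \<phi> B"
      by (simp add: \<phi>_def mult_ac)
    have "prob B (- G) \<le> prob B {C. (1 - y C) / 2 > m}"
      by (rule step_prob_mono) (auto simp: G_def)
    also have "\<dots> \<le> tail (m / 2)" by (rule minority_shrinks(2)[OF BV(1) H0 m(1) BV(2) m(2)])
    finally show "prob B (- G) \<le> tail (m / 2)" .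
    have "(real n)\<^sup>2 * (2 / (real n)\<^sup>2) \<le> \<phi> B"
      unfolding \<phi>_def using one_minus_abs_bias_ge[OF B(2)] by (intro mult_left_mono) auto
    then show "1 \<le> \<phi> B" using n_pos by simp
  next
    fix B assume "B \<in> G" then show "0 \<le> \<phi> B" using ph by (simp add: G_def)
  qed (use r0 tail_pos A in \<open>auto simp: G_def less_imp_le\<close>)
  also have "(8 * K * m) ^ t * \<phi> A \<le> (8 * K * m) ^ t * (real n)\<^sup>2"
    unfolding \<phi>_def using r0 by (intro mult_left_mono mult_left_le) auto
  finally show ?thesis by simp
qed

text \<open>In the scaling \<open>x = (8 * K + 1) * a\<close> a good round maps \<open>x\<close> to
  at most \<open>x^2\<close>, so \<open>x ^ (2 ^ k)\<close> does not grow while \<open>k\<close>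
  counts down. Reaching \<open>m\<close> early is covered by \<open>surv_antimono\<close>.\<close>

lemma surv_squaring_phase:
  assumes H0: "deriv H 0 = 0" and lam1: "lam \<le> 1" and m: "lam \<le> m" "0 < m"
    and q: "\<And>A. A \<subseteq> V \<Longrightarrow> (1 - y A) / 2 \<le> m \<Longrightarrow> surv step (dissent n) t A \<le> b" "b \<ge> 0"
    and p: "tail (m\<^sup>2) \<le> p"
    and A: "A \<subseteq> V" "((8 * K + 1) * ((1 - y A) / 2)) ^ (2 ^ k) \<le> (8 * K + 1) * m"
  shows "surv step (dissent n) (k + t) A \<le> b + real k * p"
  using A
proof (induction k arbitrary: A)
  case 0
  have "0 < 8 * K + 1" using K_ge by simp
  with 0 have "(1 - y A) / 2 \<le> m" by (simp add: mult_le_cancel_left_pos del: mult_le_cancel_left)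
  then show ?case using q 0 by simp
next
  case (Suc k)
  let ?D = "8 * K + 1"
  have p0: "p \<ge> 0" using p tail_pos[of "m\<^sup>2"] by linarith
  show ?case
  proof (cases "(1 - y A) / 2 \<le> m")
    case True
    have "surv step (dissent n) (Suc k + t) A \<le> surv step (dissent n) t A"
      by (rule voting_step.surv_antimono) simp
    also have "\<dots> \<le> b" by (rule q(1)[OF Suc.prems(1) True])
    finally show ?thesis using p0 by (simp add: add_increasing2)
  next
    case False
    define a where "a = (1 - y A) / 2"
    have am: "m \<le> a" using False by (simp add: a_def)
    define S where "S = {B. B \<subseteq> V \<and> (1 - y B) / 2 < ?D * a\<^sup>2}"
    have "surv step (dissent n) (Suc (k + t)) A \<le> (b + real k * p) + p"
    proof (rule voting_step.surv_Suc_bound[of S])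
      fix B assume "B \<in> S"
      then have B: "B \<subseteq> V" "(1 - y B) / 2 < ?D * a\<^sup>2" by (auto simp: S_def)
      have "?D * ((1 - y B) / 2) \<le> ?D * (?D * a\<^sup>2)" using B(2) K_ge by (intro mult_left_mono) auto
      also have "\<dots> = (?D * a)\<^sup>2" by (simp add: power2_eq_square)
      finally have "(?D * ((1 - y B) / 2)) ^ (2 ^ k) \<le> ((?D * a)\<^sup>2) ^ (2 ^ k)"
        using K_ge abs_bias_le_1[OF B(1)] by (intro power_mono) auto
      also have "\<dots> = (?D * a) ^ (2 ^ Suc k)" by (simp add: power_mult[symmetric])
      also have "\<dots> \<le> ?D * m" using Suc.prems(2) unfolding a_def .
      finally show "surv step (dissent n) (k + t) B \<le> b + real k * p" by (intro Suc.IH B)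
    next
      have "prob A (- S) \<le> prob A {B. (1 - y B) / 2 \<ge> ?D * a\<^sup>2}"
        by (rule step_prob_mono) (auto simp: S_def)
      also have "\<dots> \<le> tail (a\<^sup>2)" unfolding a_def
        using am m by (intro minority_squares Suc.prems(1) H0 lam1) (simp add: a_def)
      also have "\<dots> \<le> tail (m\<^sup>2)" using am m by (intro tail_antimono power_mono) auto
      finally show "prob A (- S) \<le> p" using p by linarith
    qed (use q(2) p0 in auto)
    then show ?thesis by (simp add: algebra_simps)
  qed
qed

end

section \<open>Growth phase and potential bounds\<close>

context expander_voting_gap begin

text \<open>The bound \<open>1 <= y A * (1 + g * al) ^ k\<close> survives a good round with
  \<open>k\<close> lowered by one. At \<open>k = 0\<close> it reads \<open>y A >= 1\<close>, so the
  minority has vanished.\<close>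

lemma surv_growth_phase:
  assumes L: "0 \<le> L" "K * lam\<^sup>2 \<le> g / 2 * L" and al: "0 < al"
    and q: "\<And>A. A \<subseteq> V \<Longrightarrow> (1 - y A) / 2 \<le> al \<Longrightarrow> surv step (dissent n) t A \<le> b" "b \<ge> 0"
    and p: "tail (g * al * L / 2) \<le> p"
    and A: "A \<subseteq> V" "L \<le> y A" "1 \<le> y A * (1 + g * al) ^ k"
  shows "surv step (dissent n) (k + t) A \<le> b + real k * p"
  using A
proof (induction k arbitrary: A)
  case 0
  then have "(1 - y A) / 2 \<le> al" using al by simp
  then show ?case using q 0 by simp
next
  case (Suc k)
  have p0: "p \<ge> 0" using p tail_pos[of "g * al * L / 2"] by linarith
  show ?case
  proof (cases "(1 - y A) / 2 \<le> al")
    case True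
    have "surv step (dissent n) (Suc k + t) A \<le> surv step (dissent n) t A"
      by (rule voting_step.surv_antimono) simp
    also have "\<dots> \<le> b" by (rule q(1)[OF Suc.prems(1) True])
    finally show ?thesis using p0 by (simp add: add_increasing2)
  next
    case False
    define S where "S = {B. B \<subseteq> V \<and> y B > y A * (1 + g * al)}"
    have ga: "g * al \<ge> 0" using g al by simp
    have "g / 2 * L \<le> g / 2 * y A" using Suc.prems(2) g by (intro mult_left_mono) auto
    then have small: "K * lam\<^sup>2 \<le> g / 2 * y A" by (rule order.trans[OF L(2)])
    have "surv step (dissent n) (Suc (k + t)) A \<le> (b + real k * p) + p"
    proof (rule voting_step.surv_Suc_bound[of S])
      fix B assume "B \<in> S"
      then have B: "B \<subseteq> V" "y B > y A * (1 + g * al)" by (auto simp: S_def)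
      have "y A * 1 \<le> y A * (1 + g * al)" using ga by (intro mult_left_mono) auto
      then have "L \<le> y B" using B(2) Suc.prems(2) by linarith
      moreover have "1 \<le> y B * (1 + g * al) ^ k"
      proof -
        have "1 \<le> (y A * (1 + g * al)) * (1 + g * al) ^ k" using Suc.prems(3) by (simp add: mult.assoc)
        also have "\<dots> \<le> y B * (1 + g * al) ^ k" using B(2) ga by (intro mult_right_mono) auto
        finally show ?thesis .
      qed
      ultimately show "surv step (dissent n) (k + t) B \<le> b + real k * p" by (intro Suc.IH B(1))
    next
      have "prob A (- S) \<le> prob A {B. y B \<le> y A * (1 + g * al)}"
        by (rule step_prob_mono) (auto simp: S_def)
      also have "\<dots> \<le> tail (g * al * y A / 2)"
        using False al by (intro bias_growth_minority Suc.prems(1) small) auto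
      also have "\<dots> \<le> tail (g * al * L / 2)"
        using Suc.prems(2) ga L(1) by (intro tail_antimono) (auto intro!: mult_left_mono divide_right_mono)
      finally show "prob A (- S) \<le> p" using p by linarith
    qed (use q(2) p0 in auto)
    then show ?thesis by (simp add: algebra_simps)
  qed
qed

lemma potential_contracts:
  assumes A: "A \<in> dissent n" and small: "K * lam\<^sup>2 \<le> g / 2 * y A"
    and L: "h / sqrt n \<le> L" "1 / n \<le> L" "L \<le> y A" and h: "96 * C1 / g\<^sup>2 \<le> h"
    and N: "tail (g / 16) * real n ^ 3 \<le> g / 4"
  shows "expect A (potential L) \<le> (1 - g / 16) * potential L A"
proof (cases "y A \<ge> 1/2")
  case True
  have "0 < 1 / real n" using n_pos by simp
  then have "L > 0" using L(2) by linarith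
  then have "potential L A \<ge> 0" using A by (intro potential_nonneg) auto
  then have "(1 - g / 8) * potential L A \<le> (1 - g / 16) * potential L A"
    using g by (intro mult_right_mono) auto
  then show ?thesis using potential_contracts_far[OF A small True L(2,3) N] by linarith
next
  case False
  have "A \<subseteq> V" using A by auto
  then show ?thesis using False by (intro potential_contracts_near[OF _ small _ L(1,3) h]) auto
qed

text \<open>Scaled by \<open>n^2\<close>, the potential is at least 1 on dissenting sets, because
  its denominator is at most 1, and at most \<open>n^3\<close> at the start, because
  \<open>1 / L <= n\<close>.\<close>

lemma surv_potential_bound:
  assumes contr: "\<And>B. B \<in> dissent n \<Longrightarrow> B \<in> G \<Longrightarrow>
      expect B (potential L) \<le> r * potential L B"
    and exit: "\<And>B. B \<in> dissent n \<Longrightarrow> B \<in> G \<Longrightarrow> prob B (- G) \<le> p"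
    and G: "G \<subseteq> Pow V" "A \<in> G" and L: "1 / n \<le> L" "L \<le> 1" and rp: "r \<ge> 0" "p \<ge> 0"
  shows "surv step (dissent n) t A \<le> r ^ t * real n ^ 3 + real t * p"
proof -
  define \<phi> where "\<phi> B = (real n)\<^sup>2 * potential L B" for B
  have "0 < 1 / real n" using n_pos by simp
  then have L0: "L > 0" using L(1) by linarith
  have ph: "\<phi> B \<ge> 0" if "B \<subseteq> V" for B using potential_nonneg[OF that L0] by (simp add: \<phi>_def)
  have "surv step (dissent n) t A \<le> r ^ t * \<phi> A + real t * p"
  proof (rule voting_step.surv_lyapunov[where G = G])
    fix B assume B: "B \<in> G" "B \<in> dissent n"
    have "expect B (\<lambda>C. if C \<in> G then \<phi> C else 0) \<le> expect B \<phi>"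
      using ph step_subset by (intro voting_step.expectation_mono) auto
    also have "\<dots> = (real n)\<^sup>2 * expect B (potential L)" by (simp add: \<phi>_def[abs_def])
    also have "\<dots> \<le> (real n)\<^sup>2 * (r * potential L B)"
      by (intro mult_left_mono contr B) simp
    finally show "expect B (\<lambda>C. if C \<in> G then \<phi> C else 0) \<le> r * \<phi> B"
      by (simp add: \<phi>_def mult_ac)
    show "prob B (- G) \<le> p" by (rule exit[OF B(2,1)])
    have "B \<subseteq> V" using B(2) by auto
    then have mx: "max (y B) L \<le> 1" "max (y B) L > 0" using abs_bias_le_1[of B] L(2) L0 by auto
    have ge: "1 - y B \<ge> 2 / (real n)\<^sup>2" by (rule one_minus_abs_bias_ge[OF B(2)])
    moreover have "2 / (real n)\<^sup>2 > 0" using n_pos by simp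
    ultimately have "0 \<le> 1 - y B" by linarith
    then have "1 - y B \<le> potential L B"
      using mx unfolding potential_def by (simp add: le_divide_eq mult_left_le)
    then have "(real n)\<^sup>2 * (2 / (real n)\<^sup>2) \<le> \<phi> B"
      unfolding \<phi>_def using ge by (intro mult_left_mono) auto
    then show "1 \<le> \<phi> B" using n_pos by simp
  next
    fix B assume "B \<in> G" then show "0 \<le> \<phi> B" using ph G(1) by auto
  qed (use rp G(2) in auto)
  also have "r ^ t * \<phi> A \<le> r ^ t * real n ^ 3"
  proof (rule mult_left_mono)
    have "potential L A \<le> 1 / L" using G by (intro potential_le[OF _ L0]) auto
    also have "\<dots> \<le> n" using L(1) L0 n_pos by (simp add: field_simps)
    finally have "\<phi> A \<le> (real n)\<^sup>2 * n" unfolding \<phi>_def by (intro mult_left_mono) auto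
    then show "\<phi> A \<le> real n ^ 3" by (simp add: power2_eq_square power3_eq_cube)
  qed (use rp in simp)
  finally show ?thesis by simp
qed

lemma surv_biased:
  assumes small: "\<And>x. L \<le> x \<Longrightarrow> K * lam\<^sup>2 \<le> g / 2 * x"
    and L: "h / sqrt n \<le> L" "1 / n \<le> L" "L \<le> 1/2" and h: "96 * C1 / g\<^sup>2 \<le> h"
    and N: "tail (g / 16) * real n ^ 3 \<le> g / 4"
    and A: "A \<subseteq> V" "L \<le> y A"
  shows "surv step (dissent n) t A \<le> (1 - g / 16) ^ t * real n ^ 3 + real t * tail (g * L / 8)"
proof (rule surv_potential_bound[where G = "{B. B \<subseteq> V \<and> L \<le> y B}"])
  have "0 \<le> 1 / real n" by simp
  then have L0: "0 \<le> L" using L(2) by linarith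
  fix B assume B: "B \<in> dissent n" "B \<in> {B. B \<subseteq> V \<and> L \<le> y B}"
  show "expect B (potential L) \<le> (1 - g / 16) * potential L B"
    using B small L by (intro potential_contracts[OF _ _ L(1,2) _ h N]) auto
  have "prob B (- {B. B \<subseteq> V \<and> L \<le> y B}) \<le> prob B {C. y C < L}"
    by (rule step_prob_mono) auto
  also have "\<dots> \<le> tail (g * L / 8)" using B small L L0 by (intro bias_exit) auto
  finally show "prob B (- {B. B \<subseteq> V \<and> L \<le> y B}) \<le> tail (g * L / 8)" .
qed (use L A g tail_pos in \<open>auto simp: less_imp_le\<close>)

text \<open>All subsets of \<open>V\<close> are good, so no exit is paid for. Above \<open>L\<close>
  the drift contracts the potential; below it, \<open>bias_anticoncentration\<close> lifts the bias
  to \<open>2 * L\<close> with probability at least \<open>p0\<close>. In \<open>D\<close>, the term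
  \<open>2 * C1\<close> offsets the Hoeffding loss of that lemma, \<open>4 * K * h\<close> and
  \<open>K * C1^2\<close> offset the mean bias, and \<open>2 * h\<close> is the target
  \<open>2 * L\<close>.\<close>

lemma surv_any:
  assumes z: "0 < z" and e: "0 < e" and f_half: "\<And>x. \<bar>x - 1/2\<bar> \<le> z \<Longrightarrow> e \<le> f x \<and> f x \<le> 1 - e"
    and lam1: "lam \<le> 1" and lamz: "lam\<^sup>2 \<le> z\<^sup>2 / 2" and lam2: "lam\<^sup>2 \<le> C1\<^sup>2 / sqrt n"
    and h: "1 \<le> h" "96 * C1 / g\<^sup>2 \<le> h" "2 * K * C1\<^sup>2 / g \<le> h"
    and D: "D = 2 * C1 + 2 * h + 4 * K * h + K * C1\<^sup>2" "D / sqrt n \<le> e"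
    and p0: "p0 = exp (- D\<^sup>2 / e\<^sup>2) / 4"
    and L: "h / sqrt n \<le> z" "h / sqrt n \<le> p0 / 4" and N: "tail (g / 16) * real n ^ 3 \<le> g / 4"
    and A: "A \<subseteq> V"
  shows "surv step (dissent n) t A \<le> (1 - min (g / 16) (p0 / 4)) ^ t * real n ^ 3"
proof -
  define L where "L = h / sqrt n"
  define r where "r = 1 - min (g / 16) (p0 / 4)"
  have p0': "0 < p0" "p0 \<le> 1/4" by (auto simp: p0)
  have L0: "L > 0" using h n_pos by (simp add: L_def)
  have L1: "L \<le> p0 / 4" using L(2) by (simp add: L_def)
  have Ln: "1 / n \<le> L"
  proof -
    have "sqrt (real n * 1) \<le> sqrt (real n * real n)" using n_pos n_ge_2 by (intro real_sqrt_le_mono mult_left_mono) auto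
    then have "sqrt n \<le> n" by simp
    then show ?thesis unfolding L_def using h(1) n_pos by (intro frac_le) auto
  qed
  have small: "K * lam\<^sup>2 \<le> g / 2 * x" if "L \<le> x" for x
  proof -
    have "K * lam\<^sup>2 \<le> K * (C1\<^sup>2 / sqrt n)" using lam2 K_ge by (intro mult_left_mono) auto
    also have "\<dots> = (2 * K * C1\<^sup>2 / g) * (g / 2 / sqrt n)" using g by (simp add: field_simps)
    also have "\<dots> \<le> h * (g / 2 / sqrt n)" using h(3) g by (intro mult_right_mono) auto
    also have "\<dots> = g / 2 * L" by (simp add: L_def)
    also have "\<dots> \<le> g / 2 * x" using that g by (intro mult_left_mono) auto
    finally show ?thesis .
  qed
  have r: "r \<ge> 0" "1 - g / 16 \<le> r" "1 - p0 / 4 \<le> r" using g by (auto simp: r_def)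
  have "surv step (dissent n) t A \<le> r ^ t * real n ^ 3 + real t * 0"
  proof (rule surv_potential_bound[where G = "Pow V"])
    fix B assume B: "B \<in> dissent n" "B \<in> Pow V"
    then have BV: "B \<subseteq> V" by auto
    have pot0: "potential L B \<ge> 0" by (rule potential_nonneg[OF BV L0])
    show "expect B (potential L) \<le> r * potential L B"
    proof (cases "L \<le> y B")
      case True
      have "expect B (potential L) \<le> (1 - g / 16) * potential L B"
        using L_def by (intro potential_contracts[OF B(1) small[OF True] _ Ln True h(2) N]) simp
      also have "\<dots> \<le> r * potential L B" using r pot0 by (intro mult_right_mono)
      finally show ?thesis .
    next
      case False
      define F where "F = {C. y C \<ge> 2 * L}"
      have D0: "D > 0" using D(1) C1_pos h(1) K_ge by (auto intro!: add_pos_nonneg)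
      have "p0 \<le> prob B {C. y C \<ge> (D - 2 * C1) / sqrt n - 4 * K * y B - K * lam\<^sup>2}"
        unfolding p0 using False L(1)
        by (intro bias_anticoncentration[OF BV z e f_half _ lam1 lamz D0 D(2)]) (auto simp: L_def)
      also have "\<dots> \<le> prob B F"
      proof (rule step_prob_mono)
        fix C assume C: "C \<in> {C. y C \<ge> (D - 2 * C1) / sqrt n - 4 * K * y B - K * lam\<^sup>2}"
        have "4 * K * y B \<le> 4 * K * L" using False K_ge by (intro mult_left_mono) auto
        moreover have "K * lam\<^sup>2 \<le> K * (C1\<^sup>2 / sqrt n)" using lam2 K_ge by (intro mult_left_mono) auto
        moreover have "(D - 2 * C1) / sqrt n = 2 * L + 4 * K * L + K * (C1\<^sup>2 / sqrt n)"
          by (simp add: D(1) L_def add_divide_distrib)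
        ultimately show "C \<in> F" using C by (simp add: F_def)
      qed
      finally have pF: "p0 \<le> prob B F" .
      have "expect B (potential L)
          \<le> expect B (\<lambda>C. 1 / L - indicator F C * (1 / (2 * L)))"
      proof (rule voting_step.expectation_mono)
        fix C assume "C \<in> set_pmf (step B)"
        then have C: "C \<subseteq> V" by (rule step_subset)
        show "potential L C \<le> 1 / L - indicator F C * (1 / (2 * L))"
        proof (cases "C \<in> F")
          case True
          then have "2 * L \<le> max (y C) L" by (simp add: F_def)
          then have "potential L C \<le> 1 / (2 * L)"
            unfolding potential_def using abs_bias_le_1[OF C] L0 by (intro frac_le) auto
          also have "\<dots> = 1 / L - 1 / (2 * L)" using L0 by (simp add: field_simps)
          finally show ?thesis using True by simp
        next
          case False
          then show ?thesis using potential_le[OF C L0] by simp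
        qed
      qed
      also have "\<dots> = 1 / L - prob B F * (1 / (2 * L))" by simp
      also have "\<dots> \<le> 1 / L - p0 * (1 / (2 * L))" using pF L0 by (intro diff_left_mono mult_right_mono) auto
      also have "\<dots> = (1 - p0 / 2) * (1 / L)" by (simp add: diff_divide_distrib)
      \<comment> \<open>Below \<open>L\<close> the current potential is only known to be at least
        \<open>(1 - L) / L\<close>, not \<open>1 / L\<close>; since \<open>L <= p0 / 4\<close>, half
        of the gain \<open>p0 / 2\<close> makes up for it.\<close>
      also have "\<dots> \<le> ((1 - p0 / 4) * (1 - L)) * (1 / L)"
      proof (rule mult_right_mono)
        have "0 \<le> (p0 / 4) * L" using p0' L0 by simp
        moreover have "(1 - p0 / 4) * (1 - L) = 1 - p0 / 4 - L + (p0 / 4) * L" by (simp add: field_simps)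
        ultimately show "1 - p0 / 2 \<le> (1 - p0 / 4) * (1 - L)" using L1 by linarith
      qed (use L0 in simp)
      also have "\<dots> = (1 - p0 / 4) * ((1 - L) / L)" by simp
      also have "\<dots> \<le> (1 - p0 / 4) * potential L B"
        unfolding potential_def using False L0 p0' by (intro mult_left_mono) (auto intro!: divide_right_mono)
      also have "\<dots> \<le> r * potential L B" using r pot0 by (intro mult_right_mono)
      finally show ?thesis .
    qed
    have "prob B (- Pow V) \<le> prob B {}"
      by (rule step_prob_mono) auto
    then show "prob B (- Pow V) \<le> 0" by simp
  qed (use A Ln L1 p0' r in auto)
  then show ?thesis by (simp add: r_def)
qed

end

section \<open>Consensus times\<close>

lemma eventually_le_of_tendsto_0:
  fixes u :: "nat \<Rightarrow> real"
  assumes "(u \<longlongrightarrow> 0) sequentially" "d > 0"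
  shows "\<forall>\<^sub>F n in sequentially. u n \<le> d"
  using order_tendstoD(2)[OF assms] by (rule eventually_mono) simp

text \<open>Rounding the number of rounds down loses at most the factor
  \<open>exp r <= exp 1\<close>.\<close>

lemma power_floor_decay:
  fixes r x b :: real
  assumes "0 < r" "r \<le> 1" "x \<ge> 0" "b \<ge> 0"
  shows "(1 - r) ^ nat \<lfloor>b / r * x\<rfloor> \<le> exp (1 - b * x)"
proof -
  define t where "t = nat \<lfloor>b / r * x\<rfloor>"
  have "b / r * x \<ge> 0" using assms by simp
  then have t: "b / r * x - 1 \<le> real t" unfolding t_def by linarith
  have "(1 - r) ^ t \<le> exp (- r) ^ t" using assms exp_ge_add_one_self[of "- r"] by (intro power_mono) auto
  also have "\<dots> = exp (- (r * t))" by (simp add: exp_of_nat_mult[symmetric] mult.commute)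
  also have "\<dots> \<le> exp (1 - b * x)"
  proof -
    have "r * (b / r * x - 1) \<le> r * t" using t assms by (intro mult_left_mono) auto
    moreover have "r * (b / r * x - 1) = b * x - r" using assms by (simp add: field_simps)
    ultimately have "b * x - r \<le> r * t" by (simp only:)
    then show ?thesis using assms(2) by (subst exp_le_cancel_iff) linarith
  qed
  finally show ?thesis unfolding t_def .
qed

text \<open>Halving the exponent leaves a positive power of \<open>n\<close> to absorb the logarithm
  and the constants.\<close>

lemma failure_probability_bound:
  fixes B c0 :: real
  assumes "c0 > 0"
  shows "\<forall>\<^sub>F n::nat in sequentially. exp (1 - ln n) + B * ln n * exp (- (c0 * ln n)) \<le> real n powr (- (min 1 c0 / 2))"
proof -
  define c where "c = min 1 c0 / 2"
  have c: "c > 0" "1 - c > 0" "c0 - c > 0" using assms by (auto simp: c_def min_def)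
  have "((\<lambda>n::nat. exp 1 * real n powr (- (1 - c))) \<longlongrightarrow> 0) sequentially"
    using c(2) by real_asymp
  moreover have "((\<lambda>n::nat. B * (ln n * real n powr (- (c0 - c)))) \<longlongrightarrow> 0) sequentially"
  proof (rule tendsto_mult_right_zero)
    show "((\<lambda>n::nat. ln n * real n powr (- (c0 - c))) \<longlongrightarrow> 0) sequentially"
      using c(3) by real_asymp
  qed
  ultimately have "((\<lambda>n::nat. exp 1 * real n powr (- (1 - c)) + B * (ln n * real n powr (- (c0 - c)))) \<longlongrightarrow> 0 + 0) sequentially"
    by (rule tendsto_add)
  then have "\<forall>\<^sub>F n::nat in sequentially. exp 1 * real n powr (- (1 - c)) + B * (ln n * real n powr (- (c0 - c))) \<le> 1"
    by (intro eventually_le_of_tendsto_0) auto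
  then show ?thesis using eventually_gt_at_top[of 0]
  proof eventually_elim
    case (elim n)
    have 1: "exp (1 - ln n) = exp 1 * real n powr (- (1 - c)) * real n powr (- c)"
      using elim(2) by (simp add: powr_def exp_add[symmetric] algebra_simps)
    have 2: "exp (- (c0 * ln n)) = real n powr (- (c0 - c)) * real n powr (- c)"
      using elim(2) by (simp add: powr_def exp_add[symmetric] algebra_simps)
    have "exp (1 - ln n) + B * ln n * exp (- (c0 * ln n))
      = (exp 1 * real n powr (- (1 - c)) + B * (ln n * real n powr (- (c0 - c)))) * real n powr (- c)"
      unfolding 1 2 by (simp add: algebra_simps)
    also have "\<dots> \<le> 1 * real n powr (- c)" using elim(1) by (intro mult_right_mono) auto
    finally show ?case by (simp add: c_def)
  qed
qed

lemma powr_neg_half: "real n powr (- (1/2)) = 1 / sqrt n"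
proof -
  have "real n powr (1/2) = sqrt n" by (rule powr_half_sqrt) simp
  then show ?thesis by (simp only: powr_minus inverse_eq_divide)
qed

lemma lam_sq_le:
  assumes "0 \<le> lam" "lam \<le> C * real n powr (-1/4)" "n > 0"
  shows "lam\<^sup>2 \<le> C\<^sup>2 / sqrt n"
proof -
  have "lam\<^sup>2 \<le> (C * real n powr (-1/4))\<^sup>2" using assms by (intro power_mono) auto
  also have "\<dots> = C\<^sup>2 * (real n powr (-1/4) * real n powr (-1/4))" by (simp add: power2_eq_square)
  also have "real n powr (-1/4) * real n powr (-1/4) = real n powr (- (1/2))"
    by (simp add: powr_add[symmetric])
  also have "\<dots> = 1 / sqrt n" by (rule powr_neg_half)
  finally show ?thesis by simp
qed

section \<open>Choice of constants for the individual claims\<close>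

context quasi_majority_voting begin

lemma f_half_bounds:
  obtains z e where "0 < z" "0 < e" "\<And>x. \<bar>x - 1/2\<bar> \<le> z \<Longrightarrow> e \<le> f x \<and> f x \<le> 1 - e"
proof -
  define e where "e = min (f (1/2)) (1 - f (1/2)) / 2"
  have e: "0 < e" "2 * e \<le> f (1/2)" "2 * e \<le> 1 - f (1/2)"
    using qm by (auto simp: quasi_majority_def e_def)
  have "isCont f (1/2)" using f_deriv by (rule DERIV_isCont)
  then obtain d where d: "d > 0" "\<And>x. \<bar>x - 1/2\<bar> < d \<Longrightarrow> \<bar>f x - f (1/2)\<bar> < e"
    using e(1) unfolding continuous_at_eps_delta by (auto simp: dist_real_def)
  show ?thesis
  proof (rule that[of "d / 2" e])
    fix x :: real assume "\<bar>x - 1/2\<bar> \<le> d / 2"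
    then have "\<bar>f x - f (1/2)\<bar> < e" using d by (intro d(2)) auto
    then show "e \<le> f x \<and> f x \<le> 1 - e" using e by linarith
  qed (use d e in auto)
qed

lemma H_gap_exists:
  obtains g where "0 < g" "g \<le> 1/2" "\<And>a. a \<in> {0..1/2} \<Longrightarrow> H a \<le> a - 2 * g * a * (1 - 2 * a)"
proof -
  obtain e where e: "0 < e" "e \<le> 1" "\<And>a. a \<in> {0..1/2} \<Longrightarrow> H a \<le> a - e * a * (1 - 2 * a)"
    by (rule H_contraction) blast
  then show ?thesis by (intro that[of "e / 2"]) auto
qed

lemma expander_votingI:
  assumes "connected_graph n E" "n \<ge> 2" "expander lam n E" "real (max_deg n E) \<le> C1 * avg_deg n E" "C1 > 0"
  shows "expander_voting n E f f' K lam C1"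
  by (intro expander_voting.intro voting_graph.intro quasi_majority_voting_axioms
      expander_voting_axioms.intro assms)

lemma consensus_upper_bound:
  assumes C1: "C1 > 0"
  shows "\<exists>B>0. \<exists>c>0. \<exists>N. \<forall>n\<ge>N. \<forall>E lam.
          connected_graph n E \<and> expander lam n E \<and>
          real (max_deg n E) \<le> C1 * avg_deg n E \<and>
          lam \<le> C1 * real n powr (-1/4) \<longrightarrow>
          (\<forall>A\<subseteq>{..<n}.
             \<P>(\<omega> in voting_chain f n E A. ereal_of_enat (T_cons n \<omega>) \<le> ereal (B * ln (real n)))
               \<ge> 1 - real n powr (-c))"
proof -
  obtain z e where ze: "0 < z" "0 < e" "\<And>x. \<bar>x - 1/2\<bar> \<le> z \<Longrightarrow> e \<le> f x \<and> f x \<le> 1 - e"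
    by (rule f_half_bounds) blast
  obtain g where g: "0 < g" "g \<le> 1/2" "\<And>a. a \<in> {0..1/2} \<Longrightarrow> H a \<le> a - 2 * g * a * (1 - 2 * a)"
    by (rule H_gap_exists) blast
  define h where "h = max 1 (max (96 * C1 / g\<^sup>2) (2 * K * C1\<^sup>2 / g))"
  have h: "1 \<le> h" "96 * C1 / g\<^sup>2 \<le> h" "2 * K * C1\<^sup>2 / g \<le> h" by (auto simp: h_def)
  define D where "D = 2 * C1 + 2 * h + 4 * K * h + K * C1\<^sup>2"
  define p0 where "p0 = exp (- D\<^sup>2 / e\<^sup>2) / 4"
  have p0: "0 < p0" by (simp add: p0_def)
  define r where "r = min (g / 16) (p0 / 4)"
  have r: "0 < r" "r \<le> 1" using g p0 by (auto simp: r_def)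
  \<comment> \<open>The bound \<open>z / 2\<close> gives \<open>lam^2 <= z^2 / 2\<close>, and
    \<open>g / (2 * K)\<close> gives \<open>K * lam <= g / 2\<close>.\<close>
  define d where "d = min 1 (min (z / 2) (g / (2 * K)))"
  have d: "0 < d" using ze g K_ge by (simp add: d_def)
  define c where "c = 2 * (g / 16)\<^sup>2 / C1\<^sup>2"
  have c: "c > 0" using g C1 by (simp add: c_def)
  have "\<forall>\<^sub>F n::nat in sequentially. n \<ge> 2 \<and> ln n \<ge> 1 \<and> C1 * real n powr (-1/4) \<le> d \<and>
      D / sqrt n \<le> e \<and> h / sqrt n \<le> z \<and> h / sqrt n \<le> p0 / 4 \<and> exp (- c * n) * real n ^ 3 \<le> g / 4"
    (is "\<forall>\<^sub>F n in _. ?P n")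
  proof (intro eventually_conj eventually_ge_at_top)
    show "\<forall>\<^sub>F n::nat in sequentially. ln n \<ge> (1::real)" by real_asymp
    show "\<forall>\<^sub>F n::nat in sequentially. C1 * real n powr (-1/4) \<le> d"
      by (intro eventually_le_of_tendsto_0 d tendsto_mult_right_zero) real_asymp
    have lim: "((\<lambda>n::nat. x / sqrt n) \<longlongrightarrow> 0) sequentially" for x :: real
      unfolding divide_inverse by (intro tendsto_mult_right_zero) real_asymp
    show "\<forall>\<^sub>F n::nat in sequentially. D / sqrt n \<le> e" "\<forall>\<^sub>F n::nat in sequentially. h / sqrt n \<le> z"
      "\<forall>\<^sub>F n::nat in sequentially. h / sqrt n \<le> p0 / 4"
      using ze p0 by (intro eventually_le_of_tendsto_0 lim; simp)+
    have "((\<lambda>n::nat. exp (- c * n) * real n ^ 3) \<longlongrightarrow> 0) sequentially" using c by real_asymp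
    then show "\<forall>\<^sub>F n::nat in sequentially. exp (- c * n) * real n ^ 3 \<le> g / 4"
      using g by (intro eventually_le_of_tendsto_0) auto
  qed
  then obtain N where N: "\<And>n. n \<ge> N \<Longrightarrow> ?P n"
    unfolding eventually_sequentially by blast
  show ?thesis
  \<comment> \<open>The 5 splits into 3 for the initial potential \<open>n^3\<close>, 1 for the
    constant \<open>exp 1\<close>, and 1 for the final \<open>n powr (- 1)\<close>.\<close>
  proof (rule exI[of _ "5 / r"], rule conjI, use r in simp, rule exI[of _ 1], rule conjI, simp,
      rule exI[of _ N], intro allI impI)
    fix n E lam A
    assume nN: "N \<le> n" and asm: "connected_graph n E \<and> expander lam n E \<and>
          real (max_deg n E) \<le> C1 * avg_deg n E \<and> lam \<le> C1 * real n powr (-1/4)" and A: "A \<subseteq> {..<n}"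
    note n = N[OF nN]
    interpret expander_voting n E f f' K lam C1
      using asm n C1 by (intro expander_votingI) auto
    have lamd: "lam \<le> d" using asm n by linarith
    have "K * lam \<le> K * (g / (2 * K))" using lamd K_ge by (intro mult_left_mono) (auto simp: d_def)
    then have Kl: "K * lam \<le> g / 2" using K_ge by simp
    interpret expander_voting_gap n E f f' K lam C1 g
      using g Kl by unfold_locales auto
    have lamz: "lam\<^sup>2 \<le> z\<^sup>2 / 2"
    proof -
      have "lam\<^sup>2 \<le> (z / 2)\<^sup>2" using lamd lam_nonneg by (intro power_mono) (auto simp: d_def)
      also have "\<dots> \<le> z\<^sup>2 / 2" by (simp add: power_divide)
      finally show ?thesis .
    qed
    have lam2: "lam\<^sup>2 \<le> C1\<^sup>2 / sqrt n" using asm n by (intro lam_sq_le lam_nonneg) auto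
    have tl: "tail (g / 16) * real n ^ 3 \<le> g / 4" using n by (simp add: tail_def c_def)
    let ?t = "nat \<lfloor>5 / r * ln n\<rfloor>"
    have "surv step (dissent n) ?t A \<le> (1 - r) ^ ?t * real n ^ 3"
      unfolding r_def
      by (rule surv_any[OF ze _ lamz lam2 h D_def _ p0_def _ _ tl A]) (use n lamd in \<open>auto simp: d_def\<close>)
    also have "\<dots> \<le> exp (1 - 5 * ln n) * real n ^ 3"
      using n r by (intro mult_right_mono power_floor_decay) auto
    also have "real n ^ 3 = exp (3 * ln n)"
      using exp_of_nat_mult[of 3 "ln (real n)"] n by simp
    also have "exp (1 - 5 * ln n) * exp (3 * ln n) = exp (1 - 2 * ln n)" by (simp add: exp_add[symmetric])
    also have "\<dots> \<le> exp (- ln n)" using n by simp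
    also have "\<dots> = real n powr (- 1)" using n by (simp add: powr_def)
    finally have s: "surv step (dissent n) ?t A \<le> real n powr (- 1)" .
    have "real ?t \<le> 5 / r * ln n" using n r by simp
    from prob_T_cons_le[OF A this, of f E] s
    show "\<P>(\<omega> in voting_chain f n E A. ereal_of_enat (T_cons n \<omega>) \<le> ereal (5 / r * ln (real n)))
      \<ge> 1 - real n powr (- 1)" by linarith
  qed
qed

lemma consensus_lower_bound:
  assumes C1: "C1 > 0"
  shows "\<exists>k>0. \<exists>c>0. \<exists>N. \<forall>n\<ge>N. \<forall>E lam.
          connected_graph n E \<and> expander lam n E \<and>
          real (max_deg n E) \<le> C1 * avg_deg n E \<and>
          lam \<le> C1 * real n powr (-1/4) \<longrightarrow>
          (\<exists>A\<subseteq>{..<n}.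
             \<P>(\<omega> in voting_chain f n E A. ereal_of_enat (T_cons n \<omega>) \<ge> ereal (k * ln (real n)))
               \<ge> 1 - real n powr (-c))"
proof -
  \<comment> \<open>In \<open>k * ln n\<close> rounds the factor \<open>5 * K\<close> per round
    accumulates to at most \<open>n powr (1/8)\<close>, while the start is below
    \<open>n powr (-1/4)\<close>, so the bias stays below 1.\<close>
  define k where "k = 1 / (8 * ln (5 * K))"
  have lnK: "ln (5 * K) > 0" using K_ge by simp
  have k: "k > 0" "k * ln (5 * K) = 1/8" using lnK by (auto simp: k_def)
  define d where "d = 1 / (8 * C1\<^sup>2)"
  have d: "d > 0" using C1 by (simp add: d_def)
  have "\<forall>\<^sub>F n::nat in sequentially. n \<ge> 2 \<and> ln n \<ge> 1 \<and> C1 * real n powr (-1/4) \<le> 1 \<and>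
      K * (C1\<^sup>2 / sqrt n) \<le> real n powr (-1/4) / 2 \<and> 2 * C1 / n \<le> real n powr (-1/4) \<and>
      k * ln n * (2 * exp (- d * sqrt n)) \<le> real n powr (- 1)"
    (is "\<forall>\<^sub>F n in _. ?P n")
  proof (intro eventually_conj eventually_ge_at_top)
    have K0: "K > 0" using K_ge by simp
    show "\<forall>\<^sub>F n::nat in sequentially. ln n \<ge> (1::real)" by real_asymp
    show "\<forall>\<^sub>F n::nat in sequentially. C1 * real n powr (-1/4) \<le> 1"
      by (intro eventually_le_of_tendsto_0 tendsto_mult_right_zero; simp?) real_asymp
    show "\<forall>\<^sub>F n::nat in sequentially. K * (C1\<^sup>2 / sqrt n) \<le> real n powr (-1/4) / 2"
      using C1 K0 by real_asymp
    show "\<forall>\<^sub>F n::nat in sequentially. 2 * C1 / n \<le> real n powr (-1/4)" using C1 by real_asymp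
    show "\<forall>\<^sub>F n::nat in sequentially. k * ln n * (2 * exp (- d * sqrt n)) \<le> real n powr (- 1)"
      using k(1) d by real_asymp
  qed
  then obtain N where N: "\<And>n. n \<ge> N \<Longrightarrow> ?P n"
    unfolding eventually_sequentially by blast
  show ?thesis
  proof (rule exI[of _ k], rule conjI, use k in simp, rule exI[of _ 1], rule conjI, simp,
      rule exI[of _ N], intro allI impI)
    fix n E lam
    assume nN: "N \<le> n" and asm: "connected_graph n E \<and> expander lam n E \<and>
          real (max_deg n E) \<le> C1 * avg_deg n E \<and> lam \<le> C1 * real n powr (-1/4)"
    note n = N[OF nN]
    interpret expander_voting n E f f' K lam C1
      using asm n C1 by (intro expander_votingI) auto
    \<comment> \<open>The exponent meets two demands: \<open>w\<close> must dominate
      \<open>lam^2\<close>, which is of order \<open>1 / sqrt n\<close>, and \<open>w^2 * n\<close>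
      must outgrow \<open>ln n\<close> to make \<open>tail (w / 4)\<close> negligible.\<close>
    define w where "w = real n powr (-1/4)"
    have w: "w > 0" using n by (simp add: w_def)
    obtain A where A: "A \<subseteq> {..<n}" "y A \<le> 2 * C1 / n" using exists_balanced_set by blast
    have Aw: "y A \<le> w" using A(2) n by (simp add: w_def)
    have lam2: "lam\<^sup>2 \<le> C1\<^sup>2 / sqrt n" using asm n by (intro lam_sq_le lam_nonneg) auto
    have small: "K * lam\<^sup>2 \<le> w / 2"
    proof -
      have "K * lam\<^sup>2 \<le> K * (C1\<^sup>2 / sqrt n)" using lam2 K_ge by (intro mult_left_mono) auto
      then show ?thesis using n unfolding w_def by linarith
    qed
    let ?t = "nat \<lfloor>k * ln n\<rfloor>"
    have t: "real ?t \<le> k * ln n" "k * ln n \<le> real ?t + 1" using n k by (simp, linarith)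
    have pw: "(5 * K) ^ ?t * w < 1"
    proof -
      have "(5 * K) ^ ?t = exp (real ?t * ln (5 * K))" using K_ge by (simp add: exp_of_nat_mult)
      also have "\<dots> \<le> exp (k * ln n * ln (5 * K))" using t(1) lnK by simp
      also have "k * ln n * ln (5 * K) = ln n / 8" using k(2) by (simp add: mult_ac)
      finally have "(5 * K) ^ ?t * w \<le> exp (ln n / 8) * w" using w by (intro mult_right_mono) auto
      also have "\<dots> = exp (- (ln n / 8))" using n by (simp add: w_def powr_def exp_add[symmetric])
      also have "\<dots> < 1" using n by simp
      finally show ?thesis .
    qed
    have s: "1 - real ?t * (2 * tail (w / 4)) \<le> surv step (dissent n) ?t A"
      using asm n by (intro surv_lower_bound[OF small _ w order_refl A(1) Aw pw]) auto
    have tl: "tail (w / 4) = exp (- d * sqrt n)"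
    proof -
      have "w\<^sup>2 = real n powr (- (1/2))"
        unfolding w_def power2_eq_square by (simp add: powr_add[symmetric])
      also have "\<dots> = 1 / sqrt n" by (rule powr_neg_half)
      finally have "w\<^sup>2 * n = sqrt n" using n by (simp add: real_div_sqrt)
      moreover have "-2 * (w / 4)\<^sup>2 * n / C1\<^sup>2 = - (w\<^sup>2 * n) / (8 * C1\<^sup>2)" by (simp add: power_divide)
      ultimately show ?thesis by (simp add: tail_def d_def)
    qed
    have "real ?t * (2 * exp (- d * sqrt n)) \<le> k * ln n * (2 * exp (- d * sqrt n))"
      using t(1) by (intro mult_right_mono) auto
    also have "\<dots> \<le> real n powr (- 1)" using n by blast
    finally have "1 - real n powr (- 1) \<le> surv step (dissent n) ?t A" using s unfolding tl by linarith
    also have "\<dots> \<le> \<P>(\<omega> in voting_chain f n E A. ereal_of_enat (T_cons n \<omega>) \<ge> ereal (k * ln (real n)))"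
      using t(2) by (rule prob_T_cons_ge)
    finally show "\<exists>A\<subseteq>{..<n}.
             \<P>(\<omega> in voting_chain f n E A. ereal_of_enat (T_cons n \<omega>) \<ge> ereal (k * ln (real n)))
               \<ge> 1 - real n powr (- 1)" using A(1) by blast
  qed
qed

lemma biased_consensus_bound:
  shows "\<exists>C2>0. \<forall>C1>0.
       \<exists>B>0. \<exists>c>0. \<exists>N. \<forall>n\<ge>N. \<forall>E lam.
          connected_graph n E \<and> expander lam n E \<and>
          real (max_deg n E) \<le> C1 * avg_deg n E \<and>
          lam \<le> C2 \<longrightarrow>
          (\<forall>A\<subseteq>{..<n}.
             \<bar>bias n E A\<bar> \<ge> C2 * max (lam\<^sup>2) (sqrt (ln (real n) / real n)) \<longrightarrow>
             \<P>(\<omega> in voting_chain f n E A. ereal_of_enat (T_cons n \<omega>) \<le> ereal (B * ln (real n)))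
               \<ge> 1 - real n powr (-c))"
  (is "\<exists>C2>0. \<forall>C1>0. ?Q C2 C1")
proof -
  obtain g where g: "0 < g" "g \<le> 1/2" "\<And>a. a \<in> {0..1/2} \<Longrightarrow> H a \<le> a - 2 * g * a * (1 - 2 * a)"
    by (rule H_gap_exists) blast
  define M where "M = 4 * K / g"
  have "1 * g \<le> 4 * K" using g K_ge by linarith
  then have M: "M \<ge> 1" using g by (simp add: M_def le_divide_eq)
  \<comment> \<open>The square is chosen because the bias is at most 1: the bias condition then
    gives \<open>C2 * lam^2 <= 1\<close>, that is \<open>M * lam <= 1\<close>, hence
    \<open>K * lam <= g / 4\<close>. As \<open>C2 >= M\<close>, it also makes the bias dominate
    \<open>lam^2\<close>.\<close>
  define C2 where "C2 = M\<^sup>2"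
  have C2: "C2 \<ge> M" "C2 > 0" using M by (auto simp: C2_def power2_eq_square)
  show ?thesis
  proof (rule exI[of _ C2], rule conjI, rule C2(2), intro allI impI)
    fix C1 :: real assume C1: "C1 > 0"
    define h where "h = max 1 (96 * C1 / g\<^sup>2)"
    have h: "1 \<le> h" "96 * C1 / g\<^sup>2 \<le> h" by (auto simp: h_def)
    define r where "r = g / 16"
    have r: "0 < r" "r \<le> 1" using g by (auto simp: r_def)
    define c where "c = 2 * (g / 16)\<^sup>2 / C1\<^sup>2"
    have c: "c > 0" using g C1 by (simp add: c_def)
    \<comment> \<open>The exponent in \<open>tail (g * L / 8) <= n powr (- c0)\<close>, which
      results from \<open>L >= C2 * sqrt (ln n / n)\<close>.\<close>
    define c0 where "c0 = 2 * (g * C2 / 8)\<^sup>2 / C1\<^sup>2"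
    have c0: "c0 > 0" using g C1 C2 by (simp add: c0_def)
    define cc where "cc = min 1 c0 / 2"
    have cc: "cc > 0" using c0 by (simp add: cc_def)
    have "\<forall>\<^sub>F n::nat in sequentially. n \<ge> 2 \<and> ln n \<ge> 1 \<and> ln n \<ge> (h / C2)\<^sup>2 \<and>
        C2 * sqrt (ln n / n) \<le> 1/2 \<and> h / sqrt n \<le> 1/2 \<and> exp (- c * n) * real n ^ 3 \<le> g / 4 \<and>
        exp (1 - ln n) + 5 / r * ln n * exp (- (c0 * ln n)) \<le> real n powr (- (min 1 c0 / 2))"
      (is "\<forall>\<^sub>F n in _. ?P n")
    proof (intro eventually_conj eventually_ge_at_top failure_probability_bound c0)
      show "\<forall>\<^sub>F n::nat in sequentially. ln n \<ge> (1::real)" by real_asymp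
      show "\<forall>\<^sub>F n::nat in sequentially. ln n \<ge> (h / C2)\<^sup>2"
        by (rule eventually_compose_filterlim[OF eventually_ge_at_top]) real_asymp
      show "\<forall>\<^sub>F n::nat in sequentially. C2 * sqrt (ln n / n) \<le> 1/2"
        by (intro eventually_le_of_tendsto_0 tendsto_mult_right_zero; simp?) real_asymp
      have "((\<lambda>n::nat. h / sqrt n) \<longlongrightarrow> 0) sequentially"
        unfolding divide_inverse by (intro tendsto_mult_right_zero) real_asymp
      then show "\<forall>\<^sub>F n::nat in sequentially. h / sqrt n \<le> 1/2"
        by (intro eventually_le_of_tendsto_0) auto
      have "((\<lambda>n::nat. exp (- c * n) * real n ^ 3) \<longlongrightarrow> 0) sequentially" using c by real_asymp
      then show "\<forall>\<^sub>F n::nat in sequentially. exp (- c * n) * real n ^ 3 \<le> g / 4"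
        using g by (intro eventually_le_of_tendsto_0) auto
    qed
    then obtain N where N: "\<And>n. n \<ge> N \<Longrightarrow> ?P n"
      unfolding eventually_sequentially by blast
    show "?Q C2 C1"
    proof (rule exI[of _ "5 / r"], rule conjI, use r in simp, rule exI[of _ cc], rule conjI, rule cc,
        rule exI[of _ N], intro allI impI)
      fix n E lam A
      assume nN: "N \<le> n" and asm: "connected_graph n E \<and> expander lam n E \<and>
            real (max_deg n E) \<le> C1 * avg_deg n E \<and> lam \<le> C2" and A: "A \<subseteq> {..<n}"
        and bias: "C2 * max (lam\<^sup>2) (sqrt (ln (real n) / real n)) \<le> \<bar>bias n E A\<bar>"
      note n = N[OF nN]
      interpret expander_voting n E f f' K lam C1
        using asm n C1 by (intro expander_votingI) auto
      define s where "s = sqrt (ln n / n)"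
      \<comment> \<open>Capped at 1/2 as \<open>surv_biased\<close> requires. The factor 4 in
        \<open>M\<close> leaves a spare 2, so that \<open>M * lam^2 / 2 <= 1/2\<close> keeps
        \<open>small\<close> true for the capped value.\<close>
      define L where "L = min (1/2) (C2 * max (lam\<^sup>2) s)"
      have "C2 * lam\<^sup>2 \<le> C2 * max (lam\<^sup>2) s" using C2 by (intro mult_left_mono) auto
      also have "\<dots> \<le> 1" using bias abs_bias_le_1[OF A] unfolding s_def by linarith
      finally have C2lam: "C2 * lam\<^sup>2 \<le> 1" .
      have "(M * lam)\<^sup>2 \<le> 1\<^sup>2" using C2lam by (simp add: C2_def power_mult_distrib)
      then have Mlam: "M * lam \<le> 1" by (rule power2_le_imp_le) simp
      have KM: "K = M * g / 4" using g by (simp add: M_def)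
      have "K * lam = (M * lam) * (g / 4)" by (simp add: KM)
      also have "\<dots> \<le> 1 * (g / 4)" using Mlam g by (intro mult_right_mono) auto
      finally have Kl: "K * lam \<le> g / 2" using g by simp
      interpret expander_voting_gap n E f f' K lam C1 g
        using g Kl by unfold_locales auto
      have small: "K * lam\<^sup>2 \<le> g / 2 * x" if "L \<le> x" for x
      proof -
        have 1: "M * lam\<^sup>2 \<le> C2 * lam\<^sup>2" using C2 by (intro mult_right_mono) auto
        have 2: "C2 * lam\<^sup>2 \<le> C2 * max (lam\<^sup>2) s" using C2 by (intro mult_left_mono) auto
        have 3: "0 \<le> M * lam\<^sup>2" using M by simp
        have "M * lam\<^sup>2 / 2 \<le> 1/2" using 1 C2lam by linarith
        moreover have "M * lam\<^sup>2 / 2 \<le> C2 * max (lam\<^sup>2) s" using 1 2 3 by linarith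
        ultimately have "M * lam\<^sup>2 / 2 \<le> L" unfolding L_def by (rule min.boundedI)
        then have "g / 2 * (M * lam\<^sup>2 / 2) \<le> g / 2 * x" using that g by (intro mult_left_mono) auto
        then show ?thesis by (simp add: KM)
      qed
      have Cs: "C2 * s \<le> L"
        using n C2 unfolding L_def s_def by (auto intro: mult_left_mono)
      have hs: "h / sqrt n \<le> C2 * s"
      proof -
        have "h / C2 \<le> sqrt (ln n)" using n by (intro real_le_rsqrt) auto
        then have "h \<le> C2 * sqrt (ln n)" using C2 by (simp add: divide_le_eq mult.commute)
        then have "h / sqrt n \<le> C2 * sqrt (ln n) / sqrt n" by (intro divide_right_mono) auto
        then show ?thesis by (simp add: s_def real_sqrt_divide)
      qed
      have Lh: "h / sqrt n \<le> L" using hs Cs by linarith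
      have Ln: "1 / n \<le> L"
      proof -
        have "sqrt (real n * 1) \<le> sqrt (real n * real n)"
          using n by (intro real_sqrt_le_mono mult_left_mono) auto
        then have "1 / n \<le> h / sqrt n" using h(1) n by (intro frac_le) auto
        then show ?thesis using Lh by linarith
      qed
      have tl: "tail (g / 16) * real n ^ 3 \<le> g / 4" using n by (simp add: tail_def c_def)
      have AL: "L \<le> y A" using bias unfolding L_def s_def by linarith
      have L12: "L \<le> 1/2" by (simp add: L_def)
      let ?t = "nat \<lfloor>5 / r * ln n\<rfloor>"
      have t: "real ?t \<le> 5 / r * ln n" using n r by simp
      have s0: "s \<ge> 0" using n by (simp add: s_def)
      have p: "tail (g * L / 8) \<le> exp (- (c0 * ln n))"
      proof -
        have le: "tail (g * L / 8) \<le> tail (g * (C2 * s) / 8)"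
          using Cs g C2 s0 by (intro tail_antimono) (auto intro: mult_left_mono)
        have "s\<^sup>2 * n = ln n" using n by (simp add: s_def)
        moreover have "-2 * (g * (C2 * s) / 8)\<^sup>2 * n / C1\<^sup>2 = - (2 * (g * C2 / 8)\<^sup>2 / C1\<^sup>2 * (s\<^sup>2 * n))"
          by (simp add: power_mult_distrib power_divide mult_ac)
        ultimately have "-2 * (g * (C2 * s) / 8)\<^sup>2 * n / C1\<^sup>2 = - (c0 * ln n)"
          by (simp only: c0_def)
        then have "tail (g * (C2 * s) / 8) = exp (- (c0 * ln n))" by (simp only: tail_def)
        with le show ?thesis by simp
      qed
      have "surv step (dissent n) ?t A \<le> (1 - r) ^ ?t * real n ^ 3 + real ?t * tail (g * L / 8)"
        unfolding r_def by (rule surv_biased[OF small Lh Ln L12 h(2) tl A AL])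
      also have "\<dots> \<le> exp (1 - 5 * ln n) * real n ^ 3 + (5 / r * ln n) * exp (- (c0 * ln n))"
        using n r t p tail_pos[of "g * L / 8"]
        by (intro add_mono mult_right_mono mult_mono power_floor_decay) auto
      also have "real n ^ 3 = exp (3 * ln n)"
        using exp_of_nat_mult[of 3 "ln (real n)"] n by simp
      also have "exp (1 - 5 * ln n) * exp (3 * ln n) = exp (1 - 2 * ln n)" by (simp add: exp_add[symmetric])
      also have "\<dots> \<le> exp (1 - ln n)" using n by simp
      finally have "surv step (dissent n) ?t A \<le> real n powr (- cc)" using n unfolding cc_def by linarith
      then show "\<P>(\<omega> in voting_chain f n E A. ereal_of_enat (T_cons n \<omega>) \<le> ereal (5 / r * ln (real n)))
        \<ge> 1 - real n powr (- cc)"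
        using prob_T_cons_le[OF A t, of f E] by linarith
    qed
  qed
qed

lemma biased_consensus_bound_flat:
  assumes H0: "deriv H 0 = 0"
  shows "\<exists>C2>0. \<forall>C1>0.
       \<exists>B>0. \<exists>c>0. \<exists>N. \<forall>n\<ge>N. \<forall>E lam.
          connected_graph n E \<and> expander lam n E \<and>
          real (max_deg n E) \<le> C1 * avg_deg n E \<and>
          lam \<le> C2 \<longrightarrow>
          (\<forall>A\<subseteq>{..<n}.
             \<bar>bias n E A\<bar> \<ge> C2 * max (lam\<^sup>2) (sqrt (ln (real n) / real n)) \<longrightarrow>
             \<P>(\<omega> in voting_chain f n E A.
                 ereal_of_enat (T_cons n \<omega>)
                   \<le> ereal (B * (ln (ln (real n)) + ln (1 / \<bar>bias n E A\<bar>) + ln (real n) / ln (1 / lam))))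
               \<ge> 1 - real n powr (-c))"
  (is "\<exists>C2>0. \<forall>C1>0. ?Q C2 C1")
proof -
  obtain g where g: "0 < g" "g \<le> 1/2" "\<And>a. a \<in> {0..1/2} \<Longrightarrow> H a \<le> a - 2 * g * a * (1 - 2 * a)"
    by (rule H_gap_exists) blast
  have K2: "K\<^sup>2 \<ge> 1" using K_ge by (simp add: one_le_power)
  \<comment> \<open>The first entry serves the gap conditions; the second gives
    \<open>64 * K^2 * m <= 1\<close> for \<open>m <= 1 / M\<close>, so that
    \<open>8 * K * m <= sqrt m\<close>.\<close>
  define M where "M = max (2 * K / g) (64 * K\<^sup>2)"
  have M: "M \<ge> 64" "M \<ge> 2 * K / g" "M \<ge> 64 * K\<^sup>2" using K2 by (auto simp: M_def)
  define C2 where "C2 = M\<^sup>2"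
  have "M * 1 \<le> M * M" using M(1) by (intro mult_left_mono) auto
  then have "C2 \<ge> M" by (simp add: C2_def power2_eq_square)
  then have C2: "C2 \<ge> M" "C2 > 0" "C2 \<ge> 1" using M(1) by linarith+
  \<comment> \<open>A minority \<open>a\<close> below this mass satisfies
    \<open>(8 * K + 1) * a <= 1/2\<close>, so the squaring phase starts with base 1/2.\<close>
  define al where "al = 1 / (2 * (8 * K + 1))"
  have al: "al > 0" using K_ge by (simp add: al_def)
  define lg where "lg = ln (1 + g * al)"
  have "0 < g * al" using g(1) al by simp
  then have lg: "lg > 0" by (simp add: lg_def)
  \<comment> \<open>Here 39 is 6 for the last phase at rate \<open>lam\<close>, 30 for that phase at
    the floor rate, and 3 for rounding three phase lengths up.\<close>
  define B where "B = 1 / lg + 1 / ln 2 + 39"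
  have B: "B > 0" using lg by (simp add: B_def add_pos_pos)
  show ?thesis
  proof (rule exI[of _ C2], rule conjI, rule C2(2), intro allI impI)
    fix C1 :: real assume C1: "C1 > 0"
    define c0 where "c0 = 2 * (g * al * C2 / 2)\<^sup>2 / C1\<^sup>2"
    have c0: "c0 > 0" using g C1 C2 al by (simp add: c0_def)
    define c1 where "c1 = 2 / C1\<^sup>2"
    have c1: "c1 > 0" using C1 by (simp add: c1_def)
    define cc where "cc = min 1 c0 / 2"
    have cc: "cc > 0" using c0 by (simp add: cc_def)
    have "\<forall>\<^sub>F n::nat in sequentially. n \<ge> 2 \<and> ln (ln n) \<ge> 1 \<and> ln n \<ge> 1 \<and> real n powr (-1/5) \<le> 1 / M \<and>
        c0 * ln n \<le> c1 * real n powr (1/5) \<and>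
        exp (1 - ln n) + 3 * B * ln n * exp (- (c0 * ln n)) \<le> real n powr (- (min 1 c0 / 2))"
      (is "\<forall>\<^sub>F n in _. ?P n")
    proof (intro eventually_conj eventually_ge_at_top failure_probability_bound c0)
      show "\<forall>\<^sub>F n::nat in sequentially. ln (ln n) \<ge> (1::real)" by real_asymp
      show "\<forall>\<^sub>F n::nat in sequentially. ln n \<ge> (1::real)" by real_asymp
      have "((\<lambda>n::nat. real n powr (-1/5)) \<longlongrightarrow> 0) sequentially" by real_asymp
      then show "\<forall>\<^sub>F n::nat in sequentially. real n powr (-1/5) \<le> 1 / M"
        using M by (intro eventually_le_of_tendsto_0) auto
      show "\<forall>\<^sub>F n::nat in sequentially. c0 * ln n \<le> c1 * real n powr (1/5)"
        using c0 c1 by real_asymp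
    qed
    then obtain N where N: "\<And>n. n \<ge> N \<Longrightarrow> ?P n"
      unfolding eventually_sequentially by blast
    show "?Q C2 C1"
    proof (rule exI[of _ B], rule conjI, rule B, rule exI[of _ cc], rule conjI, rule cc,
        rule exI[of _ N], intro allI impI)
      fix n E lam A
      assume nN: "N \<le> n" and asm: "connected_graph n E \<and> expander lam n E \<and>
            real (max_deg n E) \<le> C1 * avg_deg n E \<and> lam \<le> C2" and A: "A \<subseteq> {..<n}"
        and bias: "C2 * max (lam\<^sup>2) (sqrt (ln (real n) / real n)) \<le> \<bar>bias n E A\<bar>"
      note n = N[OF nN]
      interpret expander_voting n E f f' K lam C1
        using asm n C1 by (intro expander_votingI) auto
      define s where "s = sqrt (ln n / n)"
      define L where "L = C2 * max (lam\<^sup>2) s"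
      have AL: "L \<le> y A" using bias unfolding L_def s_def .
      have C2lam: "C2 * lam\<^sup>2 \<le> L" unfolding L_def using C2 by (intro mult_left_mono) auto
      have Cs: "C2 * s \<le> L" unfolding L_def using C2 by (intro mult_left_mono) auto
      have "(M * lam)\<^sup>2 \<le> 1\<^sup>2"
        using C2lam AL abs_bias_le_1[OF A] by (simp add: C2_def power_mult_distrib)
      then have Mlam: "M * lam \<le> 1" by (rule power2_le_imp_le) simp
      then have lamM: "lam \<le> 1 / M" using M(1) by (simp add: field_simps)
      have Kg: "K \<le> M * (g / 2)" using M(2) g by (simp add: field_simps)
      have "K * lam \<le> M * (g / 2) * lam" using Kg lam_nonneg by (intro mult_right_mono)
      also have "\<dots> = (M * lam) * (g / 2)" by simp
      also have "\<dots> \<le> 1 * (g / 2)" using Mlam g by (intro mult_right_mono) auto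
      finally have Kl: "K * lam \<le> g / 2" by simp
      interpret expander_voting_gap n E f f' K lam C1 g
        using g Kl by unfold_locales auto
      have small: "K * lam\<^sup>2 \<le> g / 2 * L"
      proof -
        have "K * lam\<^sup>2 \<le> M * (g / 2) * lam\<^sup>2" using Kg by (intro mult_right_mono) auto
        also have "\<dots> = (g / 2) * (M * lam\<^sup>2)" by simp
        also have "\<dots> \<le> (g / 2) * (C2 * lam\<^sup>2)" using C2 g by (intro mult_left_mono mult_right_mono) auto
        also have "\<dots> \<le> (g / 2) * L" using C2lam g by (intro mult_left_mono) auto
        finally show ?thesis .
      qed
      define p where "p = exp (- (c0 * ln n))"
      have p0: "p > 0" by (simp add: p_def)
      have s0: "s \<ge> 0" using n by (simp add: s_def)
      have "0 \<le> C2 * s" using s0 C2 by simp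
      then have L0: "L \<ge> 0" using Cs by linarith
      have pL: "tail (g * al * L / 2) \<le> p"
      proof -
        have le: "tail (g * al * L / 2) \<le> tail (g * al * (C2 * s) / 2)"
          using Cs g C2 s0 al by (intro tail_antimono) (auto intro!: mult_left_mono)
        have "s\<^sup>2 * n = ln n" using n by (simp add: s_def)
        moreover have "-2 * (g * al * (C2 * s) / 2)\<^sup>2 * n / C1\<^sup>2 = - (2 * (g * al * C2 / 2)\<^sup>2 / C1\<^sup>2 * (s\<^sup>2 * n))"
          by (simp add: power_mult_distrib power_divide mult_ac)
        ultimately have "-2 * (g * al * (C2 * s) / 2)\<^sup>2 * n / C1\<^sup>2 = - (c0 * ln n)"
          by (simp only: c0_def)
        then have "tail (g * al * (C2 * s) / 2) = p" by (simp only: tail_def p_def)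
        with le show ?thesis by simp
      qed
      \<comment> \<open>A floor for the rate of the last phase. The exponent is smaller than 1/4 in
        absolute value, so \<open>w^4 * n\<close> is a positive power of \<open>n\<close>, as
        \<open>tail (m^2)\<close> requires; and \<open>ln (1 / w)\<close> is a fixed fraction of
        \<open>ln n\<close>, so the floor costs boundedly many rounds.\<close>
      define w where "w = real n powr (-1/5)"
      have w0: "w > 0" using n by (simp add: w_def)
      define m where "m = max lam w"
      have wM: "w \<le> 1 / M" using n unfolding w_def by blast
      have m: "lam \<le> m" "w \<le> m" "0 < m" "m \<le> 1 / M" using w0 lamM wM by (auto simp: m_def max_def)
      have "1 / M \<le> 1 / 64" using M(1) by (intro frac_le) auto
      then have m64: "m \<le> 1 / 64" using m(4) by linarith
      have lam1: "lam \<le> 1" using m m64 by linarith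
      have "m * (64 * K\<^sup>2) \<le> (1 / M) * M" using m(3,4) M by (intro mult_mono) auto
      then have mK: "64 * K\<^sup>2 * m \<le> 1" using M(1) by (simp add: mult.commute)
      have "K * 1 \<le> K * K" using K_ge by (intro mult_left_mono) auto
      then have "16 * K * m \<le> 64 * K\<^sup>2 * m" using m(3) K_ge by (intro mult_right_mono) (auto simp: power2_eq_square)
      then have m16: "16 * K * m \<le> 1" using mK by linarith
      have pm: "tail (m\<^sup>2) \<le> p"
      proof -
        have "tail (m\<^sup>2) \<le> tail (w\<^sup>2)" using m w0 by (intro tail_antimono power_mono) auto
        moreover have "(w\<^sup>2)\<^sup>2 * n = real n powr (1/5)"
        proof -
          have "(w\<^sup>2)\<^sup>2 * n = real n powr (-1/5) * real n powr (-1/5) * real n powr (-1/5) * real n powr (-1/5) * real n powr 1"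
            using n by (simp add: w_def power2_eq_square)
          also have "\<dots> = real n powr (1/5)" by (simp only: powr_add[symmetric]) simp
          finally show ?thesis .
        qed
        moreover have "-2 * (w\<^sup>2)\<^sup>2 * n / C1\<^sup>2 = - (c1 * ((w\<^sup>2)\<^sup>2 * n))" by (simp add: c1_def)
        ultimately show ?thesis using n unfolding tail_def p_def by simp
      qed
      have "m * m \<le> m * (1/2)" using m(3) m64 by (intro mult_left_mono) auto
      then have "tail (m / 2) \<le> tail (m\<^sup>2)" by (intro tail_antimono) (auto simp: power2_eq_square)
      then have pm2: "tail (m / 2) \<le> p" using pm by linarith
      have lm: "ln (1 / m) \<ge> 1"
      proof -
        have "exp 1 \<le> (64::real)" using exp_le by linarith
        also have "64 \<le> 1 / m" using m64 m(3) by (simp add: field_simps)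
        finally show ?thesis using m(3) by (subst ln_ge_iff) auto
      qed
      \<comment> \<open>The 6 makes \<open>sqrt m ^ tC\<close> at most \<open>n powr (- 3)\<close>,
        which beats the factor \<open>n^2\<close> of \<open>surv_small_minority\<close> and leaves
        \<open>n powr (- 1)\<close>.\<close>
      define tC where "tC = nat \<lceil>6 * ln n / ln (1 / m)\<rceil>"
      have tC: "6 * ln n / ln (1 / m) \<le> tC" "tC \<le> 6 * ln n / ln (1 / m) + 1"
      proof -
        have "0 \<le> 6 * ln n / ln (1 / m)" using n lm by simp
        then show "6 * ln n / ln (1 / m) \<le> tC" "tC \<le> 6 * ln n / ln (1 / m) + 1"
          unfolding tC_def by linarith+
      qed
      \<comment> \<open>With \<open>2 ^ tB >= ln n\<close> the base 1/2 is driven to at most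
        \<open>n powr (- ln 2)\<close>, which is below \<open>w\<close>.\<close>
      define tB where "tB = nat \<lceil>ln (ln n) / ln 2\<rceil>"
      have tB: "ln (ln n) / ln 2 \<le> tB" "tB \<le> ln (ln n) / ln 2 + 1"
      proof -
        have "0 \<le> ln (ln n) / ln 2" using n by simp
        then show "ln (ln n) / ln 2 \<le> tB" "tB \<le> ln (ln n) / ln 2 + 1"
          unfolding tB_def by linarith+
      qed
      have ysmall: "1 / n \<le> y A"
      proof -
        have "1 / real n \<le> s"
        proof (unfold s_def, rule real_le_rsqrt)
          have "(1 / real n)\<^sup>2 = 1 / n / n" by (simp add: power2_eq_square)
          also have "\<dots> \<le> ln n / n"
          proof (rule divide_right_mono)
            have "1 / real n \<le> 1" using n by simp
            then show "1 / real n \<le> ln n" using n by linarith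
          qed simp
          finally show "(1 / real n)\<^sup>2 \<le> ln n / n" .
        qed
        also have "1 * s \<le> C2 * s" using C2 s0 by (intro mult_right_mono)
        finally show ?thesis using Cs AL by linarith
      qed
      have y0: "y A > 0"
      proof -
        have "0 < 1 / real n" using n by simp
        then show ?thesis using ysmall by linarith
      qed
      have ly: "0 \<le> ln (1 / y A)" "ln (1 / y A) \<le> ln n"
      proof -
        have "1 \<le> 1 / y A" using y0 abs_bias_le_1[OF A] by (simp add: divide_simps)
        then show "0 \<le> ln (1 / y A)" by simp
        have "1 / y A \<le> n" using ysmall y0 n by (simp add: field_simps)
        then show "ln (1 / y A) \<le> ln n" using y0 by (subst ln_le_cancel_iff) (use n in auto)
      qed
      define tA where "tA = nat \<lceil>ln (1 / y A) / lg\<rceil>"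
      have tA: "ln (1 / y A) / lg \<le> tA" "tA \<le> ln (1 / y A) / lg + 1"
      proof -
        have "0 \<le> ln (1 / y A) / lg" using ly lg by simp
        then show "ln (1 / y A) / lg \<le> tA" "tA \<le> ln (1 / y A) / lg + 1"
          unfolding tA_def by linarith+
      qed
      define qC where "qC = exp (- ln n) + tC * p"
      have qC: "surv step (dissent n) tC D \<le> qC" if D: "D \<subseteq> V" "(1 - y D) / 2 \<le> m" for D
      proof -
        have "surv step (dissent n) tC D \<le> (8 * K * m) ^ tC * (real n)\<^sup>2 + tC * tail (m / 2)"
          by (rule surv_small_minority[OF H0 m(1) m16 D])
        also have "\<dots> \<le> exp (- (3 * ln n)) * (real n)\<^sup>2 + tC * p"
        proof (intro add_mono mult_right_mono mult_left_mono pm2)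
          have "(8 * K * m)\<^sup>2 = 64 * K\<^sup>2 * m * m" by (simp add: power2_eq_square)
          also have "\<dots> \<le> 1 * m" using mK m(3) by (intro mult_right_mono) auto
          finally have "8 * K * m \<le> sqrt m" by (intro real_le_rsqrt) simp
          then have "(8 * K * m) ^ tC \<le> sqrt m ^ tC" using K_ge m(3) by (intro power_mono) auto
          also have "sqrt m = exp (- (ln (1 / m) / 2))"
          proof -
            have "exp (- (ln (1 / m) / 2)) = m powr (1/2)" using m(3) by (simp add: powr_def ln_div)
            then show ?thesis using m(3) by (simp add: powr_half_sqrt)
          qed
          also have "exp (- (ln (1 / m) / 2)) ^ tC = exp (- (tC * (ln (1 / m) / 2)))"
            by (simp add: exp_of_nat_mult[symmetric])
          also have "\<dots> \<le> exp (- (3 * ln n))"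
          proof -
            have "6 * ln n / ln (1 / m) * (ln (1 / m) / 2) \<le> tC * (ln (1 / m) / 2)"
              using tC(1) lm by (intro mult_right_mono) auto
            then show ?thesis using lm by simp
          qed
          finally show "(8 * K * m) ^ tC \<le> exp (- (3 * ln n))" .
        qed auto
        also have "(real n)\<^sup>2 = exp (2 * ln n)"
          using exp_of_nat_mult[of 2 "ln (real n)"] n by simp
        also have "exp (- (3 * ln n)) * exp (2 * ln n) = exp (- ln n)" by (simp add: exp_add[symmetric])
        finally show ?thesis by (simp add: qC_def)
      qed
      have qC0: "qC \<ge> 0" using p0 by (simp add: qC_def)
      have qB: "surv step (dissent n) (tB + tC) D \<le> qC + tB * p" if D: "D \<subseteq> V" "(1 - y D) / 2 \<le> al" for D
      proof (rule surv_squaring_phase[OF H0 lam1 m(1,3) qC qC0 pm D(1)])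
        let ?x = "(8 * K + 1) * ((1 - y D) / 2)"
        have "?x \<le> (8 * K + 1) * al" using D(2) K_ge by (intro mult_left_mono) auto
        also have "\<dots> = 1/2" using K_ge by (simp add: al_def)
        finally have "?x ^ (2 ^ tB) \<le> (1/2) ^ (2 ^ tB)"
          using K_ge abs_bias_le_1[OF D(1)] by (intro power_mono) auto
        also have "\<dots> = exp (- (2 ^ tB * ln 2))"
        proof -
          have "exp (- (2 ^ tB * ln 2)) = exp (real (2 ^ tB) * (- ln 2))" by simp
          also have "\<dots> = exp (- ln 2) ^ (2 ^ tB)" by (rule exp_of_nat_mult)
          finally show ?thesis by (simp add: exp_minus inverse_eq_divide)
        qed
        also have "\<dots> \<le> exp (- (ln n / 5))"
        proof -
          have "ln (ln n) \<le> tB * ln 2" using tB(1) by (simp add: divide_le_eq)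
          then have "exp (ln (ln n)) \<le> exp (tB * ln 2)" by simp
          also have "\<dots> = 2 ^ tB" by (simp add: exp_of_nat_mult)
          finally have "ln n \<le> 2 ^ tB" using n by simp
          then have "ln n * (1/5) \<le> 2 ^ tB * ln (2::real)"
            using ln2_ge_two_thirds n by (intro mult_mono) auto
          then show ?thesis by simp
        qed
        also have "\<dots> = w" using n by (simp add: w_def powr_def)
        also have "\<dots> \<le> (8 * K + 1) * m"
        proof -
          have "1 * m \<le> (8 * K + 1) * m" using K_ge m(3) by (intro mult_right_mono) auto
          then show ?thesis using m(2) by linarith
        qed
        finally show "?x ^ (2 ^ tB) \<le> (8 * K + 1) * m" .
      qed
      have qB0: "qC + tB * p \<ge> 0" using qC0 p0 by simp
      have "surv step (dissent n) (tA + (tB + tC)) A \<le> (qC + tB * p) + tA * p"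
      proof (rule surv_growth_phase[OF L0 small al qB qB0 pL A AL])
        have "1 / y A = exp (ln (1 / y A))" using y0 by simp
        also have "\<dots> \<le> exp (tA * lg)" using tA(1) lg by (simp add: divide_le_eq)
        also have "\<dots> = exp lg ^ tA" by (rule exp_of_nat_mult)
        also have "exp lg = 1 + g * al" unfolding lg_def using \<open>0 < g * al\<close> by (intro exp_ln) simp
        finally show "1 \<le> y A * (1 + g * al) ^ tA" using y0 by (simp add: divide_le_eq mult.commute)
      qed
      also have "\<dots> = exp (- ln n) + real (tA + (tB + tC)) * p" by (simp add: qC_def algebra_simps)
      finally have s1: "surv step (dissent n) (tA + (tB + tC)) A \<le> exp (- ln n) + real (tA + (tB + tC)) * p" .
      \<comment> \<open>For \<open>lam = 0\<close> the conventions for division by 0 and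
        \<open>ln 0\<close> make this 0; the estimate of the phase length still holds, since then
        \<open>m = w\<close>.\<close>
      define R where "R = ln n / ln (1 / lam)"
      have R: "0 \<le> R" "R \<le> ln n" "6 * ln n / ln (1 / m) \<le> 6 * R + 30"
      proof -
        show R0: "0 \<le> R" using n lam1 lam_nonneg by (cases "lam = 0") (auto simp: R_def)
        show "R \<le> ln n"
        proof (cases "lam = 0")
          case True
          then show ?thesis using n by (simp add: R_def)
        next
          case False
          then have "lam > 0" using lam_nonneg by simp
          then have "ln (1 / m) \<le> ln (1 / lam)" using m(1,3) by (simp add: ln_div)
          then have "1 \<le> ln (1 / lam)" using lm by linarith
          then show ?thesis using n by (simp add: R_def divide_le_eq mult_le_cancel_left1)
        qed
        show "6 * ln n / ln (1 / m) \<le> 6 * R + 30"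
        proof (cases "lam \<ge> w")
          case True
          then show ?thesis by (simp add: R_def m_def max_def)
        next
          case False
          then have "m = w" by (simp add: m_def)
          then have "ln (1 / m) = ln n / 5" using n by (simp add: w_def ln_div ln_powr)
          then have ln_n: "ln n = 5 * ln (1 / m)" by simp
          have "6 * (5 * x) / x = 30" if "x \<noteq> 0" for x :: real using that by simp
          moreover have "ln (1 / m) \<noteq> 0" using lm by linarith
          ultimately have "6 * ln n / ln (1 / m) = 30" unfolding ln_n by blast
          then show ?thesis using R0 by simp
        qed
      qed
      define X where "X = ln (ln n) + ln (1 / y A) + R"
      have T: "real (tA + (tB + tC)) \<le> B * X"
      proof -
        define u where "u = ln (ln n)"
        have u: "u \<ge> 1" using n by (simp add: u_def)
        have l2: "1 / ln (2::real) > 0" by simp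
        have "real (tA + (tB + tC)) \<le> (1 / lg) * ln (1 / y A) + (1 / ln 2) * u + 6 * R + 33"
          using tA(2) tB(2) tC(2) R(3) by (simp add: u_def)
        also have "\<dots> \<le> (1 / lg) * X + (1 / ln 2) * X + 6 * X + 33 * X"
        proof (intro add_mono mult_left_mono)
          show "ln (1 / y A) \<le> X" "u \<le> X" "R \<le> X" using u ly R unfolding X_def u_def[symmetric] by linarith+
          have "1 \<le> X" using u ly R unfolding X_def u_def[symmetric] by linarith
          then show "33 \<le> 33 * X" by simp
        qed (use lg l2 in auto)
        also have "\<dots> = B * X" by (simp add: B_def algebra_simps)
        finally show ?thesis .
      qed
      have "X \<le> 3 * ln n"
      proof -
        have "ln (ln n) \<le> ln n - 1" using n by (intro ln_le_minus_one) auto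
        then show ?thesis using ly R unfolding X_def by linarith
      qed
      then have "B * X \<le> B * (3 * ln n)" using B by (intro mult_left_mono) auto
      then have "real (tA + (tB + tC)) * p \<le> 3 * B * ln n * p"
        using T p0 by (intro mult_right_mono) auto
      moreover have "exp (- ln n) \<le> exp (1 - ln n)" by simp
      ultimately have "surv step (dissent n) (tA + (tB + tC)) A \<le> real n powr (- cc)"
        using s1 n unfolding cc_def p_def by linarith
      then show "\<P>(\<omega> in voting_chain f n E A.
                 ereal_of_enat (T_cons n \<omega>)
                   \<le> ereal (B * (ln (ln (real n)) + ln (1 / \<bar>bias n E A\<bar>) + ln (real n) / ln (1 / lam))))
               \<ge> 1 - real n powr (- cc)"
        using prob_T_cons_le[OF A T, of f E] unfolding X_def R_def by linarith
    qed
  qed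
qed

end

theorem corollary1p12:
  fixes f :: "real \<Rightarrow> real"
  assumes "quasi_majority f"
  shows
    "(\<forall>C1>0.
       (\<exists>K>0. \<exists>c>0. \<exists>N. \<forall>n\<ge>N. \<forall>E lam.
          connected_graph n E \<and> expander lam n E \<and>
          real (max_deg n E) \<le> C1 * avg_deg n E \<and>
          lam \<le> C1 * real n powr (-1/4) \<longrightarrow>
          (\<forall>A\<subseteq>{..<n}.
             \<P>(\<omega> in voting_chain f n E A. ereal_of_enat (T_cons n \<omega>) \<le> ereal (K * ln (real n)))
               \<ge> 1 - real n powr (-c))) \<and>
       (\<exists>k>0. \<exists>c>0. \<exists>N. \<forall>n\<ge>N. \<forall>E lam.
          connected_graph n E \<and> expander lam n E \<and>
          real (max_deg n E) \<le> C1 * avg_deg n E \<and>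
          lam \<le> C1 * real n powr (-1/4) \<longrightarrow>
          (\<exists>A\<subseteq>{..<n}.
             \<P>(\<omega> in voting_chain f n E A. ereal_of_enat (T_cons n \<omega>) \<ge> ereal (k * ln (real n)))
               \<ge> 1 - real n powr (-c)))) \<and>
     (\<exists>C2>0. \<forall>C1>0.
       \<exists>K>0. \<exists>c>0. \<exists>N. \<forall>n\<ge>N. \<forall>E lam.
          connected_graph n E \<and> expander lam n E \<and>
          real (max_deg n E) \<le> C1 * avg_deg n E \<and>
          lam \<le> C2 \<longrightarrow>
          (\<forall>A\<subseteq>{..<n}.
             \<bar>bias n E A\<bar> \<ge> C2 * max (lam\<^sup>2) (sqrt (ln (real n) / real n)) \<longrightarrow>
             \<P>(\<omega> in voting_chain f n E A. ereal_of_enat (T_cons n \<omega>) \<le> ereal (K * ln (real n)))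
               \<ge> 1 - real n powr (-c))) \<and>
     (deriv (updating_function f) 0 = 0 \<longrightarrow>
     (\<exists>C2>0. \<forall>C1>0.
       \<exists>K>0. \<exists>c>0. \<exists>N. \<forall>n\<ge>N. \<forall>E lam.
          connected_graph n E \<and> expander lam n E \<and>
          real (max_deg n E) \<le> C1 * avg_deg n E \<and>
          lam \<le> C2 \<longrightarrow>
          (\<forall>A\<subseteq>{..<n}.
             \<bar>bias n E A\<bar> \<ge> C2 * max (lam\<^sup>2) (sqrt (ln (real n) / real n)) \<longrightarrow>
             \<P>(\<omega> in voting_chain f n E A.
                 ereal_of_enat (T_cons n \<omega>)
                   \<le> ereal (K * (ln (ln (real n)) + ln (1 / \<bar>bias n E A\<bar>) + ln (real n) / ln (1 / lam))))
               \<ge> 1 - real n powr (-c))))"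
proof -
  obtain f' K where "quasi_majority_voting f f' K"
    by (rule quasi_majority_voting_exists[OF assms])
  then interpret quasi_majority_voting f f' K .
  show ?thesis
    by (intro conjI allI impI consensus_upper_bound consensus_lower_bound
        biased_consensus_bound biased_consensus_bound_flat)
qed

end
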